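(* Let $X$ be either a hypersurface $X_8$ of degree $8$ in the weighted projective space $\mathbb{P}(1:1:1:1:4)$ or a hypersurface $X_{10}$ of degree $10$ in the weighted projective space $\mathbb{P}(1:1:1:2:5)$, and assume that $X$ has no singularities other than ordinary triple points. Then $X$ has no ordinary triple points.
   Context: All varieties are over $\mathbb{C}$. $\mathbb{P}(a_0:\dots:a_4)$ denotes the weighted projective space with coordinates of weights $a_0,\dots,a_4$, and a hypersurface of degree $d$ in it is the zero locus of a weighted homogeneous polynomial of degree $d$. An ordinary triple point on a threefold $X$ is an isolated singularity $O$ of $X$ such that the tangent cone to $X$ at $O$ is a cone over a smooth surface of degree three (a smooth cubic surface in $\mathbb{P}^3$). *)

theory Defs
  imports
    Complex_Main
    "HOL-Library.Poly_Mapping"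
    "HOL-Library.Numeral_Type"
    "HOL-Computational_Algebra.Fraction_Field"
begin

section \<open>Polynomials in variables indexed by a finite type\<close>

type_synonym 'n cpoly = "('n \<Rightarrow>\<^sub>0 nat) \<Rightarrow>\<^sub>0 complex"

text \<open>
  Evaluation at a family \<open>x\<close> of elements of a commutative \<open>\<complex>\<close>-algebra whose structure map
  is \<open>\<phi>\<close>.
\<close>

definition peval :: "(complex \<Rightarrow> 'b::comm_ring_1) \<Rightarrow> ('n::finite \<Rightarrow> 'b) \<Rightarrow> 'n cpoly \<Rightarrow> 'b" where
  "peval \<phi> x p = (\<Sum>m\<in>Poly_Mapping.keys p.
      \<phi> (Poly_Mapping.lookup p m) * (\<Prod>i\<in>UNIV. x i ^ Poly_Mapping.lookup m i))"

abbreviation poly_at :: "('n::finite \<Rightarrow> complex) \<Rightarrow> 'n cpoly \<Rightarrow> complex" where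
  "poly_at \<equiv> peval (\<lambda>c. c)"

definition pderivative :: "'n \<Rightarrow> 'n cpoly \<Rightarrow> 'n cpoly" where
  "pderivative i p = (\<Sum>m\<in>Poly_Mapping.keys p.
      Poly_Mapping.single (m - Poly_Mapping.single i 1)
        (of_nat (Poly_Mapping.lookup m i) * Poly_Mapping.lookup p m))"

text \<open>The zero polynomial is weighted homogeneous of every degree.\<close>

definition whomogeneous :: "('n::finite \<Rightarrow> nat) \<Rightarrow> nat \<Rightarrow> 'n cpoly \<Rightarrow> bool" where
  "whomogeneous a d p \<longleftrightarrow>
     (\<forall>m\<in>Poly_Mapping.keys p. (\<Sum>i\<in>UNIV. a i * Poly_Mapping.lookup m i) = d)"


section \<open>Weighted projective space and its hypersurfaces\<close>

text \<open>
  A point of \<open>\<P>(a)\<close> is an orbit of \<open>\<complex>\<^sup>*\<close> acting on the nonzero vectors with weights \<open>a\<close>.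
\<close>

definition wproj_rel :: "('n \<Rightarrow> nat) \<Rightarrow> (('n \<Rightarrow> complex) \<times> ('n \<Rightarrow> complex)) set" where
  "wproj_rel a = {(x, y). x \<noteq> (\<lambda>_. 0) \<and> y \<noteq> (\<lambda>_. 0) \<and>
     (\<exists>l. l \<noteq> 0 \<and> (\<forall>i. y i = l ^ a i * x i))}"

definition wproj :: "('n \<Rightarrow> nat) \<Rightarrow> ('n \<Rightarrow> complex) set set" where
  "wproj a = {x. x \<noteq> (\<lambda>_. 0)} // wproj_rel a"

text \<open>
  Used for weighted homogeneous \<open>G\<close> only, whose vanishing at \<open>p\<close> does not depend on the
  representative.
\<close>

definition vanishes_at :: "'n::finite cpoly \<Rightarrow> ('n \<Rightarrow> complex) set \<Rightarrow> bool" where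
  "vanishes_at G p \<longleftrightarrow> (\<forall>x\<in>p. poly_at x G = 0)"

definition wproj_hypersurface ::
    "('n::finite \<Rightarrow> nat) \<Rightarrow> nat \<Rightarrow> ('n \<Rightarrow> complex) set set \<Rightarrow> bool" where
  "wproj_hypersurface a d X \<longleftrightarrow>
     (\<exists>F. F \<noteq> 0 \<and> whomogeneous a d F \<and> X = {p \<in> wproj a. vanishes_at F p})"


section \<open>Local rings\<close>

text \<open>
  A closed subset \<open>X\<close> of \<open>\<P>(a)\<close> carries its structure of a variety, so that its local ring at
  \<open>p\<close> is \<open>local_ring a p\<close> (the local ring of \<open>\<P>(a)\<close>, which consists of the fractions of degree
  \<open>0\<close> that are defined at \<open>p\<close>) modulo \<open>vanishing_ideal a X p\<close>. The quotient is not formed: the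
  \<open>k\<close>-th power of the maximal ideal of the local ring of \<open>X\<close> is represented by its preimage
  \<open>local_filtration a X p k\<close> in \<open>local_ring a p\<close>.
\<close>

hide_const (open) Rat.Fract

type_synonym 'n rational_function = "'n cpoly fract"

definition const_fun :: "complex \<Rightarrow> ('n::linorder) rational_function" where
  "const_fun c = Fract (Poly_Mapping.single 0 c) 1"

definition local_ring ::
    "('n::{finite,linorder} \<Rightarrow> nat) \<Rightarrow> ('n \<Rightarrow> complex) set \<Rightarrow> 'n rational_function set" where
  "local_ring a p = {Fract G H | G H e.
     whomogeneous a e G \<and> whomogeneous a e H \<and> \<not> vanishes_at H p}"

definition maximal_ideal_at ::
    "('n::{finite,linorder} \<Rightarrow> nat) \<Rightarrow> ('n \<Rightarrow> complex) set \<Rightarrow> 'n rational_function set" where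
  "maximal_ideal_at a p = {Fract G H | G H e.
     whomogeneous a e G \<and> whomogeneous a e H \<and> \<not> vanishes_at H p \<and> vanishes_at G p}"

text \<open>
  The fractions that vanish on a neighbourhood of \<open>p\<close> in \<open>X\<close>: multiplying numerator and
  denominator by a form that does not vanish at \<open>p\<close>, one may assume that the numerator vanishes
  on all of \<open>X\<close>.
\<close>

definition vanishing_ideal ::
    "('n::{finite,linorder} \<Rightarrow> nat) \<Rightarrow> ('n \<Rightarrow> complex) set set \<Rightarrow> ('n \<Rightarrow> complex) set
      \<Rightarrow> 'n rational_function set" where
  "vanishing_ideal a X p = {Fract G H | G H e.
     whomogeneous a e G \<and> whomogeneous a e H \<and> \<not> vanishes_at H p \<and> (\<forall>q\<in>X. vanishes_at G q)}"

fun maximal_ideal_power ::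
    "('n::{finite,linorder} \<Rightarrow> nat) \<Rightarrow> ('n \<Rightarrow> complex) set \<Rightarrow> nat \<Rightarrow> 'n rational_function set" where
  "maximal_ideal_power a p 0 = local_ring a p"
| "maximal_ideal_power a p (Suc k) = {\<Sum>i<n. f i * g i | (n::nat) f g.
     \<forall>i<n. f i \<in> maximal_ideal_at a p \<and> g i \<in> maximal_ideal_power a p k}"

definition local_filtration ::
    "('n::{finite,linorder} \<Rightarrow> nat) \<Rightarrow> ('n \<Rightarrow> complex) set set \<Rightarrow> ('n \<Rightarrow> complex) set \<Rightarrow> nat
      \<Rightarrow> 'n rational_function set" where
  "local_filtration a X p k =
     {f + g | f g. f \<in> maximal_ideal_power a p k \<and> g \<in> vanishing_ideal a X p}"


section \<open>Singularities of threefolds\<close>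

text \<open>
  The Zariski cotangent space \<open>\<mm>/\<mm>\<^sup>2\<close> of \<open>X\<close> at \<open>p\<close> has a basis consisting of the classes of
  \<open>t 0, \<dots>, t (n - 1)\<close>.
\<close>

definition cotangent_dim ::
    "('n::{finite,linorder} \<Rightarrow> nat) \<Rightarrow> ('n \<Rightarrow> complex) set set \<Rightarrow> ('n \<Rightarrow> complex) set \<Rightarrow> nat
      \<Rightarrow> bool" where
  "cotangent_dim a X p n \<longleftrightarrow> (\<exists>t :: nat \<Rightarrow> 'n rational_function.
     (\<forall>i<n. t i \<in> local_filtration a X p 1) \<and>
     (\<forall>f \<in> local_filtration a X p 1. \<exists>c.
        f - (\<Sum>i<n. const_fun (c i) * t i) \<in> local_filtration a X p 2) \<and>
     (\<forall>c. (\<Sum>i<n. const_fun (c i) * t i) \<in> local_filtration a X p 2 \<longrightarrow> (\<forall>i<n. c i = 0)))"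

text \<open>
  A point of a threefold is nonsingular iff its Zariski tangent space has dimension \<open>3\<close>. The
  definition is meant for \<open>X\<close> of pure dimension \<open>3\<close>, such as a hypersurface in a
  four-dimensional weighted projective space.
\<close>

definition singular_point_3fold ::
    "('n::{finite,linorder} \<Rightarrow> nat) \<Rightarrow> ('n \<Rightarrow> complex) set set \<Rightarrow> ('n \<Rightarrow> complex) set \<Rightarrow> bool" where
  "singular_point_3fold a X p \<longleftrightarrow> p \<in> X \<and> \<not> cotangent_dim a X p 3"

definition isolated_singular_point_3fold ::
    "('n::{finite,linorder} \<Rightarrow> nat) \<Rightarrow> ('n \<Rightarrow> complex) set set \<Rightarrow> ('n \<Rightarrow> complex) set \<Rightarrow> bool" where
  "isolated_singular_point_3fold a X p \<longleftrightarrow> singular_point_3fold a X p \<and>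
     (\<exists>H e. whomogeneous a e H \<and> \<not> vanishes_at H p \<and>
        (\<forall>q\<in>X. \<not> vanishes_at H q \<and> q \<noteq> p \<longrightarrow> \<not> singular_point_3fold a X q))"

definition smooth_cubic_surface_form :: "4 cpoly \<Rightarrow> bool" where
  "smooth_cubic_surface_form c \<longleftrightarrow> c \<noteq> 0 \<and> whomogeneous (\<lambda>_. 1) 3 c \<and>
     \<not> (\<exists>x. x \<noteq> (\<lambda>_. 0) \<and> poly_at x c = 0 \<and> (\<forall>i. poly_at x (pderivative i c) = 0))"

text \<open>
  The tangent cone of \<open>X\<close> at \<open>p\<close> is the spectrum of the associated graded algebra of the local
  ring of \<open>X\<close> at \<open>p\<close>. It is isomorphic to the cone \<open>c = 0\<close> iff for some family \<open>t\<close> in the maximal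
  ideal, the homomorphism of graded \<open>\<complex>\<close>-algebras that maps the variable with index \<open>i\<close> to the
  class of \<open>t i\<close> in degree \<open>1\<close> is surjective with kernel generated by \<open>c\<close>.
\<close>

definition tangent_cone_iso ::
    "('n::{finite,linorder} \<Rightarrow> nat) \<Rightarrow> ('n \<Rightarrow> complex) set set \<Rightarrow> ('n \<Rightarrow> complex) set
      \<Rightarrow> 'm::{finite,linorder} cpoly \<Rightarrow> bool" where
  "tangent_cone_iso a X p c \<longleftrightarrow> (\<exists>t :: 'm \<Rightarrow> 'n rational_function.
     (\<forall>i. t i \<in> local_filtration a X p 1) \<and>
     (\<forall>k. \<forall>f \<in> local_filtration a X p k. \<exists>g. whomogeneous (\<lambda>_. 1) k g \<and>
        f - peval const_fun t g \<in> local_filtration a X p (Suc k)) \<and>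
     (\<forall>k g. whomogeneous (\<lambda>_. 1) k g \<longrightarrow>
        (peval const_fun t g \<in> local_filtration a X p (Suc k) \<longleftrightarrow> c dvd g)))"

definition ordinary_triple_point ::
    "('n::{finite,linorder} \<Rightarrow> nat) \<Rightarrow> ('n \<Rightarrow> complex) set set \<Rightarrow> ('n \<Rightarrow> complex) set \<Rightarrow> bool" where
  "ordinary_triple_point a X p \<longleftrightarrow> isolated_singular_point_3fold a X p \<and>
     (\<exists>c :: 4 cpoly. smooth_cubic_surface_form c \<and> tangent_cone_iso a X p c)"


section \<open>The two weighted projective spaces\<close>

text \<open>The elements of the type \<open>5\<close> are \<open>0, 1, 2, 3, 4\<close>.\<close>

definition weights_11114 :: "5 \<Rightarrow> nat" where
  "weights_11114 = (\<lambda>_. 1)(4 := 4)"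

definition weights_11125 :: "5 \<Rightarrow> nat" where
  "weights_11125 = (\<lambda>_. 1)(3 := 2, 4 := 5)"

end

theory Submission
  imports Defs "HOL-Computational_Algebra.Fundamental_Theorem_Algebra"
begin

hide_const (open) Rat.Fract

text \<open>
  Let \<open>X\<close> be given by \<open>F\<close>, let \<open>w\<close> be the last coordinate, so that \<open>deg F\<close> is twice the weight
  of \<open>w\<close>, and let \<open>x\<^sub>0, x\<^sub>1, \<dots>\<close> be the coordinates of weight one. For \<open>X\<^sub>1\<^sub>0\<close> let \<open>y\<close> be the
  coordinate of weight two. Two facts decide the matter: at a quotient singularity of the ambient
  space the cotangent space of \<open>X\<close> is too large for an ordinary triple point, and elsewhere the
  multiplicity of \<open>X\<close> is too small.

  Suppose that a coordinate point \<open>e\<^sub>k\<close> whose coordinate has weight \<open>r > 1\<close> lies on \<open>X\<close>.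
  Locally, functions on the ambient space are \<open>\<mu>\<^sub>r\<close>-invariant functions of the other coordinates.
  The initial forms of functions in the maximal ideal have weighted order at least \<open>r\<close>, those of
  its square have order at least \<open>2r\<close>, and a function vanishing on \<open>X\<close> has an initial form that
  vanishes on the initial cone of \<open>F\<close>. Five invariant forms of order \<open>r\<close> stay linearly
  independent on that cone, because the cone is a hypersurface and so projects onto a plane or
  three-space in which the forms already are independent. Hence the cotangent space has dimension at
  least five (\<open>quotient_point_large_cotangent\<close>), whereas it has dimension three at a nonsingular
  point and four at an ordinary triple point.

  This applies to the vertex of \<open>w\<close>: if it were on \<open>X\<close>, it would be singular, hence by assumption
  an ordinary triple point, which is impossible. So \<open>w\<^sup>2\<close> occurs in \<open>F\<close> and \<open>X\<close> is a double cover
  of a weighted projective space. If some \<open>x\<^sub>i\<close> does not vanish at a point \<open>p\<close> of \<open>X\<close>, then the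
  ambient space is smooth there and the local equation of \<open>X\<close> contains \<open>w\<^sup>2\<close>; so it has a
  nonzero linear or quadratic part, while the graded algebra of a cubic cone has no relation in
  degrees one and two (\<open>double_cover_no_cubic_cone\<close>). On \<open>X\<^sub>8\<close> there are no other points.
  On \<open>X\<^sub>1\<^sub>0\<close> there remains the line on which all \<open>x\<^sub>i\<close> vanish, where \<open>F\<close> restricts to
  \<open>c w\<^sup>2 + e y\<^sup>5\<close>: a zero with \<open>y \<noteq> 0 \<noteq> w\<close> is simple, so \<open>X\<close> is nonsingular there
  (\<open>open_edge_no_triple_point\<close>), and the only other possible point is the vertex of \<open>y\<close>, a quotient
  singularity of order two, to which the first fact applies again.
\<close>

section \<open>Evaluation of polynomials\<close>

lemma poly_mapping_sum_monomials:
  fixes p :: "'k \<Rightarrow>\<^sub>0 'c::comm_monoid_add"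
  shows "p = (\<Sum>m\<in>Poly_Mapping.keys p. Poly_Mapping.single m (Poly_Mapping.lookup p m))"
proof (rule poly_mapping_eqI)
  fix k
  have "(\<Sum>m\<in>Poly_Mapping.keys p. Poly_Mapping.lookup (Poly_Mapping.single m (Poly_Mapping.lookup p m)) k)
      = (\<Sum>m\<in>Poly_Mapping.keys p. if k = m then Poly_Mapping.lookup p m else 0)"
    by (intro sum.cong) (auto simp: lookup_single when_def)
  also have "\<dots> = Poly_Mapping.lookup p k"
    by (simp add: sum.delta in_keys_iff)
  finally show "Poly_Mapping.lookup p k =
      Poly_Mapping.lookup (\<Sum>m\<in>Poly_Mapping.keys p. Poly_Mapping.single m (Poly_Mapping.lookup p m)) k"
    by (simp add: lookup_sum)
qed

text \<open>
  Evaluation at complex points and substitution of rational functions for the variables are the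
  two instances needed below.
\<close>

locale ring_map =
  fixes \<phi> :: "complex \<Rightarrow> 'b::comm_ring_1"
  assumes map_add: "\<phi> (u + v) = \<phi> u + \<phi> v"
    and map_mult: "\<phi> (u * v) = \<phi> u * \<phi> v"
    and map_one: "\<phi> 1 = 1"
begin

lemma map_zero: "\<phi> 0 = 0"
  using map_add[of 0 0] by simp

lemma map_uminus: "\<phi> (- u) = - \<phi> u"
  using map_add[of u "- u"] map_zero by (simp add: eq_neg_iff_add_eq_0 add.commute)

lemma map_sum: "\<phi> (sum f A) = (\<Sum>i\<in>A. \<phi> (f i))"
  by (induction A rule: infinite_finite_induct) (auto simp: map_zero map_add)

lemma peval_superset:
  assumes "finite S" "Poly_Mapping.keys p \<subseteq> S"
  shows "peval \<phi> x p = (\<Sum>m\<in>S. \<phi> (Poly_Mapping.lookup p m) * (\<Prod>i\<in>UNIV. x i ^ Poly_Mapping.lookup m i))"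
  unfolding peval_def using assms
  by (intro sum.mono_neutral_left) (auto simp: in_keys_iff map_zero)

lemma peval_zero [simp]: "peval \<phi> x 0 = 0"
  by (simp add: peval_def)

lemma peval_add: "peval \<phi> x (p + q) = peval \<phi> x p + peval \<phi> x q"
proof -
  let ?S = "Poly_Mapping.keys p \<union> Poly_Mapping.keys q"
  have "peval \<phi> x (p + q) = (\<Sum>m\<in>?S. \<phi> (Poly_Mapping.lookup (p + q) m) * (\<Prod>i\<in>UNIV. x i ^ Poly_Mapping.lookup m i))"
    using Poly_Mapping.keys_add[of p q] by (intro peval_superset) auto
  then show ?thesis
    by (simp add: peval_superset[of ?S p] peval_superset[of ?S q] lookup_add map_add
        distrib_right sum.distrib)
qed

lemma peval_sum: "peval \<phi> x (sum f A) = (\<Sum>i\<in>A. peval \<phi> x (f i))"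
  by (induction A rule: infinite_finite_induct) (auto simp: peval_add)

lemma peval_single:
  "peval \<phi> x (Poly_Mapping.single m c) = \<phi> c * (\<Prod>i\<in>UNIV. x i ^ Poly_Mapping.lookup m i)"
  using peval_superset[of "{m}" "Poly_Mapping.single m c"] by simp

lemma peval_const: "peval \<phi> x (Poly_Mapping.single 0 c) = \<phi> c"
  by (simp add: peval_single)

lemma peval_one: "peval \<phi> x 1 = 1"
  using peval_const[of x 1] by (simp add: map_one)

lemma peval_mult: "peval \<phi> x (p * q) = peval \<phi> x p * peval \<phi> x q"
proof -
  have *: "peval \<phi> x (Poly_Mapping.single m c * Poly_Mapping.single n d)
      = peval \<phi> x (Poly_Mapping.single m c) * peval \<phi> x (Poly_Mapping.single n d)" for m n c d
    by (simp add: mult_single peval_single map_mult lookup_add power_add prod.distrib)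
  have "p * q = (\<Sum>m\<in>Poly_Mapping.keys p. Poly_Mapping.single m (Poly_Mapping.lookup p m)) *
      (\<Sum>m\<in>Poly_Mapping.keys q. Poly_Mapping.single m (Poly_Mapping.lookup q m))"
    using poly_mapping_sum_monomials[of p] poly_mapping_sum_monomials[of q] by simp
  also have "peval \<phi> x \<dots> =
      peval \<phi> x (\<Sum>m\<in>Poly_Mapping.keys p. Poly_Mapping.single m (Poly_Mapping.lookup p m)) *
      peval \<phi> x (\<Sum>m\<in>Poly_Mapping.keys q. Poly_Mapping.single m (Poly_Mapping.lookup q m))"
    by (simp add: sum_product peval_sum * )
  finally show ?thesis
    using poly_mapping_sum_monomials[of p] poly_mapping_sum_monomials[of q] by simp
qed

lemma peval_power: "peval \<phi> x (p ^ n) = peval \<phi> x p ^ n"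
  by (induction n) (auto simp: peval_one peval_mult)

lemma peval_uminus: "peval \<phi> x (- p) = - peval \<phi> x p"
  using peval_add[of x p "- p"] by (simp add: eq_neg_iff_add_eq_0 add.commute)

lemma peval_diff: "peval \<phi> x (p - q) = peval \<phi> x p - peval \<phi> x q"
  using peval_add[of x p "- q"] by (simp add: peval_uminus)

end

definition pvar :: "'n \<Rightarrow> 'n cpoly" where
  "pvar i = Poly_Mapping.single (Poly_Mapping.single i 1) 1"

lemma (in ring_map) peval_pvar [simp]: "peval \<phi> x (pvar i) = x i"
proof -
  have "(\<Prod>j\<in>UNIV. x j ^ Poly_Mapping.lookup (Poly_Mapping.single i (1::nat)) j)
      = (\<Prod>j\<in>UNIV. if i = j then x j else 1)"
    by (intro prod.cong) (auto simp: lookup_single when_def)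
  then show ?thesis
    by (simp add: pvar_def peval_single map_one)
qed

interpretation poly_at: ring_map "\<lambda>c::complex. c"
  by unfold_locales auto

lemmas poly_at_simps [simp] = poly_at.peval_add poly_at.peval_mult poly_at.peval_diff
  poly_at.peval_uminus poly_at.peval_power poly_at.peval_one poly_at.peval_const poly_at.peval_sum

interpretation const_fun: ring_map "const_fun :: complex \<Rightarrow> 'n::linorder rational_function"
  by unfold_locales (auto simp: const_fun_def single_add mult_single One_fract_def)

subsection \<open>Weighted homogeneous polynomials\<close>

lemma whomogeneous_single:
  "(\<Sum>i\<in>UNIV. a i * Poly_Mapping.lookup m i) = d \<Longrightarrow> whomogeneous a d (Poly_Mapping.single m c)"
  by (auto simp: whomogeneous_def)

lemma whomogeneous_const: "whomogeneous a 0 (Poly_Mapping.single 0 c)"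
  by (simp add: whomogeneous_single)

lemma whomogeneous_one: "whomogeneous a 0 1"
  using whomogeneous_const[of a 1] by simp

lemma whomogeneous_pvar: "whomogeneous a (a i) (pvar i)"
proof -
  have "(\<Sum>j\<in>UNIV. a j * Poly_Mapping.lookup (Poly_Mapping.single i (1::nat)) j)
      = (\<Sum>j\<in>UNIV. if i = j then a j else 0)"
    by (intro sum.cong) (auto simp: lookup_single when_def)
  then show ?thesis
    unfolding pvar_def by (intro whomogeneous_single) simp
qed

lemma whomogeneous_add: "whomogeneous a d p \<Longrightarrow> whomogeneous a d q \<Longrightarrow> whomogeneous a d (p + q)"
  using Poly_Mapping.keys_add[of p q] unfolding whomogeneous_def by blast

lemma whomogeneous_zero: "whomogeneous a d 0"
  by (simp add: whomogeneous_def)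

lemma whomogeneous_uminus: "whomogeneous a d p \<Longrightarrow> whomogeneous a d (- p)"
  by (auto simp: whomogeneous_def in_keys_iff)

lemma whomogeneous_diff: "whomogeneous a d p \<Longrightarrow> whomogeneous a d q \<Longrightarrow> whomogeneous a d (p - q)"
  using whomogeneous_add[of a d p "- q"] whomogeneous_uminus by fastforce

lemma whomogeneous_mult:
  assumes "whomogeneous a d p" "whomogeneous a e q"
  shows "whomogeneous a (d + e) (p * q)"
  unfolding whomogeneous_def
proof
  fix m assume "m \<in> Poly_Mapping.keys (p * q)"
  then obtain u v where "u \<in> Poly_Mapping.keys p" "v \<in> Poly_Mapping.keys q" "m = u + v"
    using keys_mult[of p q] by blast
  then show "(\<Sum>i\<in>UNIV. a i * Poly_Mapping.lookup m i) = d + e"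
    using assms by (simp add: whomogeneous_def lookup_add distrib_left sum.distrib)
qed

lemma whomogeneous_cmult:
  "whomogeneous a d p \<Longrightarrow> whomogeneous a d (Poly_Mapping.single 0 c * p)"
  using whomogeneous_mult[OF whomogeneous_const] by fastforce

lemma whomogeneous_power: "whomogeneous a d p \<Longrightarrow> whomogeneous a (n * d) (p ^ n)"
  by (induction n) (auto simp: whomogeneous_one intro: whomogeneous_mult)

lemma (in ring_map) peval_scale:
  assumes "whomogeneous a d p"
  shows "peval \<phi> (\<lambda>i. l ^ a i * x i) p = l ^ d * peval \<phi> x p"
proof -
  have "(\<Prod>i\<in>UNIV. (l ^ a i * x i) ^ Poly_Mapping.lookup m i)
      = l ^ d * (\<Prod>i\<in>UNIV. x i ^ Poly_Mapping.lookup m i)" if "m \<in> Poly_Mapping.keys p" for m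
    using assms that
    by (simp add: whomogeneous_def power_mult_distrib prod.distrib power_sum[symmetric]
        flip: power_mult)
  then show ?thesis
    unfolding peval_def by (simp add: sum_distrib_left mult_ac)
qed

lemmas poly_at_scale = poly_at.peval_scale

lemma monomial_eq_prod:
  fixes m :: "'n::finite \<Rightarrow>\<^sub>0 nat"
  shows "Poly_Mapping.single m c = Poly_Mapping.single 0 c * (\<Prod>i\<in>UNIV. pvar i ^ Poly_Mapping.lookup m i)"
proof -
  have pow: "pvar i ^ n = Poly_Mapping.single (Poly_Mapping.single i n) 1" for i :: 'n and n
    by (induction n) (simp_all add: pvar_def mult_single flip: single_add)
  have "(\<Prod>i\<in>A. pvar i ^ Poly_Mapping.lookup m i)
      = Poly_Mapping.single (\<Sum>i\<in>A. Poly_Mapping.single i (Poly_Mapping.lookup m i)) 1" for A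
    by (induction A rule: infinite_finite_induct) (simp_all add: pow mult_single)
  moreover have "(\<Sum>i\<in>UNIV. Poly_Mapping.single i (Poly_Mapping.lookup m i)) = m"
    by (rule poly_mapping_eqI)
      (simp add: lookup_sum lookup_single when_def if_distrib[of "\<lambda>f. f _"] cong: if_cong)
  ultimately show ?thesis
    by (simp add: mult_single)
qed

lemma peval_closed:
  assumes "\<And>c. \<phi> c \<in> S" "\<And>i. x i \<in> S" "\<And>u v. u \<in> S \<Longrightarrow> v \<in> S \<Longrightarrow> u + v \<in> S"
    "\<And>u v. u \<in> S \<Longrightarrow> v \<in> S \<Longrightarrow> u * v \<in> S" "0 \<in> S" "1 \<in> S"
  shows "peval \<phi> x p \<in> S"
proof -
  have pow: "u ^ n \<in> S" if "u \<in> S" for u n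
    using that assms by (induction n) auto
  have "(\<Prod>i\<in>A. x i ^ Poly_Mapping.lookup m i) \<in> S" for A m
    using assms pow by (induction A rule: infinite_finite_induct) auto
  then have "(\<Sum>m\<in>B. \<phi> (Poly_Mapping.lookup p m) * (\<Prod>i\<in>UNIV. x i ^ Poly_Mapping.lookup m i)) \<in> S" for B
    using assms by (induction B rule: infinite_finite_induct) auto
  then show ?thesis
    by (simp add: peval_def)
qed

lemma (in ring_map) linear_form_eq:
  fixes g :: "'n::finite cpoly"
  assumes "whomogeneous (\<lambda>_. 1) 1 g"
  obtains b where "\<And>z. peval \<phi> z g = (\<Sum>i\<in>UNIV. \<phi> (b i) * z i)"
proof -
  have "\<exists>i. \<forall>z::'n \<Rightarrow> 'b. (\<Prod>j\<in>UNIV. z j ^ Poly_Mapping.lookup m j) = z i"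
    if "m \<in> Poly_Mapping.keys g" for m
  proof -
    have "(\<Sum>j\<in>UNIV. Poly_Mapping.lookup m j) = Suc 0"
      using assms that by (simp add: whomogeneous_def)
    then obtain i where i: "Poly_Mapping.lookup m i = 1" "\<And>j. i \<noteq> j \<Longrightarrow> Poly_Mapping.lookup m j = 0"
      by (auto simp: sum_eq_Suc0_iff)
    have "(\<Prod>j\<in>UNIV. z j ^ Poly_Mapping.lookup m j) = (\<Prod>j\<in>UNIV. if i = j then z j else 1)"
      for z :: "'n \<Rightarrow> 'b"
      using i by (intro prod.cong) auto
    then show ?thesis by auto
  qed
  then obtain \<iota> where \<iota>: "\<And>m z. m \<in> Poly_Mapping.keys g \<Longrightarrow>
      (\<Prod>j\<in>UNIV. (z::'n \<Rightarrow> 'b) j ^ Poly_Mapping.lookup m j) = z (\<iota> m)"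
    by metis
  let ?b = "\<lambda>i. \<Sum>m | m \<in> Poly_Mapping.keys g \<and> \<iota> m = i. Poly_Mapping.lookup g m"
  have "peval \<phi> z g = (\<Sum>i\<in>UNIV. \<phi> (?b i) * z i)" for z
  proof -
    have "peval \<phi> z g = (\<Sum>m\<in>Poly_Mapping.keys g. \<phi> (Poly_Mapping.lookup g m) * z (\<iota> m))"
      by (simp add: peval_def \<iota>)
    also have "\<dots> = (\<Sum>i\<in>UNIV. \<Sum>m | m \<in> Poly_Mapping.keys g \<and> \<iota> m = i. \<phi> (Poly_Mapping.lookup g m) * z (\<iota> m))"
      by (rule sum.group[symmetric]) auto
    also have "\<dots> = (\<Sum>i\<in>UNIV. \<phi> (?b i) * z i)"
      by (intro sum.cong) (auto simp: sum_distrib_right map_sum)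
    finally show ?thesis .
  qed
  then show thesis by (rule that)
qed

lemma poly_at_tendsto:
  assumes "\<And>i. ((\<lambda>l. y l i) \<longlongrightarrow> x i) \<F>"
  shows "((\<lambda>l. poly_at (y l) p) \<longlongrightarrow> poly_at x p) \<F>"
  unfolding peval_def by (intro tendsto_intros assms)

text \<open>
  If \<open>g = c h\<close>, then scaling the argument by \<open>l\<close> gives
  \<open>g(z) = l\<^bsup>e - k\<^esup> c(z) h(l z)\<close>, which tends to \<open>0\<close> with \<open>l\<close>.
\<close>

lemma dvd_lower_degree:
  fixes c g :: "'n::finite cpoly"
  assumes "whomogeneous (\<lambda>_. 1) e c" "whomogeneous (\<lambda>_. 1) k g" "k < e" "c dvd g"
  shows "poly_at z g = 0"
proof -
  obtain h where h: "g = c * h"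
    using assms(4) by (auto elim: dvdE)
  have *: "poly_at z g = l ^ (e - k) * poly_at z c * poly_at (\<lambda>i. l * z i) h" if "l \<noteq> 0" for l
  proof -
    have "l ^ k * poly_at z g = poly_at (\<lambda>i. l * z i) (c * h)"
      using poly_at_scale[OF assms(2), of l z] by (simp add: h del: poly_at_simps)
    also have "\<dots> = l ^ e * poly_at z c * poly_at (\<lambda>i. l * z i) h"
      using poly_at_scale[OF assms(1), of l z] by simp
    also have "l ^ e = l ^ k * l ^ (e - k)"
      using assms(3) by (simp flip: power_add)
    finally show ?thesis
      using that by simp
  qed
  have "((\<lambda>l. l ^ (e - k) * poly_at z c * poly_at (\<lambda>i. l * z i) h) \<longlongrightarrow>
      0 ^ (e - k) * poly_at z c * poly_at (\<lambda>i. 0 * z i) h) (at 0)"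
    by (intro tendsto_intros poly_at_tendsto)
  moreover have "\<forall>\<^sub>F l in at 0. l ^ (e - k) * poly_at z c * poly_at (\<lambda>i. l * z i) h = poly_at z g"
    using * by (auto simp: eventually_at_filter)
  ultimately have "((\<lambda>l::complex. poly_at z g) \<longlongrightarrow> 0 ^ (e - k) * poly_at z c * poly_at (\<lambda>i. 0 * z i) h) (at 0)"
    using tendsto_cong by fast
  then show ?thesis
    using assms(3) by (simp add: tendsto_const_iff)
qed

text \<open>
  Gaussian elimination: an equation with a nonzero coefficient expresses one unknown by the
  others.
\<close>

lemma underdetermined_system:
  fixes A :: "'j \<Rightarrow> 'i \<Rightarrow> 'c::field"
  assumes "finite J" "finite I" "card J < card I"
  shows "\<exists>z. (\<exists>i\<in>I. z i \<noteq> 0) \<and> (\<forall>j\<in>J. (\<Sum>i\<in>I. A j i * z i) = 0)"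
  using assms
proof (induction J arbitrary: I A rule: finite_induct)
  case empty
  then have "I \<noteq> {}" by auto
  then show ?case by (intro exI[of _ "\<lambda>_. 1"]) auto
next
  case (insert j J)
  show ?case
  proof (cases "\<forall>i\<in>I. A j i = 0")
    case True
    moreover obtain z where "\<exists>i\<in>I. z i \<noteq> 0" "\<forall>j\<in>J. (\<Sum>i\<in>I. A j i * z i) = 0"
      using insert.IH[of I A] insert.prems insert.hyps by auto
    ultimately show ?thesis by (intro exI[of _ z]) simp
  next
    case False
    then obtain k where k: "k \<in> I" "A j k \<noteq> 0" by blast
    let ?I = "I - {k}" and ?A = "\<lambda>l i. A l i - A l k * A j i / A j k"
    obtain z where z: "\<exists>i\<in>?I. z i \<noteq> 0" "\<forall>l\<in>J. (\<Sum>i\<in>?I. ?A l i * z i) = 0"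
      using insert.IH[of ?I ?A] insert.prems insert.hyps k by force
    define w where "w = z(k := - (\<Sum>i\<in>?I. A j i * z i) / A j k)"
    have split: "(\<Sum>i\<in>I. A l i * w i) = A l k * w k + (\<Sum>i\<in>?I. A l i * z i)" for l
    proof -
      have "(\<Sum>i\<in>I. A l i * w i) = A l k * w k + (\<Sum>i\<in>?I. A l i * w i)"
        using k insert.prems by (intro sum.remove) auto
      also have "(\<Sum>i\<in>?I. A l i * w i) = (\<Sum>i\<in>?I. A l i * z i)"
        by (intro sum.cong) (auto simp: w_def)
      finally show ?thesis .
    qed
    have "(\<Sum>i\<in>I. A j i * w i) = 0"
      using k by (simp add: split) (simp add: w_def)
    moreover have "(\<Sum>i\<in>I. A l i * w i) = 0" if "l \<in> J" for l
    proof -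
      have "(\<Sum>i\<in>?I. ?A l i * z i) = (\<Sum>i\<in>?I. A l i * z i) - A l k / A j k * (\<Sum>i\<in>?I. A j i * z i)"
        by (simp add: sum_subtractf sum_distrib_left algebra_simps)
      then show ?thesis
        using z(2) that by (simp add: split) (simp add: w_def algebra_simps)
    qed
    moreover have "\<exists>i\<in>I. w i \<noteq> 0"
      using z(1) by (auto simp: w_def)
    ultimately show ?thesis by blast
  qed
qed

section \<open>Local rings of weighted projective spaces\<close>

definition regular_at :: "('n::{finite,linorder} \<Rightarrow> complex) \<Rightarrow> 'n rational_function \<Rightarrow> bool" where
  "regular_at x f \<longleftrightarrow> (\<exists>G H. f = Fract G H \<and> poly_at x H \<noteq> 0)"

text \<open>
  The choice matters only outside the regular functions: by \<open>frac_at_Fract\<close>, all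
  representations whose denominator does not vanish give the same value.
\<close>

definition frac_at :: "('n::{finite,linorder} \<Rightarrow> complex) \<Rightarrow> 'n rational_function \<Rightarrow> complex" where
  "frac_at x f = (SOME v. \<exists>G H. f = Fract G H \<and> poly_at x H \<noteq> 0 \<and> v = poly_at x G / poly_at x H)"

lemma poly_at_nonzeroD: "poly_at x H \<noteq> 0 \<Longrightarrow> H \<noteq> 0"
  by auto

lemma frac_at_Fract:
  assumes "poly_at x H \<noteq> 0"
  shows "frac_at x (Fract G H) = poly_at x G / poly_at x H"
  unfolding frac_at_def
proof (rule some_equality)
  fix v assume "\<exists>G' H'. Fract G H = Fract G' H' \<and> poly_at x H' \<noteq> 0 \<and> v = poly_at x G' / poly_at x H'"
  then obtain G' H' where *: "Fract G H = Fract G' H'" "poly_at x H' \<noteq> 0" "v = poly_at x G' / poly_at x H'"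
    by blast
  have "G * H' = G' * H"
    using *(1) assms *(2) by (simp add: eq_fract(1) poly_at_nonzeroD)
  then have "poly_at x G * poly_at x H' = poly_at x G' * poly_at x H"
    by (metis poly_at.peval_mult)
  then show "v = poly_at x G / poly_at x H"
    using * assms by (simp add: frac_eq_eq)
qed (use assms in blast)

lemma regular_at_Fract: "poly_at x H \<noteq> 0 \<Longrightarrow> regular_at x (Fract G H)"
  by (auto simp: regular_at_def)

lemma frac_at_add:
  assumes "regular_at x f" "regular_at x g"
  shows "regular_at x (f + g)" "frac_at x (f + g) = frac_at x f + frac_at x g"
proof -
  from assms obtain G H G' H' where *: "f = Fract G H" "poly_at x H \<noteq> 0" "g = Fract G' H'" "poly_at x H' \<noteq> 0"
    by (auto simp: regular_at_def)
  then have "f + g = Fract (G * H' + G' * H) (H * H')"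
    by (simp add: poly_at_nonzeroD)
  then show "regular_at x (f + g)" "frac_at x (f + g) = frac_at x f + frac_at x g"
    using * by (simp_all add: regular_at_Fract frac_at_Fract add_frac_eq)
qed

lemma frac_at_mult:
  assumes "regular_at x f" "regular_at x g"
  shows "regular_at x (f * g)" "frac_at x (f * g) = frac_at x f * frac_at x g"
proof -
  from assms obtain G H G' H' where *: "f = Fract G H" "poly_at x H \<noteq> 0" "g = Fract G' H'" "poly_at x H' \<noteq> 0"
    by (auto simp: regular_at_def)
  then have "f * g = Fract (G * G') (H * H')"
    by (simp add: poly_at_nonzeroD)
  then show "regular_at x (f * g)" "frac_at x (f * g) = frac_at x f * frac_at x g"
    using * by (simp_all add: regular_at_Fract frac_at_Fract)
qed

lemma frac_at_const [simp]: "regular_at x (const_fun c)" "frac_at x (const_fun c) = c"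
  by (simp_all add: const_fun_def regular_at_Fract frac_at_Fract)

lemma frac_at_zero [simp]: "regular_at x 0" "frac_at x 0 = 0"
  using frac_at_const[of x 0] by (simp_all only: const_fun.map_zero)

lemma frac_at_one [simp]: "regular_at x 1" "frac_at x 1 = 1"
  using frac_at_const[of x 1] by (simp_all only: const_fun.map_one)

lemma frac_at_cmult:
  assumes "regular_at x f"
  shows "regular_at x (const_fun c * f)" "frac_at x (const_fun c * f) = c * frac_at x f"
  using frac_at_mult[OF frac_at_const(1) assms] by simp_all

lemma uminus_eq_const_mult: "- f = const_fun (-1) * f"
  by (simp add: const_fun.map_uminus const_fun.map_one)

lemma frac_at_diff:
  assumes "regular_at x f" "regular_at x g"
  shows "regular_at x (f - g)" "frac_at x (f - g) = frac_at x f - frac_at x g"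
  using frac_at_add[OF assms(1) frac_at_cmult(1)[OF assms(2), of "-1"]]
    frac_at_cmult(2)[OF assms(2), of "-1"]
  by (simp_all flip: uminus_eq_const_mult)

lemma frac_at_sum:
  assumes "\<And>i. i \<in> A \<Longrightarrow> regular_at x (f i)"
  shows "regular_at x (sum f A)" "frac_at x (sum f A) = (\<Sum>i\<in>A. frac_at x (f i))"
proof -
  have "regular_at x (sum f A) \<and> frac_at x (sum f A) = (\<Sum>i\<in>A. frac_at x (f i))"
    using assms by (induction A rule: infinite_finite_induct) (auto simp: frac_at_add)
  then show "regular_at x (sum f A)" "frac_at x (sum f A) = (\<Sum>i\<in>A. frac_at x (f i))"
    by auto
qed

text \<open>
  The operation by which \<open>maximal_ideal_power\<close> is iterated. For it there are an addition rule
  and an induction rule that hide the indexing of the sums.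
\<close>

definition sums_of_products :: "'b::comm_ring_1 set \<Rightarrow> 'b set \<Rightarrow> 'b set" where
  "sums_of_products A B = {\<Sum>i<n. f i * g i | (n::nat) f g. \<forall>i<n. f i \<in> A \<and> g i \<in> B}"

lemma sums_of_products_zero: "0 \<in> sums_of_products A B"
  unfolding sums_of_products_def by (rule CollectI, rule exI[of _ 0]) auto

lemma sums_of_products_mult: "f \<in> A \<Longrightarrow> g \<in> B \<Longrightarrow> f * g \<in> sums_of_products A B"
  unfolding sums_of_products_def
  by (rule CollectI, rule exI[of _ 1], rule exI[of _ "\<lambda>_. f"], rule exI[of _ "\<lambda>_. g"]) auto

lemma sums_of_products_add:
  assumes "u \<in> sums_of_products A B" "v \<in> sums_of_products A B"
  shows "u + v \<in> sums_of_products A B"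
proof -
  obtain n f g where u: "u = (\<Sum>i<n::nat. f i * g i)" "\<forall>i<n. f i \<in> A \<and> g i \<in> B"
    using assms(1) by (auto simp: sums_of_products_def)
  obtain n' f' g' where v: "v = (\<Sum>i<n'::nat. f' i * g' i)" "\<forall>i<n'. f' i \<in> A \<and> g' i \<in> B"
    using assms(2) by (auto simp: sums_of_products_def)
  let ?f = "\<lambda>i. if i < n then f i else f' (i - n)"
  let ?g = "\<lambda>i. if i < n then g i else g' (i - n)"
  have "(\<Sum>i<n + n'. ?f i * ?g i) = u + v"
    unfolding u(1) v(1) using sum.atLeastLessThan_concat[of 0 n "n + n'" "\<lambda>i. ?f i * ?g i", symmetric]
      sum.shift_bounds_nat_ivl[of "\<lambda>i. ?f i * ?g i" 0 n n']
    by (simp add: lessThan_atLeast0 add.commute)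
  moreover have "\<forall>i<n + n'. ?f i \<in> A \<and> ?g i \<in> B"
    using u(2) v(2) by auto
  ultimately show ?thesis
    unfolding sums_of_products_def
    by (intro CollectI exI[of _ "n + n'"] exI[of _ ?f] exI[of _ ?g] conjI) simp_all
qed

lemma sums_of_products_induct [consumes 1, case_names zero mult add]:
  assumes "u \<in> sums_of_products A B" "P 0" "\<And>f g. f \<in> A \<Longrightarrow> g \<in> B \<Longrightarrow> P (f * g)"
    "\<And>u v. P u \<Longrightarrow> P v \<Longrightarrow> P (u + v)"
  shows "P u"
proof -
  obtain n f g where *: "u = (\<Sum>i<n::nat. f i * g i)" "\<forall>i<n. f i \<in> A \<and> g i \<in> B"
    using assms(1) by (auto simp: sums_of_products_def)
  have "P (\<Sum>i<k. f i * g i)" if "k \<le> n" for k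
    using that *(2) assms(2-4) by (induction k) auto
  then show ?thesis
    using * by blast
qed

text \<open>
  Fixing a representative \<open>x\<close> turns vanishing along the orbit \<open>p\<close> into vanishing at one vector, so
  that \<open>local_ring a p\<close> becomes a ring of functions with values at \<open>x\<close>.
\<close>

locale wproj_point =
  fixes a :: "'n::{finite,linorder} \<Rightarrow> nat" and p :: "('n \<Rightarrow> complex) set" and x :: "'n \<Rightarrow> complex"
  assumes point: "p \<in> wproj a" and rep: "x \<in> p"
begin

lemma orbit:
  assumes "y \<in> p"
  obtains l where "l \<noteq> 0" "y = (\<lambda>i. l ^ a i * x i)"
proof -
  obtain z where z: "p = wproj_rel a `` {z}"
    using point by (auto simp: wproj_def elim: quotientE)
  obtain k where k: "k \<noteq> 0" "\<forall>i. x i = k ^ a i * z i"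
    using rep z by (auto simp: wproj_rel_def)
  obtain l where l: "l \<noteq> 0" "\<forall>i. y i = l ^ a i * z i"
    using assms z by (auto simp: wproj_rel_def)
  have "y = (\<lambda>i. (l / k) ^ a i * x i)"
    using k l by (auto simp: power_divide)
  moreover have "l / k \<noteq> 0"
    using k l by simp
  ultimately show thesis
    using that by blast
qed

lemma vanishes_at_iff:
  assumes "whomogeneous a e G"
  shows "vanishes_at G p \<longleftrightarrow> poly_at x G = 0"
proof
  assume G: "poly_at x G = 0"
  have "poly_at y G = 0" if y: "y \<in> p" for y
  proof -
    obtain l where "l \<noteq> 0" "y = (\<lambda>i. l ^ a i * x i)"
      using y by (rule orbit)
    then show ?thesis
      using poly_at_scale[OF assms] G by simp
  qed
  then show "vanishes_at G p"
    by (simp add: vanishes_at_def)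
qed (use rep in \<open>simp add: vanishes_at_def\<close>)

abbreviation "\<O> \<equiv> local_ring a p"
abbreviation "\<mm> \<equiv> maximal_ideal_at a p"
abbreviation "M \<equiv> maximal_ideal_power a p"

lemma local_ring_iff: "f \<in> \<O> \<longleftrightarrow>
    (\<exists>G H e. f = Fract G H \<and> whomogeneous a e G \<and> whomogeneous a e H \<and> poly_at x H \<noteq> 0)"
  unfolding local_ring_def mem_Collect_eq
  by (intro iff_exI conj_cong refl) (simp add: vanishes_at_iff)

lemma local_ringI:
  "whomogeneous a e G \<Longrightarrow> whomogeneous a e H \<Longrightarrow> poly_at x H \<noteq> 0 \<Longrightarrow> Fract G H \<in> \<O>"
  using local_ring_iff by blast

lemma local_ring_regular: "f \<in> \<O> \<Longrightarrow> regular_at x f"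
  by (auto simp: local_ring_iff regular_at_Fract)

lemma maximal_ideal_iff: "f \<in> \<mm> \<longleftrightarrow> f \<in> \<O> \<and> frac_at x f = 0"
proof
  assume "f \<in> \<mm>"
  then obtain G H e where *: "f = Fract G H" "whomogeneous a e G" "whomogeneous a e H"
    "\<not> vanishes_at H p" "vanishes_at G p"
    unfolding maximal_ideal_at_def mem_Collect_eq by blast
  then have "poly_at x H \<noteq> 0" "poly_at x G = 0"
    using vanishes_at_iff by blast+
  then show "f \<in> \<O> \<and> frac_at x f = 0"
    using local_ringI[OF *(2,3)] *(1) by (simp add: frac_at_Fract)
next
  assume "f \<in> \<O> \<and> frac_at x f = 0"
  then obtain G H e where *: "f = Fract G H" "whomogeneous a e G" "whomogeneous a e H" "poly_at x H \<noteq> 0"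
    "frac_at x f = 0"
    using local_ring_iff by blast
  then have "\<not> vanishes_at H p" "vanishes_at G p"
    using vanishes_at_iff[OF *(2)] vanishes_at_iff[OF *(3)] by (auto simp: frac_at_Fract)
  then show "f \<in> \<mm>"
    unfolding maximal_ideal_at_def mem_Collect_eq using * by blast
qed

lemma local_ring_const: "const_fun c \<in> \<O>"
  unfolding const_fun_def using whomogeneous_const whomogeneous_one
  by (intro local_ringI[of 0]) auto

lemma local_ring_zero: "0 \<in> \<O>" and local_ring_one: "1 \<in> \<O>"
  using local_ring_const[of 0] local_ring_const[of 1]
  by (simp_all only: const_fun.map_zero const_fun.map_one)

lemma local_ring_mult:
  assumes "f \<in> \<O>" "g \<in> \<O>" shows "f * g \<in> \<O>"
proof -
  obtain G H e where f: "f = Fract G H" "whomogeneous a e G" "whomogeneous a e H" "poly_at x H \<noteq> 0"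
    using assms(1) local_ring_iff by blast
  obtain G' H' e' where g: "g = Fract G' H'" "whomogeneous a e' G'" "whomogeneous a e' H'" "poly_at x H' \<noteq> 0"
    using assms(2) local_ring_iff by blast
  have "Fract (G * G') (H * H') \<in> \<O>"
    using f g by (intro local_ringI[of "e + e'"] whomogeneous_mult) auto
  then show ?thesis
    using f g by simp
qed

lemma local_ring_add:
  assumes "f \<in> \<O>" "g \<in> \<O>" shows "f + g \<in> \<O>"
proof -
  obtain G H e where f: "f = Fract G H" "whomogeneous a e G" "whomogeneous a e H" "poly_at x H \<noteq> 0"
    using assms(1) local_ring_iff by blast
  obtain G' H' e' where g: "g = Fract G' H'" "whomogeneous a e' G'" "whomogeneous a e' H'" "poly_at x H' \<noteq> 0"
    using assms(2) local_ring_iff by blast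
  have "whomogeneous a (e + e') (G' * H)"
    using whomogeneous_mult[OF g(2) f(3)] by (simp add: add.commute)
  then have "Fract (G * H' + G' * H) (H * H') \<in> \<O>"
    using f g by (intro local_ringI[OF whomogeneous_add[OF whomogeneous_mult[OF f(2) g(3)]]]
        whomogeneous_mult[OF f(3) g(3)]) auto
  then show ?thesis
    using f g by (simp add: poly_at_nonzeroD)
qed

lemma local_ring_sum: "(\<And>i. i \<in> A \<Longrightarrow> f i \<in> \<O>) \<Longrightarrow> sum f A \<in> \<O>"
  by (induction A rule: infinite_finite_induct) (auto simp: local_ring_zero local_ring_add)

lemma local_ring_prod: "(\<And>i. i \<in> A \<Longrightarrow> f i \<in> \<O>) \<Longrightarrow> prod f A \<in> \<O>"
  by (induction A rule: infinite_finite_induct) (auto simp: local_ring_one local_ring_mult)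

lemma local_ring_power: "f \<in> \<O> \<Longrightarrow> f ^ n \<in> \<O>"
  by (induction n) (auto simp: local_ring_one local_ring_mult)

lemma local_ring_diff: "f \<in> \<O> \<Longrightarrow> g \<in> \<O> \<Longrightarrow> f - g \<in> \<O>"
  using local_ring_add[OF _ local_ring_mult[OF local_ring_const[of "-1"]], of f g]
  by (simp flip: uminus_eq_const_mult)

lemma local_ring_diff_value: "f \<in> \<O> \<Longrightarrow> f - const_fun (frac_at x f) \<in> \<mm>"
  by (simp add: maximal_ideal_iff local_ring_diff local_ring_const frac_at_diff local_ring_regular)

lemma maximal_ideal_mult: "f \<in> \<O> \<Longrightarrow> g \<in> \<mm> \<Longrightarrow> f * g \<in> \<mm>"
  by (auto simp: maximal_ideal_iff local_ring_mult frac_at_mult local_ring_regular)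

lemma maximal_ideal_add: "f \<in> \<mm> \<Longrightarrow> g \<in> \<mm> \<Longrightarrow> f + g \<in> \<mm>"
  by (auto simp: maximal_ideal_iff local_ring_add frac_at_add local_ring_regular)

lemma maximal_ideal_zero: "0 \<in> \<mm>"
  by (simp add: maximal_ideal_iff local_ring_zero)

lemma maximal_ideal_power_Suc: "M (Suc k) = sums_of_products \<mm> (M k)"
  by (simp add: sums_of_products_def)

declare maximal_ideal_power.simps(2) [simp del]

lemma maximal_ideal_power_zero_mem: "0 \<in> M k"
  by (cases k) (simp_all add: local_ring_zero maximal_ideal_power_Suc sums_of_products_zero)

lemma maximal_ideal_power_add: "f \<in> M k \<Longrightarrow> g \<in> M k \<Longrightarrow> f + g \<in> M k"
  by (cases k) (simp_all add: local_ring_add maximal_ideal_power_Suc sums_of_products_add)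

lemma maximal_ideal_power_mult_local: "f \<in> \<O> \<Longrightarrow> g \<in> M k \<Longrightarrow> f * g \<in> M k"
proof (cases k)
  case (Suc l)
  assume f: "f \<in> \<O>" and "g \<in> M k"
  then have "g \<in> sums_of_products \<mm> (M l)"
    by (simp add: Suc maximal_ideal_power_Suc)
  then have "f * g \<in> sums_of_products \<mm> (M l)"
  proof (induction rule: sums_of_products_induct)
    case (mult u v)
    then have "(f * u) * v \<in> sums_of_products \<mm> (M l)"
      by (intro sums_of_products_mult maximal_ideal_mult f)
    then show ?case by (simp add: mult.assoc)
  qed (simp_all add: sums_of_products_zero sums_of_products_add distrib_left)
  then show ?thesis
    by (simp add: Suc maximal_ideal_power_Suc)
qed (simp add: local_ring_mult)

lemma maximal_ideal_power_mult: "f \<in> M k \<Longrightarrow> g \<in> M l \<Longrightarrow> f * g \<in> M (k + l)"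
proof (induction k arbitrary: f)
  case (Suc k)
  from Suc.prems(1) have "f \<in> sums_of_products \<mm> (M k)"
    by (simp add: maximal_ideal_power_Suc)
  then have "f * g \<in> sums_of_products \<mm> (M (k + l))"
  proof (induction rule: sums_of_products_induct)
    case (mult u v)
    then have "u * (v * g) \<in> sums_of_products \<mm> (M (k + l))"
      by (intro sums_of_products_mult Suc)
    then show ?case by (simp add: mult.assoc)
  qed (simp_all add: sums_of_products_zero sums_of_products_add distrib_right)
  then show ?case
    by (simp add: maximal_ideal_power_Suc)
qed (simp add: maximal_ideal_power_mult_local)

lemma maximal_ideal_power_1: "M (Suc 0) = \<mm>"
proof
  show "M (Suc 0) \<subseteq> \<mm>"
  proof
    fix f assume "f \<in> M (Suc 0)"
    then have "f \<in> sums_of_products \<mm> \<O>"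
      by (simp add: maximal_ideal_power_Suc)
    then show "f \<in> \<mm>"
    proof (induction rule: sums_of_products_induct)
      case (mult u v)
      then show ?case
        using maximal_ideal_mult[of v u] by (simp add: mult.commute)
    qed (simp_all add: maximal_ideal_zero maximal_ideal_add)
  qed
  show "\<mm> \<subseteq> M (Suc 0)"
    using sums_of_products_mult[OF _ local_ring_one] by (fastforce simp: maximal_ideal_power_Suc)
qed

lemma maximal_ideal_power_Suc_subset: "M (Suc k) \<subseteq> M k"
proof
  fix f assume "f \<in> M (Suc k)"
  then have "f \<in> sums_of_products \<mm> (M k)"
    by (simp add: maximal_ideal_power_Suc)
  then show "f \<in> M k"
    by (induction rule: sums_of_products_induct)
      (auto simp: maximal_ideal_power_zero_mem maximal_ideal_power_add maximal_ideal_iff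
        intro: maximal_ideal_power_mult_local)
qed

end

locale wproj_point_of = wproj_point a p x
  for a :: "'n::{finite,linorder} \<Rightarrow> nat" and p x +
  fixes X :: "('n \<Rightarrow> complex) set set"
  assumes mem: "p \<in> X"
begin

abbreviation "I \<equiv> vanishing_ideal a X p"
abbreviation "filt \<equiv> local_filtration a X p"

lemma vanishing_idealI:
  assumes "whomogeneous a e G" "whomogeneous a e H" "poly_at x H \<noteq> 0" "\<forall>q\<in>X. vanishes_at G q"
  shows "Fract G H \<in> I"
  unfolding vanishing_ideal_def mem_Collect_eq using assms vanishes_at_iff[OF assms(2)] by blast

lemma vanishing_idealE:
  assumes "f \<in> I"
  obtains G H e where "f = Fract G H" "whomogeneous a e G" "whomogeneous a e H" "poly_at x H \<noteq> 0"
    "\<forall>q\<in>X. vanishes_at G q"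
proof -
  obtain G H e where *: "f = Fract G H" "whomogeneous a e G" "whomogeneous a e H"
    "\<not> vanishes_at H p" "\<forall>q\<in>X. vanishes_at G q"
    using assms unfolding vanishing_ideal_def mem_Collect_eq by blast
  then show thesis
    using that vanishes_at_iff[OF *(3)] by blast
qed

lemma vanishing_ideal_subset: "I \<subseteq> \<mm>"
  unfolding vanishing_ideal_def maximal_ideal_at_def using mem by fast

lemma vanishing_ideal_zero: "0 \<in> I"
  unfolding Zero_fract_def
  by (rule vanishing_idealI[of 0]) (auto simp: whomogeneous_zero whomogeneous_one vanishes_at_def)

lemma vanishing_ideal_add:
  assumes "f \<in> I" "g \<in> I" shows "f + g \<in> I"
proof -
  obtain G H e where f: "f = Fract G H" "whomogeneous a e G" "whomogeneous a e H" "poly_at x H \<noteq> 0"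
    "\<forall>q\<in>X. vanishes_at G q"
    using assms(1) by (rule vanishing_idealE)
  obtain G' H' e' where g: "g = Fract G' H'" "whomogeneous a e' G'" "whomogeneous a e' H'" "poly_at x H' \<noteq> 0"
    "\<forall>q\<in>X. vanishes_at G' q"
    using assms(2) by (rule vanishing_idealE)
  have "whomogeneous a (e + e') (G' * H)"
    using whomogeneous_mult[OF g(2) f(3)] by (simp add: add.commute)
  then have "Fract (G * H' + G' * H) (H * H') \<in> I"
    using f g by (intro vanishing_idealI[OF whomogeneous_add[OF whomogeneous_mult[OF f(2) g(3)]]]
        whomogeneous_mult[OF f(3) g(3)]) (auto simp: vanishes_at_def)
  then show ?thesis
    using f g by (simp add: poly_at_nonzeroD)
qed

lemma vanishing_ideal_mult:
  assumes "f \<in> \<O>" "g \<in> I" shows "f * g \<in> I"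
proof -
  obtain G H e where f: "f = Fract G H" "whomogeneous a e G" "whomogeneous a e H" "poly_at x H \<noteq> 0"
    using assms(1) local_ring_iff by blast
  obtain G' H' e' where g: "g = Fract G' H'" "whomogeneous a e' G'" "whomogeneous a e' H'" "poly_at x H' \<noteq> 0"
    "\<forall>q\<in>X. vanishes_at G' q"
    using assms(2) by (rule vanishing_idealE)
  have "Fract (G * G') (H * H') \<in> I"
    using f g by (intro vanishing_idealI[of "e + e'"] whomogeneous_mult) (auto simp: vanishes_at_def)
  then show ?thesis
    using f g by simp
qed

lemma filt_iff: "f \<in> filt k \<longleftrightarrow> (\<exists>g h. f = g + h \<and> g \<in> M k \<and> h \<in> I)"
  by (auto simp: local_filtration_def)

lemma filt_I: "f \<in> I \<Longrightarrow> f \<in> filt k"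
  unfolding filt_iff by (rule exI[of _ 0], rule exI[of _ f]) (simp add: maximal_ideal_power_zero_mem)

lemma filt_M: "f \<in> M k \<Longrightarrow> f \<in> filt k"
  unfolding filt_iff by (rule exI[of _ f], rule exI[of _ 0]) (simp add: vanishing_ideal_zero)

lemma filt_zero: "0 \<in> filt k"
  by (simp add: filt_I vanishing_ideal_zero)

lemma filt_add:
  assumes "f \<in> filt k" "g \<in> filt k" shows "f + g \<in> filt k"
proof -
  from assms obtain f1 f2 g1 g2 where "f = f1 + f2" "f1 \<in> M k" "f2 \<in> I" "g = g1 + g2" "g1 \<in> M k" "g2 \<in> I"
    by (auto simp: filt_iff)
  then show ?thesis
    unfolding filt_iff
    by (intro exI[of _ "f1 + g1"] exI[of _ "f2 + g2"])
      (simp add: maximal_ideal_power_add vanishing_ideal_add)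
qed

lemma maximal_ideal_power_subset: "M k \<subseteq> \<O>"
  by (induction k) (use maximal_ideal_power_Suc_subset in auto)

lemma filt_0: "filt 0 = \<O>"
  using filt_M[of _ 0] vanishing_ideal_subset
  by (auto simp: filt_iff maximal_ideal_iff subset_iff intro!: local_ring_add)

lemma filt_1: "filt (Suc 0) = \<mm>"
  using filt_M[of _ "Suc 0"] vanishing_ideal_subset
  by (auto simp: filt_iff maximal_ideal_power_1 subset_iff intro!: maximal_ideal_add)

lemma filt_Suc_subset: "filt (Suc k) \<subseteq> filt k"
  using maximal_ideal_power_Suc_subset by (fastforce simp: filt_iff)

text \<open>
  The filtration is multiplicative because the vanishing ideal absorbs all mixed terms.
\<close>

lemma filt_mult:
  assumes "f \<in> filt k" "g \<in> filt l" shows "f * g \<in> filt (k + l)"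
proof -
  from assms obtain f1 f2 g1 g2 where *: "f = f1 + f2" "f1 \<in> M k" "f2 \<in> I" "g = g1 + g2" "g1 \<in> M l" "g2 \<in> I"
    by (auto simp: filt_iff)
  have "f1 \<in> \<O>" "f2 \<in> \<O>" "g1 \<in> \<O>"
    using * maximal_ideal_power_subset vanishing_ideal_subset maximal_ideal_iff by blast+
  then have "g1 * f2 \<in> I" "(f1 + f2) * g2 \<in> I"
    using * by (auto intro: vanishing_ideal_mult local_ring_add)
  then have "g1 * f2 + (f1 + f2) * g2 \<in> I" and "f1 * g1 \<in> M (k + l)"
    using * by (auto intro: vanishing_ideal_add maximal_ideal_power_mult)
  moreover have "f * g = f1 * g1 + (g1 * f2 + (f1 + f2) * g2)"
    using * by (simp add: algebra_simps)
  ultimately show ?thesis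
    unfolding filt_iff by blast
qed

lemma filt_mult_local: "f \<in> \<O> \<Longrightarrow> g \<in> filt k \<Longrightarrow> f * g \<in> filt k"
  using filt_mult[of f 0 g k] by (simp add: filt_0)

lemma filt_cmult: "f \<in> filt k \<Longrightarrow> const_fun c * f \<in> filt k"
  using filt_mult_local local_ring_const by blast

lemma filt_uminus: "f \<in> filt k \<Longrightarrow> - f \<in> filt k"
  using filt_cmult[of f k "-1"] by (simp flip: uminus_eq_const_mult)

lemma filt_diff: "f \<in> filt k \<Longrightarrow> g \<in> filt k \<Longrightarrow> f - g \<in> filt k"
  using filt_add[of f k "- g"] filt_uminus by simp

lemma filt_sum: "(\<And>i. i \<in> A \<Longrightarrow> f i \<in> filt k) \<Longrightarrow> sum f A \<in> filt k"
  by (induction A rule: infinite_finite_induct) (auto simp: filt_zero filt_add)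

end

section \<open>Symbols on a cubic tangent cone\<close>

text \<open>
  The data behind \<open>tangent_cone_iso a X p c\<close> for a form \<open>c\<close> of degree three. The use made of
  the degree is that the graded algebra \<open>\<complex>[t]/(c)\<close> agrees with the polynomial ring \<open>\<complex>[t]\<close> in
  degrees below three.
\<close>

locale cubic_tangent_cone = wproj_point_of a p x X
  for a :: "'n::{finite,linorder} \<Rightarrow> nat" and p x X +
  fixes t :: "'m::{finite,linorder} \<Rightarrow> 'n rational_function" and c :: "'m cpoly"
  assumes cubic: "whomogeneous (\<lambda>_. 1) 3 c"
    and t_mem: "t i \<in> filt 1"
    and surjective: "f \<in> filt k \<Longrightarrow> \<exists>g. whomogeneous (\<lambda>_. 1) k g \<and> f - peval const_fun t g \<in> filt (Suc k)"
    and kernel: "whomogeneous (\<lambda>_. 1) k g \<Longrightarrow> peval const_fun t g \<in> filt (Suc k) \<longleftrightarrow> c dvd g"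
begin

text \<open>
  The class of \<open>f\<close> in the degree \<open>k\<close> part of the graded algebra, as a form of degree \<open>k\<close>, evaluated
  at a point \<open>z\<close> of the affine space that contains the tangent cone. For \<open>k < 3\<close> such an evaluation
  makes sense even off the cone.
\<close>

definition symbol :: "('m \<Rightarrow> complex) \<Rightarrow> nat \<Rightarrow> 'n rational_function \<Rightarrow> complex" where
  "symbol z k f = poly_at z (SOME g. whomogeneous (\<lambda>_. 1) k g \<and> f - peval const_fun t g \<in> filt (Suc k))"

text \<open>
  Two representing forms differ by a multiple of \<open>c\<close> of degree less than three, that is, by \<open>0\<close>.
\<close>

lemma symbol_eq:
  assumes "k < 3" "whomogeneous (\<lambda>_. 1) k g" "f - peval const_fun t g \<in> filt (Suc k)"
  shows "symbol z k f = poly_at z g"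
proof -
  define h where "h = (SOME g. whomogeneous (\<lambda>_. 1) k g \<and> f - peval const_fun t g \<in> filt (Suc k))"
  have h: "whomogeneous (\<lambda>_. 1) k h \<and> f - peval const_fun t h \<in> filt (Suc k)"
    unfolding h_def by (rule someI) (use assms in blast)
  have "(f - peval const_fun t g) - (f - peval const_fun t h) \<in> filt (Suc k)"
    using h assms by (blast intro: filt_diff)
  then have "peval const_fun t (h - g) \<in> filt (Suc k)"
    by (simp add: const_fun.peval_diff)
  moreover have hom: "whomogeneous (\<lambda>_. 1) k (h - g)"
    using h assms by (simp add: whomogeneous_diff)
  ultimately have "c dvd h - g"
    using kernel by blast
  then have "poly_at z (h - g) = 0"
    using dvd_lower_degree[OF cubic hom] assms(1) by blast
  then show ?thesis
    unfolding symbol_def h_def[symmetric] by simp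
qed

lemma symbol_repr:
  assumes "k < 3" "f \<in> filt k"
  obtains g where "whomogeneous (\<lambda>_. 1) k g" "f - peval const_fun t g \<in> filt (Suc k)"
    "\<And>z. symbol z k f = poly_at z g"
  using surjective[OF assms(2)] symbol_eq[OF assms(1)] by blast

lemma symbol_add:
  assumes "k < 3" "f \<in> filt k" "g \<in> filt k"
  shows "symbol z k (f + g) = symbol z k f + symbol z k g"
proof -
  obtain u where u: "whomogeneous (\<lambda>_. 1) k u" "f - peval const_fun t u \<in> filt (Suc k)"
    "\<And>z. symbol z k f = poly_at z u"
    using assms(1,2) by (rule symbol_repr) blast
  obtain v where v: "whomogeneous (\<lambda>_. 1) k v" "g - peval const_fun t v \<in> filt (Suc k)"
    "\<And>z. symbol z k g = poly_at z v"
    using assms(1,3) by (rule symbol_repr) blast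
  have "(f + g) - peval const_fun t (u + v) \<in> filt (Suc k)"
    using filt_add[OF u(2) v(2)] by (simp add: const_fun.peval_add algebra_simps)
  then show ?thesis
    using symbol_eq[OF assms(1) whomogeneous_add[OF u(1) v(1)]] u v by simp
qed

lemma symbol_filt_Suc:
  assumes "k < 3" "f \<in> filt (Suc k)"
  shows "symbol z k f = 0"
  using symbol_eq[OF assms(1) whomogeneous_zero, of f z] assms by simp

lemma symbol_zero: "k < 3 \<Longrightarrow> symbol z k 0 = 0"
  by (rule symbol_filt_Suc) (simp_all add: filt_zero)

lemma symbol_cmult:
  assumes "k < 3" "f \<in> filt k"
  shows "symbol z k (const_fun b * f) = b * symbol z k f"
proof -
  obtain u where u: "whomogeneous (\<lambda>_. 1) k u" "f - peval const_fun t u \<in> filt (Suc k)"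
    "\<And>z. symbol z k f = poly_at z u"
    using assms by (rule symbol_repr) blast
  have "const_fun b * f - peval const_fun t (Poly_Mapping.single 0 b * u) \<in> filt (Suc k)"
    using filt_cmult[OF u(2), of b] by (simp add: const_fun.peval_mult const_fun.peval_const algebra_simps)
  then show ?thesis
    using symbol_eq[OF assms(1) whomogeneous_cmult[OF u(1)]] u by simp
qed

lemma symbol_sum:
  assumes "k < 3" "\<And>i. i \<in> A \<Longrightarrow> f i \<in> filt k"
  shows "symbol z k (sum f A) = (\<Sum>i\<in>A. symbol z k (f i))"
  using assms
  by (induction A rule: infinite_finite_induct) (auto simp: symbol_zero symbol_add filt_sum)

lemma symbol_mult:
  assumes "k + l < 3" "f \<in> filt k" "g \<in> filt l"
  shows "symbol z (k + l) (f * g) = symbol z k f * symbol z l g"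
proof -
  have kl: "k < 3" "l < 3" using assms by auto
  obtain u where u: "whomogeneous (\<lambda>_. 1) k u" "f - peval const_fun t u \<in> filt (Suc k)"
    "\<And>z. symbol z k f = poly_at z u"
    using kl(1) assms(2) by (rule symbol_repr) blast
  obtain v where v: "whomogeneous (\<lambda>_. 1) l v" "g - peval const_fun t v \<in> filt (Suc l)"
    "\<And>z. symbol z l g = poly_at z v"
    using kl(2) assms(3) by (rule symbol_repr) blast
  have "f - (f - peval const_fun t u) \<in> filt k"
    using assms(2) u(2) filt_Suc_subset by (blast intro: filt_diff)
  then have "peval const_fun t u \<in> filt k" by simp
  then have "(f - peval const_fun t u) * g + peval const_fun t u * (g - peval const_fun t v)
      \<in> filt (Suc (k + l))"
    using filt_mult[OF u(2) assms(3)] filt_mult[OF _ v(2), of "peval const_fun t u" k]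
    by (intro filt_add) auto
  then have "f * g - peval const_fun t (u * v) \<in> filt (Suc (k + l))"
    by (simp add: const_fun.peval_mult algebra_simps)
  then show ?thesis
    using symbol_eq[OF assms(1) whomogeneous_mult[OF u(1) v(1)]] u v by simp
qed

lemma symbol_t: "symbol z 1 (t i) = z i"
  using symbol_eq[of 1 "pvar i" "t i" z] whomogeneous_pvar[of "\<lambda>_. 1" i] by (simp add: filt_zero)

text \<open>
  The symbols of degree one are linear forms in \<open>CARD('m)\<close> variables, and fewer linear forms than
  variables have a nontrivial common zero.
\<close>

lemma common_zero:
  assumes "finite J" "card J < CARD('m)" "\<And>j. j \<in> J \<Longrightarrow> u j \<in> filt 1"
  obtains z where "z \<noteq> (\<lambda>_. 0)" "\<And>j. j \<in> J \<Longrightarrow> symbol z 1 (u j) = 0"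
proof -
  have "\<exists>b. \<forall>z. symbol z 1 (u j) = (\<Sum>i\<in>UNIV. b i * z i)" if j: "j \<in> J" for j
  proof -
    obtain g where g: "whomogeneous (\<lambda>_. 1) 1 g" "\<And>z. symbol z 1 (u j) = poly_at z g"
      by (rule symbol_repr[OF _ assms(3)[OF j]]) auto
    obtain b where "\<And>z. poly_at z g = (\<Sum>i\<in>UNIV. b i * z i)"
      using g(1) by (rule poly_at.linear_form_eq) blast
    then show ?thesis using g(2) by auto
  qed
  then obtain B where B: "\<And>j z. j \<in> J \<Longrightarrow> symbol z 1 (u j) = (\<Sum>i\<in>UNIV. B j i * z i)"
    by metis
  obtain z where z: "\<exists>i. z i \<noteq> 0" "\<forall>j\<in>J. (\<Sum>i\<in>UNIV. B j i * z i) = 0"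
    using underdetermined_system[OF assms(1) finite_class.finite_UNIV assms(2), of B] by auto
  show thesis
  proof (rule that)
    show "z \<noteq> (\<lambda>_. 0)" using z(1) by auto
    show "symbol z 1 (u j) = 0" if "j \<in> J" for j
      using z(2) that B by simp
  qed
qed

text \<open>
  The point \<open>z\<close> as a tangent vector of \<open>X\<close> at \<open>p\<close>, in the guise of a derivation of the local ring.
\<close>

definition tangent_derivation :: "('m \<Rightarrow> complex) \<Rightarrow> 'n rational_function \<Rightarrow> complex" where
  "tangent_derivation z f = symbol z 1 (f - const_fun (frac_at x f))"

lemma diff_value_filt: "f \<in> \<O> \<Longrightarrow> f - const_fun (frac_at x f) \<in> filt 1"
  using local_ring_diff_value filt_1 by simp

lemma tangent_derivation_const: "tangent_derivation z (const_fun b) = 0"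
  by (simp add: tangent_derivation_def symbol_zero)

lemma tangent_derivation_filt: "f \<in> filt 1 \<Longrightarrow> tangent_derivation z f = symbol z 1 f"
  using filt_1 maximal_ideal_iff by (simp add: tangent_derivation_def const_fun.map_zero)

lemma tangent_derivation_add:
  assumes "f \<in> \<O>" "g \<in> \<O>"
  shows "tangent_derivation z (f + g) = tangent_derivation z f + tangent_derivation z g"
  using symbol_add[OF _ diff_value_filt[OF assms(1)] diff_value_filt[OF assms(2)], of z] assms
  by (simp add: tangent_derivation_def frac_at_add local_ring_regular const_fun.map_add algebra_simps)

text \<open>
  The product of the two deviations from the values at \<open>p\<close> lies in the square of the maximal ideal,
  where the symbol of degree one vanishes.
\<close>

lemma tangent_derivation_mult:
  assumes "f \<in> \<O>" "g \<in> \<O>"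
  shows "tangent_derivation z (f * g) =
    frac_at x f * tangent_derivation z g + frac_at x g * tangent_derivation z f"
proof -
  let ?u = "f - const_fun (frac_at x f)" and ?v = "g - const_fun (frac_at x g)"
  have uv: "?u \<in> filt 1" "?v \<in> filt 1"
    using assms diff_value_filt by auto
  then have "?u * ?v \<in> filt (Suc 1)"
    using filt_mult[OF uv] by simp
  then have 0: "symbol z 1 (?u * ?v) = 0" "?u * ?v \<in> filt 1"
    using symbol_filt_Suc[of 1] filt_Suc_subset by auto
  have "f * g - const_fun (frac_at x (f * g)) =
      (const_fun (frac_at x f) * ?v + const_fun (frac_at x g) * ?u) + ?u * ?v"
    using assms by (simp add: frac_at_mult local_ring_regular const_fun.map_mult algebra_simps)
  then show ?thesis
    using uv 0 unfolding tangent_derivation_def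
    by (simp add: symbol_add symbol_cmult filt_add filt_cmult)
qed

lemma tangent_derivation_peval_zero:
  assumes "\<And>i. \<xi> i \<in> \<O>" "\<And>i. tangent_derivation z (\<xi> i) = 0"
  shows "peval const_fun \<xi> G \<in> \<O>" "tangent_derivation z (peval const_fun \<xi> G) = 0"
proof -
  have "peval const_fun \<xi> G \<in> {f \<in> \<O>. tangent_derivation z f = 0}"
    by (rule peval_closed)
      (use assms tangent_derivation_const[of z 0] tangent_derivation_const[of z 1] in
        \<open>simp_all add: tangent_derivation_const tangent_derivation_add tangent_derivation_mult
          local_ring_const local_ring_add local_ring_mult local_ring_zero local_ring_one
          const_fun.map_zero const_fun.map_one\<close>)
  then show "peval const_fun \<xi> G \<in> \<O>" "tangent_derivation z (peval const_fun \<xi> G) = 0"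
    by auto
qed

end

subsection \<open>Charts\<close>

lemma Fract_power: "Fract g h ^ k = Fract (g ^ k) (h ^ k)"
  by (induction k) (simp_all add: One_fract_def)

lemma peval_pvar_fract:
  "peval const_fun (\<lambda>i. Fract (pvar i) 1) G = (Fract G 1 :: 'n::{finite,linorder} rational_function)"
proof -
  have prod: "(\<Prod>i\<in>A. Fract (pvar i) 1 ^ n i) = (Fract (\<Prod>i\<in>A. pvar i ^ n i) 1 :: 'n rational_function)"
    for A :: "'n set" and n :: "'n \<Rightarrow> nat"
  proof -
    have pow: "Fract g 1 ^ k = Fract (g ^ k) 1" for g :: "'n cpoly" and k
      by (induction k) (simp_all add: One_fract_def)
    show ?thesis
      by (induction A rule: infinite_finite_induct) (simp_all add: pow One_fract_def)
  qed
  have sum: "(\<Sum>m\<in>A. Fract (h m) 1) = Fract (sum h A) 1" for A :: "('n \<Rightarrow>\<^sub>0 nat) set" and h :: "_ \<Rightarrow> 'n cpoly"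
    by (induction A rule: infinite_finite_induct) (simp_all add: Zero_fract_def)
  have "peval const_fun (\<lambda>i. Fract (pvar i) 1) G =
      (\<Sum>m\<in>Poly_Mapping.keys G. Fract (Poly_Mapping.single m (Poly_Mapping.lookup G m)) 1)"
    unfolding peval_def
    by (intro sum.cong refl) (simp add: prod const_fun_def flip: monomial_eq_prod)
  also have "\<dots> = Fract G 1"
    by (simp add: sum flip: poly_mapping_sum_monomials)
  finally show ?thesis .
qed

text \<open>
  The coordinate functions obtained by dehomogenizing with respect to a function \<open>s\<close> of degree one.
\<close>

definition chart :: "('n::{finite,linorder} \<Rightarrow> nat) \<Rightarrow> 'n rational_function \<Rightarrow> 'n \<Rightarrow> 'n rational_function" where
  "chart a s i = Fract (pvar i) 1 / s ^ a i"

text \<open>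
  This is the scaling rule for forms, with the scalar \<open>s\<^sup>-\<^sup>1\<close>.
\<close>

lemma peval_chart:
  assumes "whomogeneous a e G"
  shows "peval const_fun (chart a s) G = Fract G 1 / s ^ e"
proof -
  have "chart a s = (\<lambda>i. inverse s ^ a i * Fract (pvar i) 1)"
    by (auto simp: chart_def field_simps power_inverse)
  then show ?thesis
    using const_fun.peval_scale[OF assms, of "inverse s" "\<lambda>i. Fract (pvar i) 1"]
    by (simp add: peval_pvar_fract divide_inverse power_inverse mult.commute)
qed

context wproj_point
begin

text \<open>
  Such a function exists only where the stabilizer of \<open>\<complex>\<^sup>*\<close> is trivial, since a stabilizing scalar
  \<open>l\<close> multiplies its value by \<open>l\<close>. At such points the functions \<open>chart a s i\<close> generate the local
  ring up to denominators.
\<close>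

definition degree_one_unit :: "'n rational_function \<Rightarrow> bool" where
  "degree_one_unit s \<longleftrightarrow> (\<exists>U V e. s = Fract U V \<and> whomogeneous a (Suc e) U \<and> whomogeneous a e V \<and>
     poly_at x U \<noteq> 0 \<and> poly_at x V \<noteq> 0)"

lemma degree_one_unit_quotient:
  assumes "degree_one_unit s" "whomogeneous a d G"
  obtains G' H' e where "Fract G 1 / s ^ d = Fract (G * G') H'" "whomogeneous a e (G * G')" "whomogeneous a e H'"
    "poly_at x H' \<noteq> 0" "poly_at x G' \<noteq> 0"
proof -
  obtain U V e where s: "s = Fract U V" "whomogeneous a (Suc e) U" "whomogeneous a e V"
    "poly_at x U \<noteq> 0" "poly_at x V \<noteq> 0"
    using assms(1) unfolding degree_one_unit_def by blast
  have "Fract G 1 / s ^ d = Fract (G * V ^ d) (U ^ d)"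
    by (simp add: s(1) Fract_power)
  moreover have "whomogeneous a (d + d * e) (G * V ^ d)"
    using assms s by (intro whomogeneous_mult whomogeneous_power)
  moreover have "whomogeneous a (d + d * e) (U ^ d)"
    using whomogeneous_power[OF s(2), of d] by (simp add: algebra_simps)
  ultimately show thesis
    using s by (intro that[of "V ^ d" "U ^ d"]) auto
qed

lemma degree_one_unit_local:
  assumes "degree_one_unit s" "whomogeneous a d G"
  shows "Fract G 1 / s ^ d \<in> \<O>"
    and "frac_at x (Fract G 1 / s ^ d) = 0 \<longleftrightarrow> poly_at x G = 0"
proof -
  obtain G' H' e where "Fract G 1 / s ^ d = Fract (G * G') H'" "whomogeneous a e (G * G')" "whomogeneous a e H'"
    "poly_at x H' \<noteq> 0" "poly_at x G' \<noteq> 0"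
    using assms by (rule degree_one_unit_quotient)
  then show "Fract G 1 / s ^ d \<in> \<O>" "frac_at x (Fract G 1 / s ^ d) = 0 \<longleftrightarrow> poly_at x G = 0"
    using local_ringI by (auto simp: frac_at_Fract)
qed

lemma chart_local: "degree_one_unit s \<Longrightarrow> chart a s i \<in> \<O>"
  unfolding chart_def by (rule degree_one_unit_local(1)[OF _ whomogeneous_pvar])

lemma degree_one_unit_nonzero:
  assumes "degree_one_unit s" shows "s \<noteq> 0"
  using assms unfolding degree_one_unit_def
  by (auto simp: Zero_fract_def eq_fract poly_at_nonzeroD)

end

lemma (in wproj_point_of) chart_vanishing:
  assumes "degree_one_unit s" "whomogeneous a d F" "\<forall>q\<in>X. vanishes_at F q"
  shows "peval const_fun (chart a s) F \<in> I"
proof -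
  obtain G' H' e where *: "Fract F 1 / s ^ d = Fract (F * G') H'" "whomogeneous a e (F * G')" "whomogeneous a e H'"
    "poly_at x H' \<noteq> 0" "poly_at x G' \<noteq> 0"
    using assms(1,2) by (rule degree_one_unit_quotient)
  have "\<forall>q\<in>X. vanishes_at (F * G') q"
    using assms(3) by (simp add: vanishes_at_def)
  then have "Fract (F * G') H' \<in> I"
    using * by (intro vanishing_idealI)
  then show ?thesis
    by (simp add: peval_chart[OF assms(2)] *(1))
qed

text \<open>
  A derivation that kills all coordinate functions kills all polynomials in them, hence all elements
  \<open>G/H\<close> of the maximal ideal, among them the \<open>t i\<close>, on which the derivation takes the values \<open>z i\<close>.
\<close>

lemma (in cubic_tangent_cone) tangent_derivation_chart_nonzero:
  assumes "degree_one_unit s" "z \<noteq> (\<lambda>_. 0)"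
  obtains i where "tangent_derivation z (chart a s i) \<noteq> 0"
proof (rule ccontr)
  assume "\<not> thesis"
  then have 0: "tangent_derivation z (chart a s i) = 0" for i
    using that by blast
  have "symbol z 1 f = 0" if f: "f \<in> filt 1" for f
  proof -
    have fO: "f \<in> \<O>" and f0: "frac_at x f = 0"
      using f filt_1 maximal_ideal_iff by auto
    obtain G H e where GH: "f = Fract G H" "whomogeneous a e G" "whomogeneous a e H" "poly_at x H \<noteq> 0"
      using fO local_ring_iff by blast
    let ?P = "peval const_fun (chart a s)"
    have nz: "s ^ e \<noteq> 0"
      using degree_one_unit_nonzero[OF assms(1)] by simp
    have "?P H * f = Fract H 1 * Fract G H / s ^ e"
      by (simp add: peval_chart[OF GH(3)] GH(1))
    also have "Fract H 1 * Fract G H = Fract G 1"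
      using poly_at_nonzeroD[OF GH(4)] by (simp add: eq_fract mult.commute)
    also have "Fract G 1 / s ^ e = ?P G"
      by (simp add: peval_chart[OF GH(2)])
    finally have eq: "?P H * f = ?P G" .
    have P: "?P K \<in> \<O>" "tangent_derivation z (?P K) = 0" for K
      using tangent_derivation_peval_zero[where \<xi> = "chart a s", OF chart_local[OF assms(1)] 0] by auto
    have "frac_at x (?P H) * tangent_derivation z f = 0"
      using arg_cong[OF eq, of "tangent_derivation z"] P fO f0 by (simp add: tangent_derivation_mult)
    moreover have "frac_at x (?P H) \<noteq> 0"
      using degree_one_unit_local(2)[OF assms(1) GH(3)] GH(4) by (simp add: peval_chart[OF GH(3)])
    ultimately show ?thesis
      using tangent_derivation_filt[OF f] by simp
  qed
  then have "z i = 0" for i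
    using symbol_t[of z i] t_mem[of i] by simp
  then show False
    using assms(2) by blast
qed

section \<open>Points at which the multiplicity is at most two\<close>

context cubic_tangent_cone
begin

lemma tangent_derivation_sum:
  assumes "\<And>i. i \<in> A \<Longrightarrow> f i \<in> \<O>"
  shows "tangent_derivation z (sum f A) = (\<Sum>i\<in>A. tangent_derivation z (f i))"
  using assms tangent_derivation_const[of z 0]
  by (induction A rule: infinite_finite_induct)
    (auto simp: const_fun.map_zero tangent_derivation_add local_ring_sum)

text \<open>
  The tangent space has dimension \<open>CARD('m)\<close>, so a tangent vector cannot be determined by its
  effect on fewer coordinate functions.
\<close>

lemma coordinates_not_determined:
  assumes "degree_one_unit s" "finite J" "card J < CARD('m)"
    and "\<And>z i. (\<And>j. j \<in> J \<Longrightarrow> tangent_derivation z (chart a s j) = 0) \<Longrightarrow> tangent_derivation z (chart a s i) = 0"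
  shows False
proof -
  have "chart a s j - const_fun (frac_at x (chart a s j)) \<in> filt 1" for j
    using diff_value_filt chart_local[OF assms(1)] by blast
  then obtain z where "z \<noteq> (\<lambda>_. 0)" "\<And>j. j \<in> J \<Longrightarrow> tangent_derivation z (chart a s j) = 0"
    using common_zero[OF assms(2,3), of "\<lambda>j. chart a s j - const_fun (frac_at x (chart a s j))"]
    unfolding tangent_derivation_def by blast
  then show False
    using assms(4) tangent_derivation_chart_nonzero[OF assms(1)] by metis
qed

text \<open>
  Functions whose Taylor expansion in the local coordinates \<open>u j\<close> (\<open>j \<in> J\<close>) has a quadratic part
  with value \<open>\<gamma>\<close> at \<open>z\<close>. In the application, \<open>z\<close> is a common zero of the symbols of all coordinates
  except one, so that \<open>\<gamma>\<close> measures the coefficient of the square of that one.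
\<close>

definition jet :: "('n \<Rightarrow> 'n rational_function) \<Rightarrow> 'n set \<Rightarrow> ('m \<Rightarrow> complex) \<Rightarrow> complex \<Rightarrow> 'n rational_function set" where
  "jet u J z \<gamma> = {const_fun k + (\<Sum>j\<in>J. const_fun (b j) * u j) + h | k b h. h \<in> filt 2 \<and> symbol z 2 h = \<gamma>}"

lemma jetI:
  "f = const_fun k + (\<Sum>j\<in>J. const_fun (b j) * u j) + h \<Longrightarrow> h \<in> filt 2 \<Longrightarrow> symbol z 2 h = \<gamma> \<Longrightarrow> f \<in> jet u J z \<gamma>"
  unfolding jet_def by blast

lemma jetE:
  assumes "f \<in> jet u J z \<gamma>"
  obtains k b h where "f = const_fun k + (\<Sum>j\<in>J. const_fun (b j) * u j) + h" "h \<in> filt 2" "symbol z 2 h = \<gamma>"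
  using assms unfolding jet_def by blast

lemma jet_add:
  assumes "f \<in> jet u J z \<gamma>" "g \<in> jet u J z \<delta>"
  shows "f + g \<in> jet u J z (\<gamma> + \<delta>)"
proof -
  obtain k b h where f: "f = const_fun k + (\<Sum>j\<in>J. const_fun (b j) * u j) + h" "h \<in> filt 2" "symbol z 2 h = \<gamma>"
    using assms(1) by (rule jetE)
  obtain k' b' h' where g: "g = const_fun k' + (\<Sum>j\<in>J. const_fun (b' j) * u j) + h'" "h' \<in> filt 2" "symbol z 2 h' = \<delta>"
    using assms(2) by (rule jetE)
  show ?thesis
    by (rule jetI[of _ "k + k'" "\<lambda>j. b j + b' j" u J "h + h'"])
      (use f g in \<open>simp_all add: const_fun.map_add distrib_right sum.distrib filt_add symbol_add\<close>)
qed

lemma jet_cmult: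
  assumes "f \<in> jet u J z \<gamma>"
  shows "const_fun r * f \<in> jet u J z (r * \<gamma>)"
proof -
  obtain k b h where f: "f = const_fun k + (\<Sum>j\<in>J. const_fun (b j) * u j) + h" "h \<in> filt 2" "symbol z 2 h = \<gamma>"
    using assms(1) by (rule jetE)
  show ?thesis
    by (rule jetI[of _ "r * k" "\<lambda>j. r * b j" u J "const_fun r * h"])
      (use f in \<open>simp_all add: const_fun.map_mult distrib_left sum_distrib_left mult.assoc filt_cmult symbol_cmult\<close>)
qed

lemma jet_const: "const_fun r \<in> jet u J z 0"
  by (rule jetI[of _ r "\<lambda>_. 0" u J 0]) (simp_all add: const_fun.map_zero filt_zero symbol_zero)

lemma jet_sum:
  assumes "finite A" "\<And>i. i \<in> A \<Longrightarrow> f i \<in> jet u J z (\<gamma> i)"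
  shows "sum f A \<in> jet u J z (sum \<gamma> A)"
  using assms jet_const[of 0]
  by (induction A rule: finite_induct) (auto simp: jet_add const_fun.map_zero)

lemma sum_delta_const:
  assumes "finite J" "j \<in> J"
  shows "(\<Sum>i\<in>J. const_fun (if i = j then r else 0) * u i) = const_fun r * u j"
proof -
  have "(\<Sum>i\<in>J. const_fun (if i = j then r else 0) * u i) = (\<Sum>i\<in>J. if i = j then const_fun r * u i else 0)"
    by (intro sum.cong) (auto simp: const_fun.map_zero)
  then show ?thesis
    using assms by simp
qed

lemma jet_variable:
  assumes "finite J" "j \<in> J"
  shows "u j \<in> jet u J z 0"
  by (rule jetI[of _ 0 "\<lambda>i. if i = j then 1 else 0" u J 0])
    (use assms in \<open>simp_all add: sum_delta_const const_fun.map_zero const_fun.map_one filt_zero symbol_zero\<close>)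

text \<open>
  Every quadratic term of the product contains the factor \<open>u j\<close>, whose symbol vanishes at \<open>z\<close>.
\<close>

lemma jet_mult_variable:
  assumes "finite J" "j \<in> J" "\<And>i. i \<in> J \<Longrightarrow> u i \<in> filt 1" "symbol z 1 (u j) = 0" "f \<in> jet u J z \<gamma>"
  shows "u j * f \<in> jet u J z 0"
proof -
  obtain k b h where f: "f = const_fun k + (\<Sum>j\<in>J. const_fun (b j) * u j) + h" "h \<in> filt 2" "symbol z 2 h = \<gamma>"
    using assms(5) by (rule jetE)
  let ?S = "\<Sum>i\<in>J. const_fun (b i) * u i"
  have S: "?S \<in> filt 1"
    using assms(3) by (intro filt_sum filt_cmult)
  have uS: "u j * ?S \<in> filt 2" "symbol z 2 (u j * ?S) = 0"
    using filt_mult[OF assms(3)[OF assms(2)] S] symbol_mult[OF _ assms(3)[OF assms(2)] S] assms(4)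
    by (simp_all add: numeral_2_eq_2)
  have "u j * h \<in> filt (Suc 2)"
    using filt_mult[OF assms(3)[OF assms(2)] f(2)] by (simp add: numeral_3_eq_3)
  then have uh: "u j * h \<in> filt 2" "symbol z 2 (u j * h) = 0"
    using filt_Suc_subset[of 2] symbol_filt_Suc[of 2] by auto
  show ?thesis
  proof (rule jetI)
    show "u j * f = const_fun 0 + (\<Sum>i\<in>J. const_fun (if i = j then k else 0) * u i) + (u j * ?S + u j * h)"
      unfolding sum_delta_const[OF assms(1,2)] f(1)
      by (simp add: const_fun.map_zero distrib_left mult.commute)
  qed (use uS uh in \<open>simp_all add: filt_add symbol_add\<close>)
qed

text \<open>
  In the chart in which the coordinate \<open>i0\<close> equals \<open>1\<close>, the remaining four coordinates, shifted to
  have value \<open>0\<close> at \<open>p\<close>, are linearly independent in the cotangent space, as this space has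
  dimension four. Let \<open>z\<close> be a nonzero common zero of the symbols of the three of them that differ
  from the one of index \<open>w\<close>. Of all monomials of \<open>F\<close>, only the square of \<open>w\<close> contributes to the
  quadratic part at \<open>z\<close>, and it contributes something nonzero. But \<open>F\<close> is zero on \<open>X\<close>: successively,
  its constant, linear and quadratic parts have to vanish.
\<close>

lemma double_cover_no_cubic_cone:
  assumes s: "degree_one_unit s" and card: "CARD('m) = 4" "CARD('n) = 5"
    and i0: "chart a s i0 = 1" and w: "w \<noteq> i0"
    and F: "whomogeneous a d F" "\<forall>q\<in>X. vanishes_at F q"
    and keys: "\<And>m. m \<in> Poly_Mapping.keys F \<Longrightarrow> Poly_Mapping.lookup m w \<le> 1 \<or> m = Poly_Mapping.single w 2"
    and nz: "Poly_Mapping.lookup F (Poly_Mapping.single w 2) \<noteq> 0"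
  shows False
proof -
  let ?\<xi> = "chart a s"
  let ?v = "\<lambda>i. frac_at x (?\<xi> i)"
  define u where "u i = ?\<xi> i - const_fun (?v i)" for i
  define J where "J = UNIV - {i0}"
  have J: "finite J" "card J = 4" "w \<in> J"
    using card w by (simp_all add: J_def)
  have u: "u i \<in> filt 1" for i
    unfolding u_def using diff_value_filt chart_local[OF s] by blast
  have D: "tangent_derivation z (?\<xi> i) = symbol z 1 (u i)" for z i
    by (simp add: tangent_derivation_def u_def)
  have D0: "tangent_derivation z (?\<xi> i0) = 0" for z
    using tangent_derivation_const[of z 1] by (simp add: i0 const_fun.map_one)
  have \<xi>: "?\<xi> i = const_fun (?v i) + u i" for i
    by (simp add: u_def)
  \<comment> \<open>If the coordinate \<open>l\<close> were redundant, a vector killed by the other three would be zero.\<close>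
  have independent: "\<forall>j\<in>J. b j = 0" if b: "(\<Sum>j\<in>J. const_fun (b j) * u j) \<in> filt 2" for b
  proof (rule ccontr)
    assume "\<not> (\<forall>j\<in>J. b j = 0)"
    then obtain l where l: "l \<in> J" "b l \<noteq> 0" by blast
    show False
    proof (rule coordinates_not_determined[OF s, of "J - {l}"])
      show "card (J - {l}) < CARD('m)"
        using J l card by simp
      fix z i assume z: "\<And>j. j \<in> J - {l} \<Longrightarrow> tangent_derivation z (?\<xi> j) = 0"
      have "0 = symbol z 1 (\<Sum>j\<in>J. const_fun (b j) * u j)"
        using symbol_filt_Suc[of 1] b by (simp add: numeral_2_eq_2)
      also have "\<dots> = (\<Sum>j\<in>J. b j * symbol z 1 (u j))"
        using u by (simp add: symbol_sum filt_cmult symbol_cmult)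
      also have "\<dots> = b l * symbol z 1 (u l) + (\<Sum>j\<in>J - {l}. b j * symbol z 1 (u j))"
        using J(1) l(1) by (rule sum.remove)
      also have "(\<Sum>j\<in>J - {l}. b j * symbol z 1 (u j)) = 0"
        using z D by (intro sum.neutral) simp
      finally have "symbol z 1 (u l) = 0"
        using l by simp
      then show "tangent_derivation z (?\<xi> i) = 0"
        using z D0 D by (cases "i = l \<or> i = i0") (auto simp: J_def)
    qed (use J in simp)
  qed
  obtain z where z: "z \<noteq> (\<lambda>_. 0)" "\<And>j. j \<in> J - {w} \<Longrightarrow> symbol z 1 (u j) = 0"
    using common_zero[of "J - {w}" u] J card u by auto
  have y: "symbol z 1 (u w) \<noteq> 0"
  proof
    assume "symbol z 1 (u w) = 0"
    then have "tangent_derivation z (?\<xi> i) = 0" for i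
      using z(2) D0 D by (cases "i = w \<or> i = i0") (auto simp: J_def)
    then show False
      using tangent_derivation_chart_nonzero[OF s z(1)] by blast
  qed
  let ?jet = "jet u J z"
  have mult_coord: "?\<xi> i * f \<in> ?jet 0" if "f \<in> ?jet 0" "i \<noteq> w" for i f
  proof (cases "i = i0")
    case False
    then have "u i * f \<in> ?jet 0"
      using that J u z(2) by (intro jet_mult_variable) (auto simp: J_def)
    then have "const_fun (?v i) * f + u i * f \<in> ?jet (?v i * 0 + 0)"
      using that(1) by (intro jet_add jet_cmult)
    then show ?thesis
      by (simp only: distrib_right[symmetric] \<xi>[symmetric]) simp
  qed (use that i0 in simp)
  have mult_power: "?\<xi> i ^ n * f \<in> ?jet 0" if "f \<in> ?jet 0" "i \<noteq> w" for i f n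
    using that mult_coord by (induction n) (auto simp: mult.assoc)
  have mult_prod: "(\<Prod>i\<in>A. ?\<xi> i ^ n i) * f \<in> ?jet 0" if "finite A" "f \<in> ?jet 0" "w \<notin> A" for A f n
    using that mult_power by (induction A rule: finite_induct) (auto simp: mult.assoc)
  have w1: "?\<xi> w \<in> ?jet 0"
    using jet_add[OF jet_const jet_variable[OF J(1,3)], of "?v w" u z] by (simp only: \<xi>[symmetric]) simp
  have u2: "u w * u w \<in> filt 2" "symbol z 2 (u w * u w) = (symbol z 1 (u w))\<^sup>2"
    using filt_mult[OF u[of w] u[of w]] symbol_mult[OF _ u[of w] u[of w]] by (simp_all add: numeral_2_eq_2)
  have w2: "?\<xi> w ^ 2 \<in> ?jet ((symbol z 1 (u w))\<^sup>2)"
  proof (rule jetI)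
    show "?\<xi> w ^ 2 = const_fun ((?v w)\<^sup>2) + (\<Sum>i\<in>J. const_fun (if i = w then 2 * ?v w else 0) * u i) + u w * u w"
    proof -
      have "?\<xi> w ^ 2 = (const_fun (?v w) + u w) ^ 2"
        by (simp only: \<xi>[symmetric])
      moreover have "const_fun 2 = (2 :: 'n rational_function)"
        using const_fun.map_add[of 1 1] by (simp add: const_fun.map_one)
      ultimately show ?thesis
        unfolding sum_delta_const[OF J(1,3)]
        by (simp add: power2_eq_square const_fun.map_mult const_fun.map_add algebra_simps)
    qed
  qed (use u2 in auto)
  let ?c = "Poly_Mapping.lookup F"
  let ?\<gamma> = "\<lambda>m. if m = Poly_Mapping.single w 2 then ?c m * (symbol z 1 (u w))\<^sup>2 else 0"
  have mono: "const_fun (?c m) * (\<Prod>i\<in>UNIV. ?\<xi> i ^ Poly_Mapping.lookup m i) \<in> ?jet (?\<gamma> m)"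
    if m: "m \<in> Poly_Mapping.keys F" for m
  proof -
    have split: "(\<Prod>i\<in>UNIV. ?\<xi> i ^ Poly_Mapping.lookup m i) =
        (\<Prod>i\<in>UNIV - {w}. ?\<xi> i ^ Poly_Mapping.lookup m i) * ?\<xi> w ^ Poly_Mapping.lookup m w"
      by (simp add: prod.remove[of UNIV w] mult.commute)
    show ?thesis
    proof (cases "m = Poly_Mapping.single w 2")
      case True
      have "(\<Prod>i\<in>UNIV - {w}. ?\<xi> i ^ Poly_Mapping.lookup m i) = 1"
        using True by (intro prod.neutral) (auto simp: lookup_single when_def)
      then show ?thesis
        using jet_cmult[OF w2, of "?c m"] True split by simp
    next
      case False
      then have "Poly_Mapping.lookup m w = 0 \<or> Poly_Mapping.lookup m w = 1"
        using keys[OF m] by auto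
      then have "?\<xi> w ^ Poly_Mapping.lookup m w \<in> ?jet 0"
        using w1 jet_const[of 1] by (auto simp: const_fun.map_one)
      then show ?thesis
        using jet_cmult[OF mult_prod, of "UNIV - {w}" _ "?c m"] False by (simp add: split)
    qed
  qed
  have "peval const_fun ?\<xi> F \<in> ?jet (sum ?\<gamma> (Poly_Mapping.keys F))"
    unfolding peval_def by (rule jet_sum) (use mono in auto)
  also have "sum ?\<gamma> (Poly_Mapping.keys F) = ?c (Poly_Mapping.single w 2) * (symbol z 1 (u w))\<^sup>2"
    using nz by (simp add: sum.delta in_keys_iff)
  finally have "peval const_fun ?\<xi> F \<in> ?jet (?c (Poly_Mapping.single w 2) * (symbol z 1 (u w))\<^sup>2)" .
  then obtain k b h where F_eq: "peval const_fun ?\<xi> F = const_fun k + (\<Sum>j\<in>J. const_fun (b j) * u j) + h"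
    and h: "h \<in> filt 2" "symbol z 2 h = ?c (Poly_Mapping.single w 2) * (symbol z 1 (u w))\<^sup>2"
    by (rule jetE)
  have FI: "peval const_fun ?\<xi> F \<in> filt n" for n
    using chart_vanishing[OF s F] filt_I by blast
  have S: "(\<Sum>j\<in>J. const_fun (b j) * u j) \<in> filt 1"
    using u by (intro filt_sum filt_cmult)
  have "h \<in> filt 1"
    using h filt_Suc_subset[of 1] by (auto simp: numeral_2_eq_2)
  then have "peval const_fun ?\<xi> F - (\<Sum>j\<in>J. const_fun (b j) * u j) - h \<in> filt 1"
    using FI S by (intro filt_diff)
  then have "const_fun k \<in> filt 1"
    by (simp add: F_eq)
  then have k: "k = 0"
    using filt_1 maximal_ideal_iff by auto
  have "peval const_fun ?\<xi> F - h \<in> filt 2"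
    using FI h by (intro filt_diff)
  then have "\<forall>j\<in>J. b j = 0"
    by (intro independent) (simp add: F_eq k const_fun.map_zero)
  then have "peval const_fun ?\<xi> F = h"
    by (simp add: F_eq k const_fun.map_zero)
  then have "h \<in> filt (Suc 2)"
    using FI by blast
  then show False
    using symbol_filt_Suc[of 2 h z] h(2) nz y by simp
qed

text \<open>
  The Jacobian criterion: the derivative of \<open>F\<close> along a tangent vector is \<open>0\<close>. If, by
  this equation, a tangent vector is zero on all coordinates as soon as it is zero on those in \<open>J\<close>, then
  the tangent space has dimension at most \<open>card J\<close>, which is too small.
\<close>

lemma smooth_hypersurface_no_cubic_cone:
  assumes s: "degree_one_unit s" and J: "finite J" "card J < CARD('m)"
    and F: "whomogeneous a d F" "\<forall>q\<in>X. vanishes_at F q"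
    and determined: "\<And>z i. (\<And>j. j \<in> J \<Longrightarrow> tangent_derivation z (chart a s j) = 0) \<Longrightarrow>
      (\<Sum>m\<in>Poly_Mapping.keys F. Poly_Mapping.lookup F m *
        tangent_derivation z (\<Prod>i\<in>UNIV. chart a s i ^ Poly_Mapping.lookup m i)) = 0 \<Longrightarrow>
      tangent_derivation z (chart a s i) = 0"
  shows False
proof (rule coordinates_not_determined[OF s J])
  fix z i assume z: "\<And>j. j \<in> J \<Longrightarrow> tangent_derivation z (chart a s j) = 0"
  have mono: "(\<Prod>i\<in>UNIV. chart a s i ^ Poly_Mapping.lookup m i) \<in> \<O>" for m
    by (intro local_ring_prod local_ring_power chart_local s)
  have "0 = tangent_derivation z (peval const_fun (chart a s) F)"
    using chart_vanishing[OF s F] filt_I[of _ 1] filt_I[of _ "Suc 1"]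
    by (simp add: tangent_derivation_filt symbol_filt_Suc)
  also have "\<dots> = (\<Sum>m\<in>Poly_Mapping.keys F. Poly_Mapping.lookup F m *
        tangent_derivation z (\<Prod>i\<in>UNIV. chart a s i ^ Poly_Mapping.lookup m i))"
    unfolding peval_def
    by (simp add: tangent_derivation_sum local_ring_mult local_ring_const mono tangent_derivation_mult
        tangent_derivation_const)
  finally show "tangent_derivation z (chart a s i) = 0"
    by (intro determined[OF z]) simp_all
qed

lemma tangent_derivation_power:
  assumes "f \<in> \<O>"
  shows "tangent_derivation z (f ^ Suc n) = of_nat (Suc n) * frac_at x f ^ n * tangent_derivation z f"
    and "frac_at x (f ^ n) = frac_at x f ^ n"
proof -
  show pow: "frac_at x (f ^ n) = frac_at x f ^ n" for n
    using assms by (induction n) (auto simp: frac_at_mult local_ring_regular local_ring_power)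
  show "tangent_derivation z (f ^ Suc n) = of_nat (Suc n) * frac_at x f ^ n * tangent_derivation z f"
  proof (induction n)
    case (Suc n)
    show ?case
      using assms Suc tangent_derivation_mult[OF assms local_ring_power[OF assms, of "Suc n"], of z]
      by (simp add: pow[of "Suc n", simplified] algebra_simps)
  qed simp
qed

end

section \<open>Quotient singularities\<close>

subsection \<open>Nonvanishing points and small roots\<close>

text \<open>
  As weights take the powers \<open>1, N, N\<^sup>2, \<dots>\<close> of a natural number: the weighted degrees of two
  different exponent vectors are two different polynomials in \<open>N\<close>, so only finitely many \<open>N\<close> are
  excluded.
\<close>

lemma separating_weights:
  fixes S :: "('n::finite \<Rightarrow>\<^sub>0 nat) set"
  assumes "finite S"
  obtains v :: "'n \<Rightarrow> nat" where "inj_on (\<lambda>m. \<Sum>i\<in>UNIV. v i * Poly_Mapping.lookup m i) S"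
proof -
  obtain \<iota> :: "'n \<Rightarrow> nat" where \<iota>: "inj \<iota>"
    using finite_imp_inj_to_nat_seg[of "UNIV :: 'n set"] by auto
  define D :: "('n \<Rightarrow>\<^sub>0 nat) \<Rightarrow> ('n \<Rightarrow>\<^sub>0 nat) \<Rightarrow> real poly" where
    "D m n = (\<Sum>i\<in>UNIV. monom (real (Poly_Mapping.lookup m i) - real (Poly_Mapping.lookup n i)) (\<iota> i))" for m n
  have D: "D m n \<noteq> 0" if "m \<noteq> n" for m n
  proof -
    obtain i where i: "Poly_Mapping.lookup m i \<noteq> Poly_Mapping.lookup n i"
      using \<open>m \<noteq> n\<close> by (meson poly_mapping_eqI)
    have "coeff (D m n) (\<iota> i) = (\<Sum>j\<in>UNIV. if j = i then real (Poly_Mapping.lookup m j) - real (Poly_Mapping.lookup n j) else 0)"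
      unfolding D_def coeff_sum using \<iota> by (intro sum.cong) (auto simp: inj_eq)
    then show ?thesis
      using i by auto
  qed
  have "finite (\<Union>(m, n)\<in>{(m, n) \<in> S \<times> S. m \<noteq> n}. {y. poly (D m n) y = 0})"
    using assms D by (intro finite_UN_I) (auto simp: poly_roots_finite intro: finite_subset[of _ "S \<times> S"])
  moreover have "infinite (range real)"
    using infinite_UNIV_nat by (simp add: finite_image_iff inj_on_def)
  ultimately obtain N :: nat where N: "\<forall>m\<in>S. \<forall>n\<in>S. m \<noteq> n \<longrightarrow> poly (D m n) (real N) \<noteq> 0"
    using finite_subset[of "range real" "\<Union>(m, n)\<in>{(m, n) \<in> S \<times> S. m \<noteq> n}. {y. poly (D m n) y = 0}"]
    by blast
  have "inj_on (\<lambda>m. \<Sum>i\<in>UNIV. N ^ \<iota> i * Poly_Mapping.lookup m i) S"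
  proof (rule inj_onI, rule ccontr)
    fix m n assume mn: "m \<in> S" "n \<in> S" "m \<noteq> n"
      "(\<Sum>i\<in>UNIV. N ^ \<iota> i * Poly_Mapping.lookup m i) = (\<Sum>i\<in>UNIV. N ^ \<iota> i * Poly_Mapping.lookup n i)"
    have "poly (D m n) (real N) = real (\<Sum>i\<in>UNIV. N ^ \<iota> i * Poly_Mapping.lookup m i)
        - real (\<Sum>i\<in>UNIV. N ^ \<iota> i * Poly_Mapping.lookup n i)"
      by (simp add: D_def poly_sum poly_monom sum_subtractf algebra_simps)
    then show False
      using N mn by simp
  qed
  then show thesis by (rule that)
qed

text \<open>
  On a monomial curve with separating weights, \<open>p\<close> becomes a nonzero polynomial in one variable.
\<close>

lemma nonvanishing_point:
  fixes p :: "'n::finite cpoly"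
  assumes "p \<noteq> 0"
  obtains y where "\<And>i. y i \<noteq> 0" "poly_at y p \<noteq> 0"
proof -
  obtain v :: "'n \<Rightarrow> nat" where v: "inj_on (\<lambda>m. \<Sum>i\<in>UNIV. v i * Poly_Mapping.lookup m i) (Poly_Mapping.keys p)"
    using separating_weights[OF finite_keys] by blast
  let ?e = "\<lambda>m. \<Sum>i\<in>UNIV. v i * Poly_Mapping.lookup m i"
  define q where "q = (\<Sum>m\<in>Poly_Mapping.keys p. monom (Poly_Mapping.lookup p m) (?e m))"
  have q: "poly q s = poly_at (\<lambda>i. s ^ v i) p" for s
    by (simp add: q_def poly_sum poly_monom peval_def power_sum[symmetric] flip: power_mult)
  obtain m where m: "m \<in> Poly_Mapping.keys p"
    using assms by (metis keys_eq_empty all_not_in_conv)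
  have "coeff q (?e m) = (\<Sum>n\<in>Poly_Mapping.keys p. if n = m then Poly_Mapping.lookup p n else 0)"
    unfolding q_def coeff_sum using v m by (intro sum.cong) (auto simp: inj_on_def)
  then have "q \<noteq> 0"
    using m by (auto simp: in_keys_iff)
  then have "finite ({s. poly q s = 0} \<union> {0})"
    by (simp add: poly_roots_finite)
  then obtain s where "s \<notin> {s. poly q s = 0} \<union> {0}"
    using ex_new_if_finite infinite_UNIV_char_0 by blast
  then show thesis
    using that[of "\<lambda>i. s ^ v i"] q by simp
qed

text \<open>
  By factorization into linear factors \<open>1 - z/w\<close> with \<open>norm w > R\<close>. This replaces continuity of
  roots: it bounds the growth of a polynomial in terms of its constant coefficient, uniformly in
  all polynomials of bounded degree.
\<close>

lemma poly_bound_if_no_small_root: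
  fixes p :: "complex poly"
  assumes "R > 0" "\<And>z. norm z \<le> R \<Longrightarrow> poly p z \<noteq> 0"
  shows "norm (poly p z) \<le> norm (poly p 0) * (1 + norm z / R) ^ degree p"
  using assms(2)
proof (induction "degree p" arbitrary: p)
  case 0
  then obtain c where "p = [:c:]"
    by (metis degree_eq_zeroE)
  then show ?case by simp
next
  case (Suc n)
  then have "\<not> constant (poly p)"
    by (simp add: constant_degree)
  then obtain w where w: "poly p w = 0"
    using fundamental_theorem_of_algebra by blast
  then obtain q where q: "p = [:- w, 1:] * q"
    by (meson dvdE poly_eq_0_iff_dvd)
  have nw: "norm w > R"
    using Suc.prems w by force
  have "p \<noteq> 0" using Suc by auto
  then have deg: "degree p = Suc (degree q)"
    by (subst q, subst degree_mult_eq) (use q in auto)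
  have IH: "norm (poly q z) \<le> norm (poly q 0) * (1 + norm z / R) ^ degree q"
  proof (rule Suc.hyps(1))
    show "n = degree q" using deg Suc.hyps(2) by simp
    show "poly q y \<noteq> 0" if "norm y \<le> R" for y
      using Suc.prems[OF that] q by auto
  qed
  have "norm (z - w) \<le> norm w + norm z"
    using norm_triangle_ineq4[of z w] by simp
  also have "\<dots> \<le> norm w * (1 + norm z / R)"
  proof -
    have "norm z * R \<le> norm z * norm w"
      using nw by (intro mult_left_mono) auto
    then show ?thesis
      using assms(1) by (simp add: field_simps)
  qed
  finally have "norm (z - w) * norm (poly q z) \<le>
      (norm w * (1 + norm z / R)) * (norm (poly q 0) * (1 + norm z / R) ^ degree q)"
    using IH assms(1) nw by (intro mult_mono) auto
  moreover have "poly p z = (z - w) * poly q z" and "poly p 0 = - w * poly q 0"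
    by (simp_all add: q algebra_simps)
  ultimately show ?case
    by (simp add: deg norm_mult mult_ac)
qed

subsection \<open>Points of a hypersurface near a coordinate point\<close>

text \<open>
  The weighted dilation by \<open>\<tau>\<close>, with weights \<open>b\<close>, of the point \<open>\<alpha>\<close> moved by \<open>\<sigma>\<close> in the direction \<open>\<beta>\<close>.
  For \<open>b k = 0\<close>, \<open>\<alpha> k = 0\<close> and \<open>\<beta> k = 1\<close> it tends to the coordinate point \<open>e\<^sub>k\<close> as \<open>\<tau>\<close> tends to \<open>0\<close>.
\<close>

definition curve :: "('n \<Rightarrow> nat) \<Rightarrow> ('n \<Rightarrow> complex) \<Rightarrow> ('n \<Rightarrow> complex) \<Rightarrow> complex \<Rightarrow> complex \<Rightarrow> 'n \<Rightarrow> complex" where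
  "curve b \<beta> \<alpha> \<tau> \<sigma> i = \<tau> ^ b i * (\<alpha> i + \<sigma> ^ b i * \<beta> i)"

text \<open>
  Let \<open>F0\<close> be the initial form of \<open>F\<close>. Up to the factor \<open>\<tau>\<^bsup>m0\<^esup>\<close>, the value of \<open>F\<close> is a polynomial
  in \<open>\<sigma>\<close> that depends continuously on \<open>\<tau>\<close> and becomes \<open>F0(\<alpha> + \<sigma> \<beta>)\<close> at \<open>\<tau> = 0\<close>. That one is
  unbounded, since it grows like \<open>\<sigma>\<^bsup>m0\<^esup> F0(\<beta>)\<close>; so it violates the bound that
  \<open>poly_bound_if_no_small_root\<close> gives for large \<open>R\<close>, and so do the polynomials for small \<open>\<tau>\<close>.
  Therefore they have a root of absolute value at most \<open>R\<close>.
\<close>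

lemma curve_zeros:
  fixes b :: "'n::finite \<Rightarrow> nat" and F F0 :: "'n cpoly" and \<alpha> \<beta> :: "'n \<Rightarrow> complex"
  defines "wt \<equiv> \<lambda>m. \<Sum>i\<in>UNIV. b i * Poly_Mapping.lookup m i"
  assumes \<alpha>: "\<And>i. b i = 0 \<Longrightarrow> \<alpha> i = 0"
    and m0: "m0 > 0" "\<And>m. m \<in> Poly_Mapping.keys F \<Longrightarrow> m0 \<le> wt m"
    and F0: "\<And>m. Poly_Mapping.lookup F0 m = (if wt m = m0 then Poly_Mapping.lookup F m else 0)"
    and \<beta>: "poly_at \<beta> F0 \<noteq> 0"
  obtains R where "\<forall>\<^sub>F \<tau> in at 0. \<exists>\<sigma>. norm \<sigma> \<le> R \<and> poly_at (curve b \<beta> \<alpha> \<tau> \<sigma>) F = 0"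
proof -
  define Q where "Q m = (\<Prod>i\<in>UNIV. ([:\<alpha> i:] + monom (\<beta> i) (b i)) ^ Poly_Mapping.lookup m i)" for m
  define P where "P \<tau> = (\<Sum>m\<in>Poly_Mapping.keys F. smult (Poly_Mapping.lookup F m * \<tau> ^ (wt m - m0)) (Q m))" for \<tau>
  define D where "D = (\<Sum>m\<in>Poly_Mapping.keys F. degree (Q m))"
  have Q: "poly (Q m) \<sigma> = (\<Prod>i\<in>UNIV. (\<alpha> i + \<sigma> ^ b i * \<beta> i) ^ Poly_Mapping.lookup m i)" for m \<sigma>
    by (simp add: Q_def poly_prod poly_monom mult.commute)
  have P: "poly (P \<tau>) \<sigma> = (\<Sum>m\<in>Poly_Mapping.keys F. Poly_Mapping.lookup F m * \<tau> ^ (wt m - m0) *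
      (\<Prod>i\<in>UNIV. (\<alpha> i + \<sigma> ^ b i * \<beta> i) ^ Poly_Mapping.lookup m i))" for \<tau> \<sigma>
    by (simp add: P_def poly_sum Q)
  have deg: "degree (P \<tau>) \<le> D" for \<tau>
    unfolding P_def
  proof (rule degree_sum_le)
    fix m assume m: "m \<in> Poly_Mapping.keys F"
    have "degree (Q m) \<le> D"
      unfolding D_def using m by (intro member_le_sum) auto
    then show "degree (smult (Poly_Mapping.lookup F m * \<tau> ^ (wt m - m0)) (Q m)) \<le> D"
      using degree_smult_le le_trans by blast
  qed simp
  have F_curve: "poly_at (curve b \<beta> \<alpha> \<tau> \<sigma>) F = \<tau> ^ m0 * poly (P \<tau>) \<sigma>" for \<tau> \<sigma>
  proof -
    have "(\<Prod>i\<in>UNIV. curve b \<beta> \<alpha> \<tau> \<sigma> i ^ Poly_Mapping.lookup m i) =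
        \<tau> ^ m0 * \<tau> ^ (wt m - m0) * (\<Prod>i\<in>UNIV. (\<alpha> i + \<sigma> ^ b i * \<beta> i) ^ Poly_Mapping.lookup m i)"
      if m: "m \<in> Poly_Mapping.keys F" for m
    proof -
      have "(\<Prod>i\<in>UNIV. curve b \<beta> \<alpha> \<tau> \<sigma> i ^ Poly_Mapping.lookup m i) =
          \<tau> ^ wt m * (\<Prod>i\<in>UNIV. (\<alpha> i + \<sigma> ^ b i * \<beta> i) ^ Poly_Mapping.lookup m i)"
        by (simp add: curve_def power_mult_distrib prod.distrib wt_def power_sum flip: power_mult)
      then show ?thesis
        using m0(2)[OF m] by (simp flip: power_add)
    qed
    then show ?thesis
      unfolding P peval_def by (simp add: sum_distrib_left mult_ac)
  qed
  have P0: "poly (P 0) \<sigma> = poly_at (\<lambda>i. \<alpha> i + \<sigma> ^ b i * \<beta> i) F0" for \<sigma>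
  proof -
    have "poly_at (\<lambda>i. \<alpha> i + \<sigma> ^ b i * \<beta> i) F0 = (\<Sum>m\<in>Poly_Mapping.keys F. Poly_Mapping.lookup F0 m *
        (\<Prod>i\<in>UNIV. (\<alpha> i + \<sigma> ^ b i * \<beta> i) ^ Poly_Mapping.lookup m i))"
      by (rule poly_at.peval_superset) (auto simp: in_keys_iff F0 split: if_splits)
    also have "\<dots> = poly (P 0) \<sigma>"
      unfolding P by (intro sum.cong refl, drule m0(2)) (auto simp: F0 power_0_left)
    finally show ?thesis by simp
  qed
  have hom: "whomogeneous b m0 F0"
    by (auto simp: whomogeneous_def in_keys_iff F0 wt_def split: if_splits)
  \<comment> \<open>Pulling out the power of \<open>\<sigma>\<close> exhibits \<open>F0(\<beta>)\<close> as the leading coefficient.\<close>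
  have P0_scaled: "poly (P 0) \<sigma> = \<sigma> ^ m0 * poly_at (\<lambda>i. \<alpha> i / \<sigma> ^ b i + \<beta> i) F0" if "\<sigma> \<noteq> 0" for \<sigma>
  proof -
    have "(\<lambda>i. \<alpha> i + \<sigma> ^ b i * \<beta> i) = (\<lambda>i. \<sigma> ^ b i * (\<alpha> i / \<sigma> ^ b i + \<beta> i))"
      using that by (auto simp: distrib_left)
    then show ?thesis
      unfolding P0 using poly_at_scale[OF hom] by simp
  qed
  have "((\<lambda>\<sigma>. \<alpha> i / \<sigma> ^ b i + \<beta> i) \<longlongrightarrow> \<beta> i) at_infinity" for i
  proof (cases "b i = 0")
    case False
    have "((\<lambda>\<sigma>. \<alpha> i * inverse (\<sigma> ^ b i) + \<beta> i) \<longlongrightarrow> \<alpha> i * 0 + \<beta> i) at_infinity"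
      by (intro tendsto_intros tendsto_inverse_0[THEN filterlim_compose]
          filterlim_power_at_infinity) (use False in \<open>auto intro: filterlim_ident\<close>)
    then show ?thesis by (simp add: divide_inverse)
  qed (simp add: \<alpha>)
  then have "((\<lambda>\<sigma>. poly_at (\<lambda>i. \<alpha> i / \<sigma> ^ b i + \<beta> i) F0) \<longlongrightarrow> poly_at \<beta> F0) at_infinity"
    by (rule poly_at_tendsto)
  moreover have "filterlim (\<lambda>\<sigma>::complex. \<sigma> ^ m0) at_infinity at_infinity"
    using m0 by (intro filterlim_power_at_infinity filterlim_ident) auto
  ultimately have "filterlim (\<lambda>\<sigma>. poly_at (\<lambda>i. \<alpha> i / \<sigma> ^ b i + \<beta> i) F0 * \<sigma> ^ m0) at_infinity at_infinity"
    using \<beta> by (intro tendsto_mult_filterlim_at_infinity)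
  then have "\<forall>\<^sub>F \<sigma> in at_infinity. norm (poly (P 0) 0) + 1 \<le> norm (poly_at (\<lambda>i. \<alpha> i / \<sigma> ^ b i + \<beta> i) F0 * \<sigma> ^ m0)"
    unfolding filterlim_at_infinity[OF order_refl] by (simp add: add_nonneg_pos)
  moreover have "\<forall>\<^sub>F \<sigma>::complex in at_infinity. \<sigma> \<noteq> 0"
    using eventually_not_equal_at_infinity by blast
  ultimately have growth: "\<forall>\<^sub>F \<sigma> in at_infinity. norm (poly (P 0) 0) < norm (poly (P 0) \<sigma>)"
    by eventually_elim (simp add: P0_scaled mult.commute)
  obtain \<sigma>1 where \<sigma>1: "norm (poly (P 0) 0) < norm (poly (P 0) \<sigma>1)"
  proof -
    obtain r :: real where "\<And>\<sigma>. r \<le> norm \<sigma> \<Longrightarrow> norm (poly (P 0) 0) < norm (poly (P 0) \<sigma>)"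
      using growth unfolding eventually_at_infinity by blast
    then show thesis
      using that[of "of_real \<bar>r\<bar>"] by simp
  qed
  have "((\<lambda>R. norm (poly (P 0) 0) * (1 + norm \<sigma>1 * inverse R) ^ D) \<longlongrightarrow> norm (poly (P 0) 0) * (1 + norm \<sigma>1 * 0) ^ D) at_top"
    by (intro tendsto_intros tendsto_inverse_0_at_top filterlim_ident)
  then have "\<forall>\<^sub>F R in at_top. norm (poly (P 0) 0) * (1 + norm \<sigma>1 * inverse R) ^ D < norm (poly (P 0) \<sigma>1)"
    using \<sigma>1 by (intro order_tendstoD(2)) auto
  \<comment> \<open>The bound for \<open>R = \<infinity>\<close> is violated at \<open>\<sigma>1\<close>, hence also for large finite \<open>R\<close>.\<close>
  then obtain R :: real where R: "R > 0" "norm (poly (P 0) 0) * (1 + norm \<sigma>1 / R) ^ D < norm (poly (P 0) \<sigma>1)"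
    using eventually_happens[OF eventually_conj[OF _ eventually_gt_at_top[of 0]]]
    by (auto simp: divide_inverse)
  have cont: "((\<lambda>\<tau>. poly (P \<tau>) \<sigma>) \<longlongrightarrow> poly (P 0) \<sigma>) (at 0)" for \<sigma>
    unfolding P by (intro tendsto_intros)
  have "((\<lambda>\<tau>. norm (poly (P \<tau>) \<sigma>1) - norm (poly (P \<tau>) 0) * (1 + norm \<sigma>1 / R) ^ D) \<longlongrightarrow>
      norm (poly (P 0) \<sigma>1) - norm (poly (P 0) 0) * (1 + norm \<sigma>1 / R) ^ D) (at 0)"
    by (intro tendsto_intros cont)
  then have "\<forall>\<^sub>F \<tau> in at 0. 0 < norm (poly (P \<tau>) \<sigma>1) - norm (poly (P \<tau>) 0) * (1 + norm \<sigma>1 / R) ^ D"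
    by (rule order_tendstoD(1)) (use R in simp)
  then have "\<forall>\<^sub>F \<tau> in at 0. \<exists>\<sigma>. norm \<sigma> \<le> R \<and> poly_at (curve b \<beta> \<alpha> \<tau> \<sigma>) F = 0"
  proof eventually_elim
    case (elim \<tau>)
    have "\<exists>\<sigma>. norm \<sigma> \<le> R \<and> poly (P \<tau>) \<sigma> = 0"
    proof (rule ccontr)
      assume "\<not> ?thesis"
      then have "norm (poly (P \<tau>) \<sigma>1) \<le> norm (poly (P \<tau>) 0) * (1 + norm \<sigma>1 / R) ^ degree (P \<tau>)"
        by (intro poly_bound_if_no_small_root R) auto
      also have "\<dots> \<le> norm (poly (P \<tau>) 0) * (1 + norm \<sigma>1 / R) ^ D"
        using R(1) deg by (intro mult_left_mono power_increasing) auto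
      finally show False using elim by simp
    qed
    then show ?case by (auto simp: F_curve)
  qed
  then show thesis by (rule that)
qed

subsection \<open>Orders of vanishing along a sequence\<close>

lemma poly_at_coordinate_point:
  fixes k :: "'n::finite"
  shows "poly_at ((\<lambda>_. 0)(k := 1)) G = (\<Sum>m\<in>{m \<in> Poly_Mapping.keys G. \<forall>i. i \<noteq> k \<longrightarrow> Poly_Mapping.lookup m i = 0}. Poly_Mapping.lookup G m)"
proof -
  let ?x = "(\<lambda>_. 0)(k := 1) :: 'n \<Rightarrow> complex"
  have "(\<Prod>i\<in>UNIV. ?x i ^ Poly_Mapping.lookup m i) = (if \<forall>i. i \<noteq> k \<longrightarrow> Poly_Mapping.lookup m i = 0 then 1 else 0)" for m
  proof (cases "\<forall>i. i \<noteq> k \<longrightarrow> Poly_Mapping.lookup m i = 0")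
    case True
    then have "?x i ^ Poly_Mapping.lookup m i = 1" for i
      by (cases "i = k") auto
    then show ?thesis using True by simp
  next
    case False
    then obtain i where "i \<noteq> k" "Poly_Mapping.lookup m i \<noteq> 0" by blast
    then have "?x i ^ Poly_Mapping.lookup m i = 0" by simp
    then show ?thesis using False by (auto simp: prod_zero_iff)
  qed
  then have "poly_at ?x G = (\<Sum>m\<in>Poly_Mapping.keys G.
      if \<forall>i. i \<noteq> k \<longrightarrow> Poly_Mapping.lookup m i = 0 then Poly_Mapping.lookup G m else 0)"
    unfolding peval_def by (intro sum.cong refl) auto
  then show ?thesis
    by (simp add: sum.inter_filter)
qed

lemma degree_pure:
  fixes k :: "'n::finite" and a :: "'n \<Rightarrow> nat"
  assumes "\<forall>i. i \<noteq> k \<longrightarrow> Poly_Mapping.lookup m i = 0"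
  shows "(\<Sum>i\<in>UNIV. a i * Poly_Mapping.lookup m i) = a k * Poly_Mapping.lookup m k"
proof -
  have "(\<Sum>i\<in>UNIV. a i * Poly_Mapping.lookup m i) = (\<Sum>i\<in>UNIV. if i = k then a k * Poly_Mapping.lookup m k else 0)"
    using assms by (intro sum.cong) auto
  then show ?thesis by simp
qed

text \<open>
  A form of given degree contains at most one power of the variable \<open>k\<close>, and its coefficient is the
  value at \<open>e\<^sub>k\<close>.
\<close>

lemma coordinate_point_zero_keys:
  fixes k :: "'n::finite"
  assumes G: "whomogeneous a e G" "poly_at ((\<lambda>_. 0)(k := 1)) G = 0" and pos: "a k > 0"
    and m: "m \<in> Poly_Mapping.keys G"
  shows "\<exists>i. i \<noteq> k \<and> Poly_Mapping.lookup m i \<noteq> 0"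
proof (rule ccontr)
  let ?pure = "\<lambda>m. \<forall>i. i \<noteq> k \<longrightarrow> Poly_Mapping.lookup m i = 0"
  assume "\<not> ?thesis"
  then have pure: "?pure m" by blast
  have single: "{n \<in> Poly_Mapping.keys G. ?pure n} = {m}"
  proof -
    have unique: "n = m" if n: "n \<in> Poly_Mapping.keys G" "?pure n" for n
    proof (rule poly_mapping_eqI)
      fix i
      have "(\<Sum>i\<in>UNIV. a i * Poly_Mapping.lookup n i) = (\<Sum>i\<in>UNIV. a i * Poly_Mapping.lookup m i)"
        using G(1) m n(1) by (simp add: whomogeneous_def)
      then have "a k * Poly_Mapping.lookup n k = a k * Poly_Mapping.lookup m k"
        using degree_pure[OF pure, of a] degree_pure[OF n(2), of a] by simp
      then show "Poly_Mapping.lookup n i = Poly_Mapping.lookup m i"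
        using pure n(2) pos by (cases "i = k") auto
    qed
    show ?thesis
    proof
      show "{n \<in> Poly_Mapping.keys G. ?pure n} \<subseteq> {m}"
        by (intro subsetI, elim CollectE conjE, drule (1) unique) simp
    qed (use m pure in simp)
  qed
  have "Poly_Mapping.lookup G m = 0"
    using G(2) unfolding poly_at_coordinate_point single by simp
  then show False using m by (simp add: in_keys_iff)
qed

text \<open>
  A sequence of points of \<open>X\<close> that tends to \<open>e\<^sub>k\<close> at weighted speed \<open>b\<close>. The congruence in \<open>weights\<close>
  expresses that \<open>b\<close> and \<open>a\<close> define the same action of the stabilizer of \<open>e\<^sub>k\<close>, whose order is
  \<open>a k\<close>; \<open>b\<close> may be chosen smaller than \<open>a\<close>.
\<close>

locale approaching_sequence = wproj_point_of a p x X
  for a :: "'n::{finite,linorder} \<Rightarrow> nat" and p x X +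
  fixes k :: 'n and b :: "'n \<Rightarrow> nat" and y :: "nat \<Rightarrow> 'n \<Rightarrow> complex" and \<tau> :: "nat \<Rightarrow> complex" and C :: real
  assumes x_eq: "x = (\<lambda>_. 0)(k := 1)"
    and pos: "a k > 0"
    and weights: "b k = 0" "\<And>i. i \<noteq> k \<Longrightarrow> b i > 0" "\<And>i. b i mod a k = a i mod a k"
    and \<tau>: "\<tau> \<longlonglongrightarrow> 0"
    and y_k: "\<And>n. y n k = 1"
    and y_bound: "\<And>n i. norm (y n i) \<le> C * norm (\<tau> n) ^ b i"
    and y_mem: "\<And>G. \<forall>q\<in>X. vanishes_at G q \<Longrightarrow> \<forall>\<^sub>F n in sequentially. poly_at (y n) G = 0"
begin

text \<open>
  The order of vanishing along the sequence separates the powers of the maximal ideal and is infinite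
  on the vanishing ideal of \<open>X\<close>; it thereby gives a lower bound for the cotangent space without
  knowledge of generators of that ideal.
\<close>

definition order_ge :: "nat \<Rightarrow> 'n rational_function set" where
  "order_ge e = {f. \<exists>B. \<forall>\<^sub>F n in sequentially. regular_at (y n) f \<and> norm (frac_at (y n) f) \<le> B * norm (\<tau> n) ^ e}"

lemma order_geI:
  "\<forall>\<^sub>F n in sequentially. regular_at (y n) f \<and> norm (frac_at (y n) f) \<le> B * norm (\<tau> n) ^ e \<Longrightarrow> f \<in> order_ge e"
  unfolding order_ge_def by blast

lemma order_geE:
  assumes "f \<in> order_ge e"
  obtains B where "\<forall>\<^sub>F n in sequentially. regular_at (y n) f \<and> norm (frac_at (y n) f) \<le> B * norm (\<tau> n) ^ e"
  using assms unfolding order_ge_def by blast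

lemma order_ge_add:
  assumes "f \<in> order_ge e" "g \<in> order_ge e"
  shows "f + g \<in> order_ge e"
proof -
  obtain B where B: "\<forall>\<^sub>F n in sequentially. regular_at (y n) f \<and> norm (frac_at (y n) f) \<le> B * norm (\<tau> n) ^ e"
    using assms(1) by (rule order_geE)
  obtain B' where B': "\<forall>\<^sub>F n in sequentially. regular_at (y n) g \<and> norm (frac_at (y n) g) \<le> B' * norm (\<tau> n) ^ e"
    using assms(2) by (rule order_geE)
  have "\<forall>\<^sub>F n in sequentially. regular_at (y n) (f + g) \<and> norm (frac_at (y n) (f + g)) \<le> (B + B') * norm (\<tau> n) ^ e"
    using B B'
  proof eventually_elim
    case (elim n)
    then have "norm (frac_at (y n) f + frac_at (y n) g) \<le> B * norm (\<tau> n) ^ e + B' * norm (\<tau> n) ^ e"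
      by (intro norm_triangle_mono) auto
    then show ?case
      using elim by (simp add: frac_at_add distrib_right)
  qed
  then show ?thesis by (rule order_geI)
qed

lemma order_ge_mult:
  assumes "f \<in> order_ge e" "g \<in> order_ge e'"
  shows "f * g \<in> order_ge (e + e')"
proof -
  obtain B where B: "\<forall>\<^sub>F n in sequentially. regular_at (y n) f \<and> norm (frac_at (y n) f) \<le> B * norm (\<tau> n) ^ e"
    using assms(1) by (rule order_geE)
  obtain B' where B': "\<forall>\<^sub>F n in sequentially. regular_at (y n) g \<and> norm (frac_at (y n) g) \<le> B' * norm (\<tau> n) ^ e'"
    using assms(2) by (rule order_geE)
  have "\<forall>\<^sub>F n in sequentially. regular_at (y n) (f * g) \<and> norm (frac_at (y n) (f * g)) \<le> (B * B') * norm (\<tau> n) ^ (e + e')"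
    using B B'
  proof eventually_elim
    case (elim n)
    then have "norm (frac_at (y n) f) * norm (frac_at (y n) g) \<le> (B * norm (\<tau> n) ^ e) * (B' * norm (\<tau> n) ^ e')"
      by (intro mult_mono) (auto intro: order_trans[OF norm_ge_zero])
    then show ?case
      using elim by (simp add: frac_at_mult norm_mult power_add mult_ac)
  qed
  then show ?thesis by (rule order_geI)
qed

lemma order_ge_zero: "0 \<in> order_ge e"
  by (rule order_geI[of _ 0]) simp

lemma y_tendsto: "(\<lambda>n. y n i) \<longlonglongrightarrow> x i"
proof (cases "i = k")
  case False
  have "(\<lambda>n. C * norm (\<tau> n) ^ b i) \<longlonglongrightarrow> C * norm (0::complex) ^ b i"
    by (intro tendsto_intros \<tau>)
  then have "(\<lambda>n. C * norm (\<tau> n) ^ b i) \<longlonglongrightarrow> 0"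
    using weights(2)[OF False] by (simp add: power_0_left)
  then have "(\<lambda>n. y n i) \<longlonglongrightarrow> 0"
    by (rule tendsto_0_le[where K = 1]) (auto intro!: always_eventually order_trans[OF y_bound])
  then show ?thesis using False by (simp add: x_eq)
qed (simp add: x_eq y_k)

text \<open>
  Since \<open>H\<close> contains a power of the variable \<open>k\<close>, the degree is a multiple of \<open>a k\<close>. So the \<open>b\<close>-weight of
  every monomial of \<open>G\<close> is a multiple of \<open>a k\<close>, and it is positive because \<open>G\<close> contains no power of
  the variable \<open>k\<close>.
\<close>

lemma form_order:
  assumes G: "whomogeneous a e G" "poly_at x G = 0" and H: "whomogeneous a e H" "poly_at x H \<noteq> 0"
  obtains B where "\<forall>\<^sub>F n in sequentially. norm (poly_at (y n) G) \<le> B * norm (\<tau> n) ^ a k"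
proof -
  let ?pure = "\<lambda>m. \<forall>i. i \<noteq> k \<longrightarrow> Poly_Mapping.lookup m i = 0"
  let ?wt = "\<lambda>m. \<Sum>i\<in>UNIV. b i * Poly_Mapping.lookup m i"
  obtain m1 where m1: "m1 \<in> Poly_Mapping.keys H" "?pure m1"
    using H(2) unfolding x_eq poly_at_coordinate_point by (metis (mono_tags, lifting) mem_Collect_eq sum.neutral)
  have "(\<Sum>i\<in>UNIV. a i * Poly_Mapping.lookup m1 i) = e"
    using H(1) m1(1) by (simp add: whomogeneous_def)
  then have e: "e = a k * Poly_Mapping.lookup m1 k"
    using degree_pure[OF m1(2), of a] by simp
  have wt: "a k \<le> ?wt m" if m: "m \<in> Poly_Mapping.keys G" for m
  proof -
    obtain i where i: "i \<noteq> k" "Poly_Mapping.lookup m i \<noteq> 0"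
      using coordinate_point_zero_keys[OF G(1) _ pos m] G(2) by (auto simp: x_eq)
    have "0 < b i * Poly_Mapping.lookup m i"
      using i weights(2) by simp
    also have "\<dots> \<le> ?wt m"
      by (rule member_le_sum) auto
    finally have "0 < ?wt m" .
    moreover have "?wt m mod a k = (\<Sum>i\<in>UNIV. a i * Poly_Mapping.lookup m i) mod a k"
    proof -
      have "b i * Poly_Mapping.lookup m i mod a k = a i * Poly_Mapping.lookup m i mod a k" for i
        using weights(3)[of i] by (metis mod_mult_left_eq)
      then show ?thesis
        using mod_sum_eq[of "\<lambda>i. b i * Poly_Mapping.lookup m i" "a k" UNIV]
          mod_sum_eq[of "\<lambda>i. a i * Poly_Mapping.lookup m i" "a k" UNIV] by simp
    qed
    then have "a k dvd ?wt m"
      using G(1) m e by (simp add: whomogeneous_def mod_eq_0_iff_dvd)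
    ultimately show ?thesis
      by (simp add: dvd_imp_le)
  qed
  define B where "B = (\<Sum>m\<in>Poly_Mapping.keys G. norm (Poly_Mapping.lookup G m) * (\<Prod>i\<in>UNIV. C ^ Poly_Mapping.lookup m i))"
  have "\<forall>\<^sub>F n in sequentially. norm (\<tau> n) < 1"
    by (rule order_tendstoD(2)[OF tendsto_norm[OF \<tau>]]) simp
  then have "\<forall>\<^sub>F n in sequentially. norm (poly_at (y n) G) \<le> B * norm (\<tau> n) ^ a k"
  proof eventually_elim
    case (elim n)
    have C: "0 \<le> C"
      using y_bound[of n k] weights(1) y_k by simp
    have "norm (poly_at (y n) G) \<le> (\<Sum>m\<in>Poly_Mapping.keys G. norm (Poly_Mapping.lookup G m * (\<Prod>i\<in>UNIV. y n i ^ Poly_Mapping.lookup m i)))"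
      unfolding peval_def by (rule norm_sum)
    also have "\<dots> \<le> (\<Sum>m\<in>Poly_Mapping.keys G. norm (Poly_Mapping.lookup G m) * (\<Prod>i\<in>UNIV. C ^ Poly_Mapping.lookup m i) * norm (\<tau> n) ^ a k)"
    proof (rule sum_mono)
      fix m assume m: "m \<in> Poly_Mapping.keys G"
      have "(\<Prod>i\<in>UNIV. norm (y n i) ^ Poly_Mapping.lookup m i) \<le> (\<Prod>i\<in>UNIV. (C * norm (\<tau> n) ^ b i) ^ Poly_Mapping.lookup m i)"
        using y_bound by (intro prod_mono conjI power_mono) auto
      also have "\<dots> = (\<Prod>i\<in>UNIV. C ^ Poly_Mapping.lookup m i) * norm (\<tau> n) ^ ?wt m"
        by (simp add: power_mult_distrib prod.distrib power_sum flip: power_mult)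
      also have "\<dots> \<le> (\<Prod>i\<in>UNIV. C ^ Poly_Mapping.lookup m i) * norm (\<tau> n) ^ a k"
        using elim C wt[OF m] by (intro mult_left_mono power_decreasing prod_nonneg) auto
      finally have "norm (Poly_Mapping.lookup G m) * (\<Prod>i\<in>UNIV. norm (y n i) ^ Poly_Mapping.lookup m i) \<le>
          norm (Poly_Mapping.lookup G m) * ((\<Prod>i\<in>UNIV. C ^ Poly_Mapping.lookup m i) * norm (\<tau> n) ^ a k)"
        by (rule mult_left_mono) simp
      then show "norm (Poly_Mapping.lookup G m * (\<Prod>i\<in>UNIV. y n i ^ Poly_Mapping.lookup m i)) \<le>
          norm (Poly_Mapping.lookup G m) * (\<Prod>i\<in>UNIV. C ^ Poly_Mapping.lookup m i) * norm (\<tau> n) ^ a k"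
        by (simp add: norm_mult prod_norm[symmetric] norm_power mult.assoc)
    qed
    finally show ?case
      by (simp add: B_def sum_distrib_right)
  qed
  then show thesis by (rule that)
qed

lemma nonvanishing_eventually:
  assumes "poly_at x H \<noteq> 0"
  shows "\<forall>\<^sub>F n in sequentially. norm (poly_at x H) / 2 < norm (poly_at (y n) H)"
  by (rule order_tendstoD(1)[OF tendsto_norm[OF poly_at_tendsto[OF y_tendsto]]]) (use assms in simp)

lemma maximal_ideal_order: "f \<in> \<mm> \<Longrightarrow> f \<in> order_ge (a k)"
proof -
  assume "f \<in> \<mm>"
  then have f: "f \<in> \<O>" "frac_at x f = 0"
    by (simp_all add: maximal_ideal_iff)
  then obtain G H e where GH: "f = Fract G H" "whomogeneous a e G" "whomogeneous a e H" "poly_at x H \<noteq> 0"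
    using local_ring_iff by blast
  then have "poly_at x G = 0"
    using f(2) by (simp add: frac_at_Fract)
  then obtain B where B: "\<forall>\<^sub>F n in sequentially. norm (poly_at (y n) G) \<le> B * norm (\<tau> n) ^ a k"
    using form_order[OF GH(2) _ GH(3,4)] by blast
  have "\<forall>\<^sub>F n in sequentially. regular_at (y n) f \<and> norm (frac_at (y n) f) \<le> (B / (norm (poly_at x H) / 2)) * norm (\<tau> n) ^ a k"
    using B nonvanishing_eventually[OF GH(4)]
  proof eventually_elim
    case (elim n)
    have H: "poly_at (y n) H \<noteq> 0"
      using elim(2) by auto
    have "norm (poly_at (y n) G) / norm (poly_at (y n) H) \<le> (B * norm (\<tau> n) ^ a k) / (norm (poly_at x H) / 2)"
      using elim GH(4) by (intro frac_le) (auto intro: order_trans[OF norm_ge_zero])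
    then show ?case
      using H by (simp add: GH(1) regular_at_Fract frac_at_Fract norm_divide mult_ac)
  qed
  then show ?thesis by (rule order_geI)
qed

lemma vanishing_ideal_order: "f \<in> I \<Longrightarrow> f \<in> order_ge e"
proof -
  assume "f \<in> I"
  then obtain G H d where GH: "f = Fract G H" "whomogeneous a d G" "whomogeneous a d H" "poly_at x H \<noteq> 0"
    "\<forall>q\<in>X. vanishes_at G q"
    by (rule vanishing_idealE)
  have "\<forall>\<^sub>F n in sequentially. regular_at (y n) f \<and> norm (frac_at (y n) f) \<le> 0 * norm (\<tau> n) ^ e"
    using y_mem[OF GH(5)] nonvanishing_eventually[OF GH(4)]
  proof eventually_elim
    case (elim n)
    then have "poly_at (y n) H \<noteq> 0"
      by auto
    then show ?case
      using elim by (simp add: GH(1) regular_at_Fract frac_at_Fract)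
  qed
  then show ?thesis by (rule order_geI)
qed

lemma filt_2_order: "f \<in> filt 2 \<Longrightarrow> f \<in> order_ge (a k + a k)"
proof -
  assume "f \<in> filt 2"
  then obtain g h where gh: "f = g + h" "g \<in> M (Suc (Suc 0))" "h \<in> I"
    by (auto simp: filt_iff numeral_2_eq_2)
  have "g \<in> sums_of_products \<mm> \<mm>"
    using gh(2) unfolding maximal_ideal_power_Suc[of "Suc 0"] maximal_ideal_power_1 .
  then have "g \<in> order_ge (a k + a k)"
    by (induction rule: sums_of_products_induct)
      (auto intro: order_ge_zero order_ge_mult order_ge_add maximal_ideal_order)
  then show ?thesis
    using gh(1,3) vanishing_ideal_order order_ge_add by blast
qed

lemma order_leading_coefficient:
  assumes "f \<in> order_ge (e + e')" "e' > 0" "\<And>n. \<tau> n \<noteq> 0"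
    "\<forall>\<^sub>F n in sequentially. frac_at (y n) f = \<tau> n ^ e * v"
  shows "v = 0"
proof -
  obtain B where B: "\<forall>\<^sub>F n in sequentially. regular_at (y n) f \<and> norm (frac_at (y n) f) \<le> B * norm (\<tau> n) ^ (e + e')"
    using assms(1) by (rule order_geE)
  have "\<forall>\<^sub>F n in sequentially. norm v \<le> B * norm (\<tau> n) ^ e'"
    using B assms(4)
  proof eventually_elim
    case (elim n)
    then have "norm (\<tau> n) ^ e * norm v \<le> norm (\<tau> n) ^ e * (B * norm (\<tau> n) ^ e')"
      by (simp add: norm_mult norm_power power_add mult_ac)
    then show ?case
      using assms(3)[of n] by simp
  qed
  moreover have "(\<lambda>n. B * norm (\<tau> n) ^ e') \<longlonglongrightarrow> B * norm (0::complex) ^ e'"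
    by (intro tendsto_intros \<tau>)
  ultimately have "norm v \<le> B * norm (0::complex) ^ e'"
    by (intro tendsto_le[OF _ _ tendsto_const]) auto
  then show ?thesis
    using assms(2) by (simp add: power_0_left)
qed

end

subsection \<open>Cotangent spaces at quotient singularities\<close>

lemma hypersurface_point:
  assumes X: "X = {q \<in> wproj a. vanishes_at F q}" and F: "whomogeneous a d F"
    and y: "y \<noteq> (\<lambda>_. 0)" "poly_at y F = 0"
  obtains q where "q \<in> X" "y \<in> q"
proof -
  let ?q = "wproj_rel a `` {y}"
  have q: "?q \<in> wproj a"
    unfolding wproj_def using y(1) by (intro quotientI) simp
  have "y \<in> ?q"
    using y(1) by (auto simp: wproj_rel_def intro: exI[of _ 1])
  moreover have "vanishes_at F ?q"
    unfolding vanishes_at_def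
  proof
    fix z assume "z \<in> ?q"
    then obtain l where "\<forall>i. z i = l ^ a i * y i"
      by (auto simp: wproj_rel_def)
    then have "z = (\<lambda>i. l ^ a i * y i)" by auto
    then show "poly_at z F = 0"
      using poly_at_scale[OF F] y(2) by simp
  qed
  ultimately show thesis
    using that q X by blast
qed

lemma exists_root:
  fixes c :: complex
  assumes "n > 0"
  obtains l where "l ^ n = c"
proof -
  have "\<not> constant (poly (monom 1 n + [:- c:]))"
    using assms by (simp add: constant_degree degree_add_eq_left degree_monom_eq)
  then obtain l where "poly (monom 1 n + [:- c:]) l = 0"
    using fundamental_theorem_of_algebra by blast
  then show thesis
    using that[of l] by (simp add: poly_monom)
qed

text \<open>
  The common part of \<open>cotangent_dim\<close> and \<open>tangent_cone_iso\<close>: the \<open>t j\<close> span the cotangent space, not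
  necessarily as a basis.
\<close>

definition cotangent_generators ::
  "('n::{finite,linorder} \<Rightarrow> nat) \<Rightarrow> ('n \<Rightarrow> complex) set set \<Rightarrow> ('n \<Rightarrow> complex) set \<Rightarrow> 'j set \<Rightarrow>
    ('j \<Rightarrow> 'n rational_function) \<Rightarrow> bool" where
  "cotangent_generators a X p T t \<longleftrightarrow> (\<forall>f \<in> local_filtration a X p 1. \<exists>c.
     f - (\<Sum>j\<in>T. const_fun (c j) * t j) \<in> local_filtration a X p 2)"

lemma cotangent_dim_generators:
  assumes "cotangent_dim a X p n"
  obtains t where "cotangent_generators a X p {..<n} t"
  using assms unfolding cotangent_dim_def cotangent_generators_def by blast

lemma tangent_cone_generators:
  assumes "tangent_cone_iso a X p (c :: 'm::{finite,linorder} cpoly)"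
  obtains t where "cotangent_generators a X p (UNIV :: 'm set) t"
proof -
  obtain t where t: "\<forall>k. \<forall>f \<in> local_filtration a X p k. \<exists>g::'m cpoly. whomogeneous (\<lambda>_. 1) k g \<and>
        f - peval const_fun t g \<in> local_filtration a X p (Suc k)"
    using assms unfolding tangent_cone_iso_def by blast
  have "cotangent_generators a X p (UNIV :: 'm set) t"
    unfolding cotangent_generators_def
  proof
    fix f assume "f \<in> local_filtration a X p 1"
    then obtain g :: "'m cpoly" where g: "whomogeneous (\<lambda>_. 1) 1 g" "f - peval const_fun t g \<in> local_filtration a X p (Suc 1)"
      using t by blast
    obtain b where "\<And>z. peval (const_fun :: complex \<Rightarrow> 'a rational_function) z g = (\<Sum>i\<in>UNIV. const_fun (b i) * z i)"
      using g(1) by (rule const_fun.linear_form_eq) blast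
    then show "\<exists>c. f - (\<Sum>j\<in>UNIV. const_fun (c j) * t j) \<in> local_filtration a X p 2"
      using g(2) by (intro exI[of _ b]) (simp add: numeral_2_eq_2)
  qed
  then show thesis by (rule that)
qed

lemma curve_zero:
  assumes "b k = 0" "\<And>i. i \<noteq> k \<Longrightarrow> b i > 0" "\<alpha> k = 0" "\<beta> k = 1"
  shows "curve b \<beta> \<alpha> 0 \<sigma> = (\<lambda>_. 0)(k := 1)"
proof
  fix i
  show "curve b \<beta> \<alpha> 0 \<sigma> i = ((\<lambda>_. 0)(k := 1)) i"
  proof (cases "i = k")
    case False
    then have "b i \<noteq> 0"
      using assms(2)[of i] by simp
    then show ?thesis
      using False by (simp add: curve_def)
  qed (use assms in \<open>simp add: curve_def\<close>)
qed

text \<open>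
  If fewer than \<open>n\<close> elements span the cotangent space, then some nontrivial combination with
  coefficients \<open>e i\<close> of the \<open>n\<close> functions given by \<open>q \<beta> i\<close> lies in the second step of the
  filtration. For every \<open>\<mu>\<close> there is a sequence of points of \<open>X\<close> along which this combination equals
  \<open>\<tau>\<^bsup>a k\<^esup> \<Sum> e\<^sub>i \<mu>\<^sup>i\<close> but has order at least \<open>2 a k\<close>. So the polynomial \<open>\<Sum> e\<^sub>i \<mu>\<^sup>i\<close> vanishes identically.
  The direction \<open>\<beta>\<close> has to avoid the initial cone of \<open>F\<close>; that is why the forms \<open>q \<beta> i\<close>, which do not
  see the parameter \<open>\<sigma>\<close>, depend on it.
\<close>

lemma quotient_point_large_cotangent:
  fixes a b :: "'n::{finite,linorder} \<Rightarrow> nat" and q :: "('n \<Rightarrow> complex) \<Rightarrow> nat \<Rightarrow> 'n cpoly"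
    and \<alpha> :: "complex \<Rightarrow> 'n \<Rightarrow> complex" and t :: "'j \<Rightarrow> 'n rational_function"
  assumes X: "X = {q \<in> wproj a. vanishes_at F q}" and F: "F \<noteq> 0" "whomogeneous a d F"
    and p: "p \<in> X" "(\<lambda>_. 0)(k := 1) \<in> p"
    and pos: "a k > 0"
    and b: "b k = 0" "\<And>i. i \<noteq> k \<Longrightarrow> b i > 0" "\<And>i. b i mod a k = a i mod a k"
    and \<alpha>: "\<And>\<mu>. \<alpha> \<mu> k = 0"
    and q_hom: "\<And>\<beta> i. i < n \<Longrightarrow> whomogeneous a (N i * a k) (q \<beta> i)"
    and q_val: "\<And>\<beta> \<mu> \<tau> \<sigma> i. (\<And>j. \<beta> j \<noteq> 0) \<Longrightarrow> \<beta> k = 1 \<Longrightarrow> i < n \<Longrightarrow>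
      poly_at (curve b \<beta> (\<alpha> \<mu>) \<tau> \<sigma>) (q \<beta> i) = \<tau> ^ a k * \<mu> ^ i"
    and T: "finite T" "card T < n" and gen: "cotangent_generators a X p T t"
  shows False
proof -
  let ?x = "(\<lambda>_. 0)(k := 1) :: 'n \<Rightarrow> complex"
  have pw: "p \<in> wproj a" and vF: "vanishes_at F p"
    using p X by auto
  interpret wproj_point_of a p ?x X
    by unfold_locales (use p pw in auto)
  have Fx: "poly_at ?x F = 0"
    using vF p(2) by (simp add: vanishes_at_def)
  define wt where "wt m = (\<Sum>i\<in>UNIV. b i * Poly_Mapping.lookup m i)" for m :: "'n \<Rightarrow>\<^sub>0 nat"
  have wt_pos: "wt m > 0" if m: "m \<in> Poly_Mapping.keys F" for m
  proof -
    obtain i where i: "i \<noteq> k" "Poly_Mapping.lookup m i \<noteq> 0"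
      using coordinate_point_zero_keys[OF F(2) Fx pos m] by blast
    then have "0 < b i * Poly_Mapping.lookup m i"
      using b(2) by simp
    also have "\<dots> \<le> wt m"
      unfolding wt_def by (rule member_le_sum) auto
    finally show ?thesis .
  qed
  \<comment> \<open>The order of \<open>F\<close> at \<open>e\<^sub>k\<close> and, as \<open>F0\<close>, its initial form.\<close>
  define m0 where "m0 = Min (wt ` Poly_Mapping.keys F)"
  have ne: "wt ` Poly_Mapping.keys F \<noteq> {}"
    using F(1) by (simp add: keys_eq_empty)
  then have "m0 \<in> wt ` Poly_Mapping.keys F"
    unfolding m0_def by (intro Min_in) auto
  then obtain m1 where m1: "m1 \<in> Poly_Mapping.keys F" "wt m1 = m0" by blast
  have m0: "m0 > 0" "\<And>m. m \<in> Poly_Mapping.keys F \<Longrightarrow> m0 \<le> wt m"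
    using m1(2) wt_pos[OF m1(1)] by (simp_all add: m0_def)
  define F0 where "F0 = (\<Sum>m\<in>{m \<in> Poly_Mapping.keys F. wt m = m0}. Poly_Mapping.single m (Poly_Mapping.lookup F m))"
  have F0: "Poly_Mapping.lookup F0 m = (if wt m = m0 then Poly_Mapping.lookup F m else 0)" for m
  proof -
    have "Poly_Mapping.lookup F0 m = (\<Sum>m'\<in>{m \<in> Poly_Mapping.keys F. wt m = m0}. if m' = m then Poly_Mapping.lookup F m' else 0)"
      unfolding F0_def lookup_sum by (intro sum.cong) (auto simp: lookup_single when_def)
    then show ?thesis
      by (auto simp: in_keys_iff)
  qed
  have "F0 \<noteq> 0"
    using F0[of m1] m1 by (auto simp: in_keys_iff)
  then obtain \<beta>' where \<beta>': "\<And>i. \<beta>' i \<noteq> 0" "poly_at \<beta>' F0 \<noteq> 0"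
    by (rule nonvanishing_point) blast
  \<comment> \<open>Scaling by \<open>l\<close> normalizes the coordinate \<open>k\<close> to \<open>1\<close> and keeps \<open>F0\<close> nonzero.\<close>
  obtain l where l: "l ^ a k = inverse (\<beta>' k)"
    using exists_root[OF pos] by blast
  have l0: "l \<noteq> 0"
    using l pos \<beta>'(1)[of k] by (metis inverse_nonzero_iff_nonzero power_0_left less_numeral_extra(3))
  define \<beta> where "\<beta> i = l ^ a i * \<beta>' i" for i
  have \<beta>: "\<And>i. \<beta> i \<noteq> 0" "\<beta> k = 1"
    using \<beta>'(1) l0 l by (simp_all add: \<beta>_def)
  have "whomogeneous a d F0"
    using F(2) by (auto simp: whomogeneous_def in_keys_iff F0 split: if_splits)
  then have "poly_at \<beta> F0 \<noteq> 0"
    using poly_at_scale[of a d F0 l \<beta>'] \<beta>'(2) l0 by (simp add: \<beta>_def[abs_def])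
  note zeros = curve_zeros[where b = b and F = F and \<beta> = \<beta>, folded wt_def, OF _ m0(1) _ F0 this]
  define s where "s i = Fract (q \<beta> i) (pvar k ^ N i)" for i
  have s_mem: "s i \<in> filt 1" if i: "i < n" for i
  proof -
    have "poly_at (curve b \<beta> (\<alpha> 0) 0 0) (q \<beta> i) = 0"
      using q_val[where \<beta> = \<beta>, OF \<beta> i] pos by (simp add: power_0_left)
    then have "poly_at ?x (q \<beta> i) = 0"
      using curve_zero[of b k "\<alpha> 0" \<beta> 0, OF b(1,2) \<alpha> \<beta>(2)] by simp
    moreover have "s i \<in> \<O>"
      unfolding s_def using q_hom[OF i] whomogeneous_power[OF whomogeneous_pvar[of a k]]
      by (intro local_ringI) auto
    ultimately show ?thesis
      using filt_1 by (simp add: maximal_ideal_iff s_def frac_at_Fract)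
  qed
  have "\<exists>c. \<forall>i<n. s i - (\<Sum>j\<in>T. const_fun (c i j) * t j) \<in> filt 2"
  proof -
    have "\<forall>i. \<exists>c. i < n \<longrightarrow> s i - (\<Sum>j\<in>T. const_fun (c j) * t j) \<in> filt 2"
      using s_mem gen unfolding cotangent_generators_def by blast
    then show ?thesis by (rule choice[THEN exE]) blast
  qed
  then obtain c where c: "\<And>i. i < n \<Longrightarrow> s i - (\<Sum>j\<in>T. const_fun (c i j) * t j) \<in> filt 2"
    by blast
  obtain e where e: "\<exists>i\<in>{..<n}. e i \<noteq> 0" "\<forall>j\<in>T. (\<Sum>i<n. c i j * e i) = 0"
    using underdetermined_system[OF T(1) finite_lessThan[of n], of "\<lambda>j i. c i j"] T(2) by auto
  have "(\<Sum>i<n. const_fun (e i) * (s i - (\<Sum>j\<in>T. const_fun (c i j) * t j))) \<in> filt 2"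
    using c by (intro filt_sum filt_cmult) simp
  moreover have "(\<Sum>i<n. const_fun (e i) * (\<Sum>j\<in>T. const_fun (c i j) * t j)) = 0"
  proof -
    have "(\<Sum>i<n. const_fun (e i) * (\<Sum>j\<in>T. const_fun (c i j) * t j)) =
        (\<Sum>i<n. \<Sum>j\<in>T. const_fun (c i j * e i) * t j)"
      by (simp add: sum_distrib_left const_fun.map_mult mult_ac)
    also have "\<dots> = (\<Sum>j\<in>T. const_fun (\<Sum>i<n. c i j * e i) * t j)"
      by (subst sum.swap) (simp add: const_fun.map_sum sum_distrib_right)
    also have "\<dots> = 0"
      using e(2) by (simp add: const_fun.map_zero)
    finally show ?thesis .
  qed
  ultimately have comb: "(\<Sum>i<n. const_fun (e i) * s i) \<in> filt 2"
    by (simp add: right_diff_distrib sum_subtractf)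
  have "(\<Sum>i<n. e i * \<mu> ^ i) = 0" for \<mu>
  proof -
    obtain R where R: "\<forall>\<^sub>F \<tau> in at 0. \<exists>\<sigma>. norm \<sigma> \<le> R \<and> poly_at (curve b \<beta> (\<alpha> \<mu>) \<tau> \<sigma>) F = 0"
      using zeros[of "\<alpha> \<mu>"] m0(2) b(2) \<alpha> by (metis less_numeral_extra(3))
    have lim: "filterlim (\<lambda>n. of_real (inverse (real (Suc n))) :: complex) (at 0) sequentially"
      unfolding filterlim_at
    proof
      show "(\<lambda>n. of_real (inverse (real (Suc n))) :: complex) \<longlonglongrightarrow> 0"
        using tendsto_of_real[OF LIMSEQ_inverse_real_of_nat, where ?'a = complex] by simp
    qed (simp del: of_nat_Suc)
    have "\<forall>\<^sub>F n in sequentially. \<exists>\<sigma>. norm \<sigma> \<le> R \<and>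
        poly_at (curve b \<beta> (\<alpha> \<mu>) (of_real (inverse (real (Suc n)))) \<sigma>) F = 0"
      using R lim by (rule eventually_compose_filterlim)
    then obtain n0 where n0: "\<And>n. n \<ge> n0 \<Longrightarrow> \<exists>\<sigma>. norm \<sigma> \<le> R \<and>
        poly_at (curve b \<beta> (\<alpha> \<mu>) (of_real (inverse (real (Suc n)))) \<sigma>) F = 0"
      by (auto simp: eventually_sequentially)
    define \<tau> :: "nat \<Rightarrow> complex" where "\<tau> n = of_real (inverse (real (Suc (n + n0))))" for n
    have "\<forall>n. \<exists>\<sigma>. norm \<sigma> \<le> R \<and> poly_at (curve b \<beta> (\<alpha> \<mu>) (\<tau> n) \<sigma>) F = 0"
      unfolding \<tau>_def by (intro allI n0) simp
    then obtain \<sigma> where \<sigma>: "\<And>n. norm (\<sigma> n) \<le> R" "\<And>n. poly_at (curve b \<beta> (\<alpha> \<mu>) (\<tau> n) (\<sigma> n)) F = 0"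
      by metis
    define y where "y n = curve b \<beta> (\<alpha> \<mu>) (\<tau> n) (\<sigma> n)" for n
    define C where "C = (\<Sum>i\<in>UNIV. norm (\<alpha> \<mu> i) + R ^ b i * norm (\<beta> i))"
    have R0: "R \<ge> 0"
      using \<sigma>(1)[of 0] norm_ge_zero order_trans by blast
    have y_k: "y n k = 1" for n
      by (simp add: y_def curve_def b(1) \<alpha> \<beta>(2))
    have "norm (y n i) \<le> C * norm (\<tau> n) ^ b i" for n i
    proof -
      have "norm (\<alpha> \<mu> i + \<sigma> n ^ b i * \<beta> i) \<le> norm (\<alpha> \<mu> i) + norm (\<sigma> n) ^ b i * norm (\<beta> i)"
        by (metis norm_triangle_ineq norm_mult norm_power)
      also have "\<dots> \<le> norm (\<alpha> \<mu> i) + R ^ b i * norm (\<beta> i)"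
        using \<sigma>(1) by (intro add_left_mono mult_right_mono power_mono) auto
      also have "\<dots> \<le> C"
        unfolding C_def using R0 by (intro member_le_sum) auto
      finally have "norm (\<tau> n) ^ b i * norm (\<alpha> \<mu> i + \<sigma> n ^ b i * \<beta> i) \<le> norm (\<tau> n) ^ b i * C"
        by (rule mult_left_mono) simp
      then show ?thesis
        by (simp add: y_def curve_def norm_mult norm_power mult.commute)
    qed
    moreover have "poly_at (y n) G = 0" if G: "\<forall>q\<in>X. vanishes_at G q" for n G
    proof -
      have "y n \<noteq> (\<lambda>_. 0)"
        using y_k[of n] by (metis zero_neq_one)
      then obtain q where "q \<in> X" "y n \<in> q"
        using hypersurface_point[OF X F(2)] \<sigma>(2) y_def by metis
      then show ?thesis
        using G by (simp add: vanishes_at_def)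
    qed
    moreover have "\<tau> \<longlonglongrightarrow> 0"
      unfolding \<tau>_def using filterlim_at[THEN iffD1, OF lim]
      by (intro LIMSEQ_ignore_initial_segment) auto
    ultimately interpret approaching_sequence a p ?x X k b y \<tau> C
      by unfold_locales (use pos b y_k in auto)
    have s_at: "regular_at (y m) (s i)" "frac_at (y m) (s i) = \<tau> m ^ a k * \<mu> ^ i" if i: "i < n" for m i
      using q_val[where \<beta> = \<beta> and \<mu> = \<mu> and \<tau> = "\<tau> m" and \<sigma> = "\<sigma> m", OF \<beta> i] y_k[of m]
      unfolding s_def by (simp_all add: regular_at_Fract frac_at_Fract flip: y_def)
    show ?thesis
    proof (rule order_leading_coefficient[OF filt_2_order[OF comb] pos])
      show "\<tau> m \<noteq> 0" for m
        unfolding \<tau>_def by (simp del: of_nat_Suc)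
      show "\<forall>\<^sub>F m in sequentially. frac_at (y m) (\<Sum>i<n. const_fun (e i) * s i) = \<tau> m ^ a k * (\<Sum>i<n. e i * \<mu> ^ i)"
      proof (intro always_eventually allI)
        fix m
        have reg: "regular_at (y m) (const_fun (e i) * s i)" if "i \<in> {..<n}" for i
          using that by (intro frac_at_cmult(1) s_at(1)) simp
        have "frac_at (y m) (\<Sum>i<n. const_fun (e i) * s i) = (\<Sum>i<n. frac_at (y m) (const_fun (e i) * s i))"
          using reg by (rule frac_at_sum(2))
        also have "\<dots> = (\<Sum>i<n. \<tau> m ^ a k * (e i * \<mu> ^ i))"
        proof (intro sum.cong refl)
          fix i assume "i \<in> {..<n}"
          then have "i < n" by simp
          then show "frac_at (y m) (const_fun (e i) * s i) = \<tau> m ^ a k * (e i * \<mu> ^ i)"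
            by (simp add: frac_at_cmult(2)[OF s_at(1)] s_at(2))
        qed
        also have "\<dots> = \<tau> m ^ a k * (\<Sum>i<n. e i * \<mu> ^ i)"
          by (simp only: sum_distrib_left)
        finally show "frac_at (y m) (\<Sum>i<n. const_fun (e i) * s i) = \<tau> m ^ a k * (\<Sum>i<n. e i * \<mu> ^ i)" .
      qed
    qed
  qed
  then have "poly (\<Sum>i<n. monom (e i) i) = poly 0"
    by (auto simp: poly_sum poly_monom fun_eq_iff)
  then have "(\<Sum>i<n. monom (e i) i) = 0"
    by (simp only: poly_eq_poly_eq_iff)
  then have coeffs: "(\<Sum>j<n. coeff (monom (e j) j) i) = 0" for i
    by (metis coeff_sum coeff_0)
  have "e i = 0" if "i < n" for i
    using coeffs[of i] that by simp
  then show False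
    using e(1) by blast
qed

section \<open>The two families\<close>

lemma UNIV_5: "(UNIV::5 set) = {0, 1, 2, 3, 4}"
  by (rule card_subset_eq[symmetric]) simp_all

lemma sum_5: "(\<Sum>i\<in>(UNIV::5 set). f i) = f 0 + f 1 + f 2 + f 3 + f 4" for f :: "5 \<Rightarrow> 'b::comm_monoid_add"
  unfolding UNIV_5 by (simp add: add.assoc)

lemma five_cases:
  fixes i :: 5
  obtains "i = 0" | "i = 1" | "i = 2" | "i = 3" | "i = 4"
proof -
  have "i \<in> {0, 1, 2, 3, 4}"
    unfolding UNIV_5[symmetric] by simp
  then show thesis
    using that by blast
qed

lemma weights_11114_simps [simp]:
  "weights_11114 0 = 1" "weights_11114 1 = 1" "weights_11114 2 = 1" "weights_11114 3 = 1" "weights_11114 4 = 4"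
  by (simp_all add: weights_11114_def)

lemma weights_11125_simps [simp]:
  "weights_11125 0 = 1" "weights_11125 1 = 1" "weights_11125 2 = 1" "weights_11125 3 = 2" "weights_11125 4 = 5"
  by (simp_all add: weights_11125_def)

lemma poly_mapping_single_eqI:
  fixes m :: "'n \<Rightarrow>\<^sub>0 nat"
  shows "Poly_Mapping.lookup m i = n \<Longrightarrow> (\<And>j. j \<noteq> i \<Longrightarrow> Poly_Mapping.lookup m j = 0) \<Longrightarrow> m = Poly_Mapping.single i n"
  by (rule poly_mapping_eqI) (auto simp: lookup_single when_def)

text \<open>
  The degree is twice the weight of the last coordinate.
\<close>

lemma double_cover_keys:
  fixes F :: "5 cpoly"
  assumes a: "(a = weights_11114 \<and> d = 8) \<or> (a = weights_11125 \<and> d = 10)"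
    and F: "whomogeneous a d F" and m: "m \<in> Poly_Mapping.keys F"
  shows "Poly_Mapping.lookup m 4 \<le> 1 \<or> m = Poly_Mapping.single 4 2"
proof -
  let ?l = "Poly_Mapping.lookup m"
  have "a 0 * ?l 0 + a 1 * ?l 1 + a 2 * ?l 2 + a 3 * ?l 3 + a 4 * ?l 4 = d"
    using F m by (simp add: whomogeneous_def sum_5)
  then have "?l 4 \<le> 1 \<or> (?l 4 = 2 \<and> ?l 0 = 0 \<and> ?l 1 = 0 \<and> ?l 2 = 0 \<and> ?l 3 = 0)"
    using a by auto
  moreover have "m = Poly_Mapping.single 4 2" if "?l 4 = 2 \<and> ?l 0 = 0 \<and> ?l 1 = 0 \<and> ?l 2 = 0 \<and> ?l 3 = 0"
  proof (rule poly_mapping_single_eqI)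
    show "?l j = 0" if "j \<noteq> 4" for j
      using \<open>?l 4 = 2 \<and> ?l 0 = 0 \<and> ?l 1 = 0 \<and> ?l 2 = 0 \<and> ?l 3 = 0\<close> that by (cases j rule: five_cases) auto
  qed (use that in simp)
  ultimately show ?thesis by blast
qed

lemma double_cover_square_coefficient:
  fixes F :: "5 cpoly"
  assumes a: "(a = weights_11114 \<and> d = 8) \<or> (a = weights_11125 \<and> d = 10)"
    and F: "whomogeneous a d F" and nz: "poly_at ((\<lambda>_. 0)(4 := 1)) F \<noteq> 0"
  shows "Poly_Mapping.lookup F (Poly_Mapping.single 4 2) \<noteq> 0"
proof -
  obtain m where m: "m \<in> Poly_Mapping.keys F" "\<forall>i. i \<noteq> 4 \<longrightarrow> Poly_Mapping.lookup m i = 0"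
    using nz unfolding poly_at_coordinate_point by (metis (mono_tags, lifting) mem_Collect_eq sum.neutral)
  have "a 4 * Poly_Mapping.lookup m 4 = d"
    using F m(1) degree_pure[OF m(2), of a] by (simp add: whomogeneous_def)
  then have "Poly_Mapping.lookup m 4 = 2"
    using a by auto
  then have "m = Poly_Mapping.single 4 2"
    using double_cover_keys[OF a F m(1)] by auto
  then show ?thesis
    using m(1) by (simp add: in_keys_iff)
qed

text \<open>
  The projection along \<open>\<beta>\<close> to the coordinate \<open>i\<close>; the factor \<open>u\<close> makes it homogeneous if the
  coordinates \<open>i\<close> and \<open>j\<close> differ in weight.
\<close>

definition linear_projection :: "('n \<Rightarrow> complex) \<Rightarrow> 'n \<Rightarrow> 'n \<Rightarrow> 'n cpoly \<Rightarrow> 'n cpoly" where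
  "linear_projection \<beta> i j u = pvar i - Poly_Mapping.single 0 (\<beta> i / \<beta> j) * (u * pvar j)"

lemma linear_projection_curve:
  assumes "\<beta> j \<noteq> 0" "b i = 1" "b j = 1" "\<alpha> j = 0" "poly_at (curve b \<beta> \<alpha> \<tau> \<sigma>) u = 1"
  shows "poly_at (curve b \<beta> \<alpha> \<tau> \<sigma>) (linear_projection \<beta> i j u) = \<tau> * \<alpha> i"
  using assms by (simp add: linear_projection_def curve_def algebra_simps)

lemma whomogeneous_linear_projection:
  assumes "whomogeneous a e u" "a i = e + a j"
  shows "whomogeneous a (a i) (linear_projection \<beta> i j u)"
  unfolding linear_projection_def
  by (intro whomogeneous_diff whomogeneous_pvar whomogeneous_cmult)
    (use assms whomogeneous_mult[OF assms(1) whomogeneous_pvar] in simp)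

text \<open>
  As forms take the products of order \<open>a 4\<close> of two projections to coordinates of weight one. On the
  curves, these have the values \<open>\<tau> \<mu>\<close> and \<open>\<tau>\<close>, so five of the products are \<open>\<tau>\<^bsup>a 4\<^esup>\<close> times
  \<open>1, \<mu>, \<dots>, \<mu>\<^sup>4\<close>.
\<close>

lemma vertex_large_cotangent:
  fixes F :: "5 cpoly" and t :: "'j \<Rightarrow> 5 rational_function"
  assumes a: "a = weights_11114 \<or> a = weights_11125"
    and X: "X = {q \<in> wproj a. vanishes_at F q}" and F: "F \<noteq> 0" "whomogeneous a d F"
    and p: "p \<in> X" "(\<lambda>_. 0)(4 := 1) \<in> p"
    and T: "finite T" "card T < 5"
  shows "\<not> cotangent_generators a X p T t"
proof
  assume gen: "cotangent_generators a X p T t"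
  have a4: "a 4 = 4 \<or> a 4 = 5" and a012: "a 0 = 1" "a 1 = 1" "a 2 = 1" and a3: "a 3 = 1 \<or> a 3 = 2"
    using a by auto
  show False
  proof (rule quotient_point_large_cotangent[OF X F p _ _ _ _ _ _ _ T gen,
      where b = "a(4 := 0)" and \<alpha> = "\<lambda>\<mu>. (\<lambda>_. 0)(1 := \<mu>, 2 := 1)" and N = "\<lambda>_. 1"
        and q = "\<lambda>\<beta> i. linear_projection \<beta> 1 0 1 ^ i * linear_projection \<beta> 2 0 1 ^ (a 4 - i)"])
    show "a 4 > 0" using a4 by auto
    show "(a(4 := 0)) i > 0" if "i \<noteq> 4" for i
      using that a012 a3 by (cases i rule: five_cases) auto
    show "(a(4 := 0)) i mod a 4 = a i mod a 4" for i
      by simp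
    fix \<beta> :: "5 \<Rightarrow> complex" and i :: nat
    assume i: "i < 5"
    then have i4: "i \<le> a 4" using a4 by auto
    have "whomogeneous a (i * a 1 + (a 4 - i) * a 2)
        (linear_projection \<beta> 1 0 1 ^ i * linear_projection \<beta> 2 0 1 ^ (a 4 - i))"
      using a012 by (intro whomogeneous_mult whomogeneous_power whomogeneous_linear_projection[of _ 0] whomogeneous_one) auto
    then show "whomogeneous a (1 * a 4) (linear_projection \<beta> 1 0 1 ^ i * linear_projection \<beta> 2 0 1 ^ (a 4 - i))"
      using i4 by (simp add: a012)
    fix \<mu> \<tau> \<sigma> :: complex
    assume \<beta>: "\<And>j. \<beta> j \<noteq> 0" "\<beta> 4 = 1"
    let ?c = "curve (a(4 := 0)) \<beta> ((\<lambda>_. 0)(1 := \<mu>, 2 := 1)) \<tau> \<sigma>"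
    have "poly_at ?c (linear_projection \<beta> 1 0 1) = \<tau> * \<mu>"
      using linear_projection_curve[of \<beta> 0 "a(4 := 0)" 1 "(\<lambda>_. 0)(1 := \<mu>, 2 := 1)" \<tau> \<sigma> 1] \<beta>(1) a012 by simp
    moreover have "poly_at ?c (linear_projection \<beta> 2 0 1) = \<tau>"
      using linear_projection_curve[of \<beta> 0 "a(4 := 0)" 2 "(\<lambda>_. 0)(1 := \<mu>, 2 := 1)" \<tau> \<sigma> 1] \<beta>(1) a012 by simp
    moreover have "\<tau> ^ i * \<tau> ^ (a 4 - i) = \<tau> ^ a 4"
      using i4 by (simp flip: power_add)
    ultimately show "poly_at ?c (linear_projection \<beta> 1 0 1 ^ i * linear_projection \<beta> 2 0 1 ^ (a 4 - i)) = \<tau> ^ a 4 * \<mu> ^ i"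
      by (simp add: power_mult_distrib)
  qed simp_all
qed

text \<open>
  Here the stabilizer has order two and acts by \<open>-1\<close> on all four other coordinates, so that \<open>w\<close> can be
  given weight one instead of five. Three projections with values proportional to \<open>\<mu>\<close>, \<open>1\<close> and \<open>\<mu>\<^sup>3\<close>
  yield five quadratic forms with values proportional to \<open>1, \<mu>, \<mu>\<^sup>2, \<mu>\<^sup>3, \<mu>\<^sup>4\<close>.
\<close>

lemma half_point_large_cotangent:
  fixes F :: "5 cpoly" and t :: "'j \<Rightarrow> 5 rational_function"
  defines "a \<equiv> weights_11125"
  assumes X: "X = {q \<in> wproj a. vanishes_at F q}" and F: "F \<noteq> 0" "whomogeneous a d F"
    and p: "p \<in> X" "(\<lambda>_. 0)(3 := 1) \<in> p"
    and T: "finite T" "card T < 5"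
  shows "\<not> cotangent_generators a X p T t"
proof
  assume gen: "cotangent_generators a X p T t"
  define L :: "(5 \<Rightarrow> complex) \<Rightarrow> 5 \<Rightarrow> 5 cpoly" where
    "L \<beta> i = linear_projection \<beta> i 0 (if i = 4 then pvar 3 ^ 2 else 1)" for \<beta> i
  define q where "q \<beta> = (!) [L \<beta> 2 * L \<beta> 2, L \<beta> 1 * L \<beta> 2, L \<beta> 1 * L \<beta> 1, L \<beta> 2 * L \<beta> 4, L \<beta> 1 * L \<beta> 4]" for \<beta>
  \<comment> \<open>The weight of the last coordinate, five, is replaced by one, which has the same parity.\<close>
  define b :: "5 \<Rightarrow> nat" where "b = (\<lambda>_. 1)(3 := 0)"
  define \<alpha> :: "complex \<Rightarrow> 5 \<Rightarrow> complex" where "\<alpha> \<mu> = (\<lambda>_. 0)(1 := \<mu>, 2 := 1, 4 := \<mu> ^ 3)" for \<mu>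
  have less_5: "i = 0 \<or> i = 1 \<or> i = 2 \<or> i = 3 \<or> i = 4" if "i < 5" for i :: nat
    using that by auto
  have L_hom: "whomogeneous a 1 (L \<beta> 1)" "whomogeneous a 1 (L \<beta> 2)" "whomogeneous a 5 (L \<beta> 4)" for \<beta>
    using whomogeneous_linear_projection[of a 0 1 1 0 \<beta>] whomogeneous_linear_projection[of a 0 1 2 0 \<beta>]
      whomogeneous_linear_projection[of a 4 "pvar 3 ^ 2" 4 0 \<beta>] whomogeneous_one[of a]
      whomogeneous_power[OF whomogeneous_pvar[of a 3], of 2]
    by (simp_all add: a_def L_def)
  show False
  proof (rule quotient_point_large_cotangent[OF X F p _ _ _ _ _ _ _ T gen,
      where b = b and \<alpha> = \<alpha> and N = "(!) [1, 1, 1, 3, 3]" and q = q])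
    show "a 3 > 0" "b 3 = 0" by (simp_all add: a_def b_def)
    show "b i > 0" if "i \<noteq> 3" for i
      using that by (simp add: b_def)
    show "b i mod a 3 = a i mod a 3" for i
      by (cases i rule: five_cases) (simp_all add: a_def b_def)
    show "\<alpha> \<mu> 3 = 0" for \<mu>
      by (simp add: \<alpha>_def)
    fix \<beta> :: "5 \<Rightarrow> complex" and i :: nat
    assume i: "i < 5"
    have L2: "whomogeneous a 2 (L \<beta> 2 * L \<beta> 2)" "whomogeneous a 2 (L \<beta> 1 * L \<beta> 2)" "whomogeneous a 2 (L \<beta> 1 * L \<beta> 1)"
      "whomogeneous a 6 (L \<beta> 2 * L \<beta> 4)" "whomogeneous a 6 (L \<beta> 1 * L \<beta> 4)"
      using whomogeneous_mult[OF L_hom(2,2)] whomogeneous_mult[OF L_hom(1,2)] whomogeneous_mult[OF L_hom(1,1)]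
        whomogeneous_mult[OF L_hom(2,3)] whomogeneous_mult[OF L_hom(1,3)] by (simp_all add: numeral_2_eq_2)
    show "whomogeneous a ([1, 1, 1, 3, 3] ! i * a 3) (q \<beta> i)"
      using less_5[OF i] L2 by (auto simp: q_def a_def)
    fix \<mu> \<tau> \<sigma> :: complex
    assume \<beta>: "\<And>j. \<beta> j \<noteq> 0" "\<beta> 3 = 1"
    let ?c = "curve b \<beta> (\<alpha> \<mu>) \<tau> \<sigma>"
    have "?c 3 = 1"
      by (simp add: curve_def b_def \<alpha>_def \<beta>(2))
    then have "poly_at ?c (L \<beta> 1) = \<tau> * \<mu>" "poly_at ?c (L \<beta> 2) = \<tau>" "poly_at ?c (L \<beta> 4) = \<tau> * \<mu> ^ 3"
      using linear_projection_curve[of \<beta> 0 b 1 "\<alpha> \<mu>" \<tau> \<sigma> 1] linear_projection_curve[of \<beta> 0 b 2 "\<alpha> \<mu>" \<tau> \<sigma> 1]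
        linear_projection_curve[of \<beta> 0 b 4 "\<alpha> \<mu>" \<tau> \<sigma> "pvar 3 ^ 2"] \<beta>(1)
      by (simp_all add: L_def b_def \<alpha>_def)
    then show "poly_at ?c (q \<beta> i) = \<tau> ^ a 3 * \<mu> ^ i"
      using less_5[OF i] by (auto simp: q_def a_def power2_eq_square power3_eq_cube power4_eq_xxxx)
  qed
qed

lemma ordinary_triple_point_generators:
  assumes "ordinary_triple_point a X p"
  obtains t where "cotangent_generators a X p (UNIV :: 4 set) t"
  using assms tangent_cone_generators unfolding ordinary_triple_point_def by metis

lemma ordinary_triple_point_cone:
  assumes "ordinary_triple_point a X p" "X \<subseteq> wproj a" "x \<in> p"
  obtains t and c :: "4 cpoly" where "cubic_tangent_cone a p x X t c"
proof -
  have "p \<in> X"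
    using assms(1) by (simp add: ordinary_triple_point_def isolated_singular_point_3fold_def singular_point_3fold_def)
  then have p: "p \<in> X" "p \<in> wproj a" using assms(2) by auto
  obtain c :: "4 cpoly" where c: "smooth_cubic_surface_form c" "tangent_cone_iso a X p c"
    using assms(1) by (auto simp: ordinary_triple_point_def)
  obtain t :: "4 \<Rightarrow> _" where t: "\<forall>i. t i \<in> local_filtration a X p 1"
    "\<forall>k. \<forall>f \<in> local_filtration a X p k. \<exists>g. whomogeneous (\<lambda>_. 1) k g \<and>
        f - peval const_fun t g \<in> local_filtration a X p (Suc k)"
    "\<forall>k g. whomogeneous (\<lambda>_. 1) k g \<longrightarrow>
        (peval const_fun t g \<in> local_filtration a X p (Suc k) \<longleftrightarrow> c dvd g)"
    using c(2) unfolding tangent_cone_iso_def by blast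
  have "cubic_tangent_cone a p x X t c"
  proof unfold_locales
    show "whomogeneous (\<lambda>_. 1) 3 c"
      using c(1) by (simp add: smooth_cubic_surface_form_def)
  qed (use p assms(3) t in blast)+
  then show thesis by (rule that)
qed

lemma double_cover_no_triple_point:
  fixes F :: "5 cpoly"
  assumes a: "(a = weights_11114 \<and> d = 8) \<or> (a = weights_11125 \<and> d = 10)"
    and X: "X = {q \<in> wproj a. vanishes_at F q}" and F: "whomogeneous a d F"
    and nz: "poly_at ((\<lambda>_. 0)(4 := 1)) F \<noteq> 0"
    and x: "x \<in> p" "a i = 1" "x i \<noteq> 0"
  shows "\<not> ordinary_triple_point a X p"
proof
  assume "ordinary_triple_point a X p"
  then obtain t and c :: "4 cpoly" where "cubic_tangent_cone a p x X t c"
    by (rule ordinary_triple_point_cone) (use X x in auto)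
  then interpret cubic_tangent_cone a p x X t c .
  have i: "i \<noteq> 4" using x(2) a by auto
  have nz_i: "pvar i \<noteq> 0"
    using x(3) poly_at_nonzeroD[of x "pvar i"] by simp
  show False
  proof (rule double_cover_no_cubic_cone[of "Fract (pvar i) 1" i 4 d F])
    show "degree_one_unit (Fract (pvar i) 1)"
      unfolding degree_one_unit_def
      using whomogeneous_pvar[of a i] whomogeneous_one[of a] x
      by (intro exI[of _ "pvar i"] exI[of _ 1] exI[of _ 0]) auto
    show "chart a (Fract (pvar i) 1) i = 1"
      using x(2) nz_i by (simp add: chart_def Zero_fract_def eq_fract)
    show "\<forall>q\<in>X. vanishes_at F q" using X by simp
    show "Poly_Mapping.lookup F (Poly_Mapping.single 4 2) \<noteq> 0"
      by (rule double_cover_square_coefficient[OF a F nz])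
    show "Poly_Mapping.lookup m 4 \<le> 1 \<or> m = Poly_Mapping.single 4 2" if "m \<in> Poly_Mapping.keys F" for m
      by (rule double_cover_keys[OF a F that])
  qed (use F i in auto)
qed

lemma sum_over_two_keys:
  assumes "m \<noteq> n" "\<And>k. k \<in> Poly_Mapping.keys F \<Longrightarrow> k \<noteq> m \<Longrightarrow> k \<noteq> n \<Longrightarrow> h k = 0"
  shows "(\<Sum>k\<in>Poly_Mapping.keys F. Poly_Mapping.lookup F k * h k)
    = Poly_Mapping.lookup F m * h m + Poly_Mapping.lookup F n * (h n :: 'c::comm_ring_1)"
proof -
  have "(\<Sum>k\<in>Poly_Mapping.keys F. Poly_Mapping.lookup F k * h k)
      = (\<Sum>k\<in>Poly_Mapping.keys F \<union> {m, n}. Poly_Mapping.lookup F k * h k)"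
    by (rule sum.mono_neutral_left) (auto simp: in_keys_iff)
  also have "\<dots> = (\<Sum>k\<in>{m, n}. Poly_Mapping.lookup F k * h k)"
    by (rule sum.mono_neutral_right) (use assms(2) in \<open>auto simp: in_keys_iff\<close>)
  finally show ?thesis using assms(1) by simp
qed

lemma prod_single_power: "(\<Prod>i\<in>UNIV. x i ^ Poly_Mapping.lookup (Poly_Mapping.single j n) i) = (x j ^ n :: 'c::comm_monoid_mult)"
  for j :: "'n::finite"
proof -
  have "(\<Prod>i\<in>UNIV. x i ^ Poly_Mapping.lookup (Poly_Mapping.single j n) i) = (\<Prod>i\<in>UNIV. if i = j then x j ^ n else 1)"
    by (intro prod.cong) (auto simp: lookup_single when_def)
  then show ?thesis by simp
qed

lemma weights_11125_keys:
  assumes "whomogeneous weights_11125 10 F" "m \<in> Poly_Mapping.keys F"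
    "m \<noteq> Poly_Mapping.single 4 2" "m \<noteq> Poly_Mapping.single 3 5"
  shows "Poly_Mapping.lookup m 0 \<noteq> 0 \<or> Poly_Mapping.lookup m 1 \<noteq> 0 \<or> Poly_Mapping.lookup m 2 \<noteq> 0"
proof (rule ccontr)
  let ?l = "Poly_Mapping.lookup m"
  assume "\<not> ?thesis"
  then have 0: "?l 0 = 0" "?l 1 = 0" "?l 2 = 0" by auto
  have sum: "2 * ?l 3 + 5 * ?l 4 = 10"
    using bspec[OF assms(1)[unfolded whomogeneous_def] assms(2)] 0 by (simp add: sum_5)
  have solutions: "u = 5 \<and> v = 0 \<or> u = 0 \<and> v = 2" if "2 * u + 5 * v = 10" for u v :: nat
    using that by presburger
  from solutions[OF sum] show False
  proof (elim disjE conjE)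
    assume 1: "?l 3 = 5" "?l 4 = 0"
    have "m = Poly_Mapping.single 3 5"
    proof (rule poly_mapping_single_eqI)
      show "?l j = 0" if "j \<noteq> 3" for j
        using that 0 1 by (cases j rule: five_cases) auto
    qed (use 1 in simp)
    then show False using assms by simp
  next
    assume 2: "?l 3 = 0" "?l 4 = 2"
    have "m = Poly_Mapping.single 4 2"
    proof (rule poly_mapping_single_eqI)
      show "?l j = 0" if "j \<noteq> 4" for j
        using that 0 2 by (cases j rule: five_cases) auto
    qed (use 2 in simp)
    then show False using assms by simp
  qed
qed

text \<open>
  On the line on which the three coordinates of weight one vanish, \<open>F\<close> is \<open>c4 w\<^sup>2 + c3 y\<^sup>5\<close>. In the chart
  given by \<open>w/y\<^sup>2\<close>, with \<open>b\<close> the value of the coordinate belonging to \<open>y\<close>, this becomes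
  \<open>b\<^sup>4 (c4 + c3 b)\<close>, which has a simple zero. So a tangent vector that kills the three coordinates of
  weight one also kills the other two.
\<close>

lemma open_edge_no_triple_point:
  fixes F :: "5 cpoly"
  defines "a \<equiv> weights_11125"
  assumes X: "X = {q \<in> wproj a. vanishes_at F q}" and F: "whomogeneous a 10 F"
    and nz: "poly_at ((\<lambda>_. 0)(4 := 1)) F \<noteq> 0"
    and p: "p \<in> X" and x: "x \<in> p" "x 0 = 0" "x 1 = 0" "x 2 = 0" "x 3 \<noteq> 0" "x 4 \<noteq> 0"
  shows "\<not> ordinary_triple_point a X p"
proof
  assume "ordinary_triple_point a X p"
  then obtain t and c :: "4 cpoly" where "cubic_tangent_cone a p x X t c"
    by (rule ordinary_triple_point_cone) (use X x in auto)
  then interpret cubic_tangent_cone a p x X t c .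
  \<comment> \<open>The degree is \<open>5 - 2 * 2 = 1\<close>.\<close>
  define s where "s = Fract (pvar 4) (pvar 3 ^ 2 :: 5 cpoly)"
  let ?\<xi> = "chart a s"
  have s: "degree_one_unit s"
    unfolding degree_one_unit_def s_def
    using whomogeneous_pvar[of a 4] whomogeneous_power[OF whomogeneous_pvar[of a 3], of 2] x
    by (intro exI[of _ "pvar 4"] exI[of _ "pvar 3 ^ 2"] exI[of _ 4]) (auto simp: a_def)
  have \<xi>_O: "?\<xi> i \<in> \<O>" for i
    by (rule chart_local[OF s])
  have nz34: "pvar 3 \<noteq> (0 :: 5 cpoly)" "pvar 4 \<noteq> (0 :: 5 cpoly)"
    using poly_at_nonzeroD[of x "pvar 3"] poly_at_nonzeroD[of x "pvar 4"] x by auto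
  let ?v = "\<lambda>i. Fract (pvar i) 1 :: 5 rational_function"
  have v_nz: "?v 3 \<noteq> 0" "?v 4 \<noteq> 0"
    using nz34 by (simp_all add: Zero_fract_def eq_fract)
  have s_eq: "s = ?v 4 / ?v 3 ^ 2"
    by (simp add: s_def Fract_power)
  have \<xi>4: "?\<xi> 4 = ?\<xi> 3 ^ 2"
    unfolding chart_def s_eq a_def using v_nz by (simp add: field_simps flip: power_mult power_Suc power_add)
  have \<xi>3: "?\<xi> 3 = Fract (pvar 3 ^ 5) (pvar 4 ^ 2)"
  proof -
    have "?\<xi> 3 = ?v 3 ^ 5 / ?v 4 ^ 2"
      unfolding chart_def s_eq a_def using v_nz by (simp add: field_simps flip: power_mult power_Suc power_add)
    then show ?thesis by (simp add: Fract_power)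
  qed
  define b where "b = frac_at x (?\<xi> 3)"
  have b: "b = x 3 ^ 5 / x 4 ^ 2"
    unfolding b_def \<xi>3 using x by (subst frac_at_Fract) auto
  have \<xi>_0: "frac_at x (?\<xi> j) = 0" if "j \<in> {0, 1, 2}" for j
    using degree_one_unit_local(2)[OF s whomogeneous_pvar[of a j]] that x by (auto simp: chart_def)
  let ?c4 = "Poly_Mapping.lookup F (Poly_Mapping.single 4 2)" and ?c3 = "Poly_Mapping.lookup F (Poly_Mapping.single 3 5)"
  have ne: "Poly_Mapping.single (4::5) (2::nat) \<noteq> Poly_Mapping.single 3 5"
  proof
    assume "Poly_Mapping.single (4::5) (2::nat) = Poly_Mapping.single 3 5"
    then have "Poly_Mapping.lookup (Poly_Mapping.single (4::5) (2::nat)) 4 = Poly_Mapping.lookup (Poly_Mapping.single (3::5) (5::nat)) 4"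
      by simp
    then show False by (simp add: lookup_single)
  qed
  have c4: "?c4 \<noteq> 0"
    by (rule double_cover_square_coefficient[OF _ F nz]) (simp add: a_def)
  have keys: "\<exists>j\<in>{0, 1, 2}. Poly_Mapping.lookup m j \<noteq> 0"
    if "m \<in> Poly_Mapping.keys F" "m \<noteq> Poly_Mapping.single 4 2" "m \<noteq> Poly_Mapping.single 3 5" for m
    using weights_11125_keys[of F m] F that by (auto simp: a_def)
  have "poly_at x F = ?c4 * (\<Prod>i\<in>UNIV. x i ^ Poly_Mapping.lookup (Poly_Mapping.single 4 2) i)
      + ?c3 * (\<Prod>i\<in>UNIV. x i ^ Poly_Mapping.lookup (Poly_Mapping.single 3 5) i)"
    unfolding peval_def
  proof (rule sum_over_two_keys[OF ne])
    fix m assume "m \<in> Poly_Mapping.keys F" "m \<noteq> Poly_Mapping.single 4 2" "m \<noteq> Poly_Mapping.single 3 5"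
    then obtain j where "j \<in> {0, 1, 2}" "Poly_Mapping.lookup m j \<noteq> 0"
      using keys by blast
    then have "x j ^ Poly_Mapping.lookup m j = 0"
      using x by auto
    then show "(\<Prod>i\<in>UNIV. x i ^ Poly_Mapping.lookup m i) = 0"
      by (metis finite_class.finite_UNIV UNIV_I prod_zero)
  qed
  also have "poly_at x F = 0"
    using p X x(1) by (auto simp: vanishes_at_def)
  finally have "?c4 * x 4 ^ 2 + ?c3 * x 3 ^ 5 = 0"
    by (simp add: prod_single_power)
  then have rel: "?c4 + ?c3 * b = 0"
    using x by (simp add: b field_simps)
  have b0: "b \<noteq> 0" using rel c4 by auto
  show False
  proof (rule smooth_hypersurface_no_cubic_cone[OF s, of "{0, 1, 2}" 10 F])
    show "card {0, 1, 2 :: 5} < CARD(4)" by simp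
    show "\<forall>q\<in>X. vanishes_at F q" using X by simp
    fix z :: "4 \<Rightarrow> complex" and i :: 5
    let ?D = "tangent_derivation z"
    assume D0: "\<And>j. j \<in> {0, 1, 2} \<Longrightarrow> ?D (?\<xi> j) = 0"
      and DF: "(\<Sum>m\<in>Poly_Mapping.keys F. Poly_Mapping.lookup F m * ?D (\<Prod>i\<in>UNIV. ?\<xi> i ^ Poly_Mapping.lookup m i)) = 0"
    have "?D (\<Prod>i\<in>UNIV. ?\<xi> i ^ Poly_Mapping.lookup m i) = 0"
      if m: "m \<in> Poly_Mapping.keys F" "m \<noteq> Poly_Mapping.single 4 2" "m \<noteq> Poly_Mapping.single 3 5" for m
    proof -
      obtain j where j: "j \<in> {0, 1, 2}" "Poly_Mapping.lookup m j \<noteq> 0"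
        using keys m by blast
      then obtain n where n: "Poly_Mapping.lookup m j = Suc n"
        using not0_implies_Suc by blast
      have "(\<Prod>i\<in>UNIV. ?\<xi> i ^ Poly_Mapping.lookup m i) =
          ?\<xi> j ^ Suc n * (\<Prod>i\<in>UNIV - {j}. ?\<xi> i ^ Poly_Mapping.lookup m i)"
        by (simp add: prod.remove[of UNIV j] n)
      moreover have "?D (?\<xi> j ^ Suc n) = 0" "frac_at x (?\<xi> j ^ Suc n) = 0"
        using tangent_derivation_power(1)[OF \<xi>_O[of j], where z = z and n = n] tangent_derivation_power(2)[OF \<xi>_O[of j], where n = "Suc n"]
          D0[OF j(1)] \<xi>_0[OF j(1)] by simp_all
      moreover have "?\<xi> j ^ Suc n \<in> \<O>" "(\<Prod>i\<in>UNIV - {j}. ?\<xi> i ^ Poly_Mapping.lookup m i) \<in> \<O>"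
        by (intro local_ring_prod local_ring_power \<xi>_O)+
      ultimately show ?thesis
        by (simp only: tangent_derivation_mult mult_zero_left mult_zero_right add_0)
    qed
    then have "?c4 * ?D (?\<xi> 4 ^ 2) + ?c3 * ?D (?\<xi> 3 ^ 5) = 0"
      using DF sum_over_two_keys[OF ne, of F "\<lambda>m. ?D (\<Prod>i\<in>UNIV. ?\<xi> i ^ Poly_Mapping.lookup m i)"]
      by (simp add: prod_single_power)
    moreover have "?D (?\<xi> 4 ^ 2) = 4 * b ^ 3 * ?D (?\<xi> 3)"
      using tangent_derivation_power(1)[OF \<xi>_O[of 3], where z = z and n = 3] by (simp add: \<xi>4 b_def flip: power_mult)
    moreover have "?D (?\<xi> 3 ^ 5) = 5 * b ^ 4 * ?D (?\<xi> 3)"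
      using tangent_derivation_power(1)[OF \<xi>_O[of 3], where z = z and n = 4] by (simp add: b_def)
    ultimately have "b ^ 3 * (4 * (?c4 + ?c3 * b) + ?c3 * b) * ?D (?\<xi> 3) = 0"
      by (simp add: algebra_simps power_numeral_reduce)
    moreover have "?c3 * b \<noteq> 0"
      using rel c4 by auto
    ultimately have D3: "?D (?\<xi> 3) = 0"
      using b0 by (simp add: rel)
    then have D4: "?D (?\<xi> 4) = 0"
      using tangent_derivation_power(1)[OF \<xi>_O[of 3], where z = z and n = 1] by (simp add: \<xi>4 numeral_2_eq_2)
    show "?D (?\<xi> i) = 0"
      using D0 D3 D4 by (cases i rule: five_cases) auto
  qed (use F in auto)
qed

theorem proposition6p2:
  fixes a :: "5 \<Rightarrow> nat" and d :: nat and X :: "(5 \<Rightarrow> complex) set set"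
  assumes "(a = weights_11114 \<and> d = 8) \<or> (a = weights_11125 \<and> d = 10)"
    and "wproj_hypersurface a d X"
    and "\<And>p. singular_point_3fold a X p \<Longrightarrow> ordinary_triple_point a X p"
  shows "\<not> (\<exists>p\<in>X. ordinary_triple_point a X p)"
proof
  let ?v = "(\<lambda>_. 0)(4 := 1) :: 5 \<Rightarrow> complex"
  obtain F where F: "F \<noteq> 0" "whomogeneous a d F" and X: "X = {q \<in> wproj a. vanishes_at F q}"
    using assms(2) by (auto simp: wproj_hypersurface_def)
  have a: "a = weights_11114 \<or> a = weights_11125" using assms(1) by auto
  have nz: "poly_at ?v F \<noteq> 0"
  proof
    assume 0: "poly_at ?v F = 0"
    have "?v \<noteq> (\<lambda>_. 0)" by (metis fun_upd_same zero_neq_one)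
    then obtain v where v: "v \<in> X" "?v \<in> v"
      using hypersurface_point[OF X F(2) _ 0] by blast
    have "\<not> cotangent_dim a X v 3"
      using cotangent_dim_generators[of a X v 3] vertex_large_cotangent[OF a X F v, of "{..<3::nat}"] by auto
    then have "ordinary_triple_point a X v"
      using v(1) by (intro assms(3)) (simp add: singular_point_3fold_def)
    then show False
    proof (rule ordinary_triple_point_generators)
      fix t assume "cotangent_generators a X v (UNIV :: 4 set) t"
      then show False
        using vertex_large_cotangent[OF a X F v, of "UNIV :: 4 set" t] by simp
    qed
  qed
  assume "\<exists>p\<in>X. ordinary_triple_point a X p"
  then obtain p where p: "p \<in> X" "ordinary_triple_point a X p" by blast
  have pw: "p \<in> wproj a" using p X by auto
  then obtain z where z: "z \<noteq> (\<lambda>_. 0)" "p = wproj_rel a `` {z}"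
    by (auto simp: wproj_def elim!: quotientE)
  have orbit: "(\<lambda>i. l ^ a i * z i) \<in> p" if "l \<noteq> 0" for l
  proof -
    have "(\<lambda>i. l ^ a i * z i) \<noteq> (\<lambda>_. 0)"
      using z(1) that by (auto simp: fun_eq_iff)
    then show ?thesis using z that by (auto simp: wproj_rel_def)
  qed
  have zp: "z \<in> p" using orbit[of 1] by simp
  have no_unit: "z i = 0" if "a i = 1" for i
    using double_cover_no_triple_point[OF assms(1) X F(2) nz zp that] p(2) by blast
  \<comment> \<open>Such a point would be the vertex of the last coordinate, which is not on \<open>X\<close>.\<close>
  have not_vertex: "\<not> (\<forall>i. i \<noteq> 4 \<longrightarrow> z i = 0)"
  proof
    assume 0: "\<forall>i. i \<noteq> 4 \<longrightarrow> z i = 0"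
    have a4: "a 4 > 0" using a by auto
    obtain l where l: "l ^ a 4 = z 4"
      using exists_root[OF a4] by blast
    have "z = (\<lambda>i. l ^ a i * ?v i)"
      using 0 l by auto
    then have "poly_at z F = l ^ d * poly_at ?v F"
      using poly_at_scale[OF F(2), of l ?v] by simp
    moreover have "poly_at z F = 0"
      using p(1) X zp by (auto simp: vanishes_at_def)
    ultimately have "l = 0" using nz by simp
    then have "z 4 = 0" using l a4 by (auto simp: power_0_left)
    then show False using 0 z(1) by (metis ext)
  qed
  have a25: "a = weights_11125"
  proof (rule ccontr)
    assume "a \<noteq> weights_11125"
    then have "a = weights_11114" using a by simp
    then have "z i = 0" if "i \<noteq> 4" for i
      using that no_unit by (cases i rule: five_cases) auto
    then show False using not_vertex by blast
  qed
  then have d: "d = 10" using assms(1) by (auto simp: weights_11114_def weights_11125_def fun_eq_iff split: if_splits)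
  have z012: "z 0 = 0" "z 1 = 0" "z 2 = 0"
    using no_unit a25 by simp_all
  have z3: "z 3 \<noteq> 0"
  proof
    assume "z 3 = 0"
    then have "z i = 0" if "i \<noteq> 4" for i
      using that z012 by (cases i rule: five_cases) auto
    then show False using not_vertex by blast
  qed
  show False
  proof (cases "z 4 = 0")
    case False
    then show False
      using open_edge_no_triple_point[of X F p z] X F(2) nz p zp z012 z3 a25 d by blast
  next
    case True
    obtain l where l: "l ^ 2 = inverse (z 3)"
      using exists_root[of 2] by auto
    have "l \<noteq> 0" using l z3 by auto
    then have "(\<lambda>i. l ^ a i * z i) \<in> p" by (rule orbit)
    moreover have "(\<lambda>i. l ^ a i * z i) = (\<lambda>_. 0)(3 := 1)"
    proof
      fix i :: 5
      show "l ^ a i * z i = ((\<lambda>_. 0)(3 := 1)) i"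
        using z012 True l z3 a25 by (cases i rule: five_cases) auto
    qed
    ultimately have "(\<lambda>_. 0)(3 := 1) \<in> p" by simp
    then show False
      using half_point_large_cotangent[of X F d p "UNIV :: 4 set"] ordinary_triple_point_generators[OF p(2)] X F p(1) a25
      by auto
  qed
qed

end
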